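(* Let $b$ be a finite Blaschke product, $C_b=\pi(J^{1/2})\Gamma_b$, and $C_{b+}$ the restriction of $C_b$ to $H^2(\mathbb{T})$. (1) A bounded operator $T$ on $L^2(\mathbb{T})$ satisfies $T\pi(\varphi)=\pi(\varphi\circ b)T$ for all $\varphi\in L^\infty(\mathbb{T})$ if and only if $T=\pi(m)C_b$ for some $m\in L^\infty(\mathbb{T})$. (2) A bounded operator $T$ on $H^2(\mathbb{T})$ satisfies $T\tau(\varphi)=\tau(\varphi\circ b)T$ for all $\varphi\in H^\infty(\mathbb{T})$ if and only if $T=\tau(m)C_{b+}$ for some $m\in H^\infty(\mathbb{T})$. Furthermore, if $T=\pi(m)C_b$ with $m\in L^\infty(\mathbb{T})$ (respectively $T=\tau(m)C_{b+}$ with $m\in H^\infty(\mathbb{T})$), then $\|T\|=\|\mathcal{L}(|m|^2)\|_\infty^{1/2}$, and $T$ is an isometry if and only if $\mathcal{L}(|m|^2)=1$ a.e.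
   Context: $b=\prod_{j=1}^N b_{\alpha_j}$ is a finite Blaschke product with $N$ zeros in $\mathbb{D}$ ($b_w(z)=\frac{|w|}{w}\frac{w-z}{1-\overline{w}z}$, $b_0(z)=z$). $\pi(\varphi)$ is multiplication by $\varphi$ on $L^2(\mathbb{T})$ and $\tau(\varphi)=P\pi(\varphi)|_{H^2(\mathbb{T})}$ is the Toeplitz operator ($P$ the orthogonal projection onto $H^2(\mathbb{T})$). $\Gamma_b\xi=\xi\circ b$ (bounded on $L^2(\mathbb{T})$). $J_0(z)=\frac{zb'(z)}{Nb(z)}$, and $J$ is the outer function with $J(0)>0$ and $|J|=J_0$ on $\mathbb{T}$; $J^{1/2}$ is its outer square root (in $H^\infty$ with inverse in $H^\infty$). $C_b$ is an isometry reduced by $H^2(\mathbb{T})$. The transfer operator is $\mathcal{L}(\xi)(z)=\frac1N\sum_{b(w)=z}\xi(w)$. *)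

theory Defs
  imports "HOL-Analysis.Analysis"
begin

text \<open>Elements of L2(T) etc. are represented by functions complex => complex,
  of which only the values on the unit circle matter (the measure lives on T);
  equality in L2 is almost-everywhere equality.\<close>

definition circ_meas :: "complex measure" where
  "circ_meas = distr (density lborel (\<lambda>t. ennreal (indicator {0..2*pi} t / (2*pi))))
                     (borel :: complex measure) cis"

definition L2T :: "(complex \<Rightarrow> complex) set" where
  "L2T = {f. f \<in> borel_measurable circ_meas \<and> integrable circ_meas (\<lambda>z. (cmod (f z))^2)}"

definition L2norm :: "(complex \<Rightarrow> complex) \<Rightarrow> real" where
  "L2norm f = sqrt (LINT z|circ_meas. (cmod (f z))^2)"

definition L2inner :: "(complex \<Rightarrow> complex) \<Rightarrow> (complex \<Rightarrow> complex) \<Rightarrow> complex" where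
  "L2inner f g = (LINT z|circ_meas. f z * cnj (g z))"

definition LinfT :: "(complex \<Rightarrow> complex) set" where
  "LinfT = {f. f \<in> borel_measurable circ_meas \<and> (\<exists>C. AE z in circ_meas. cmod (f z) \<le> C)}"

definition Linf_norm :: "(complex \<Rightarrow> 'a::real_normed_vector) \<Rightarrow> real" where
  "Linf_norm f = Inf {C. 0 \<le> C \<and> (AE z in circ_meas. norm (f z) \<le> C)}"

definition fourier :: "(complex \<Rightarrow> complex) \<Rightarrow> int \<Rightarrow> complex" where
  "fourier f n = (LINT z|circ_meas. f z * z powi (- n))"

definition H2T :: "(complex \<Rightarrow> complex) set" where
  "H2T = {f \<in> L2T. \<forall>n<0. fourier f n = 0}"

definition HinfT :: "(complex \<Rightarrow> complex) set" where
  "HinfT = {f \<in> LinfT. \<forall>n<0. fourier f n = 0}"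

definition Pproj :: "(complex \<Rightarrow> complex) \<Rightarrow> (complex \<Rightarrow> complex)" where
  "Pproj f = (SOME g. g \<in> H2T \<and> (\<forall>h\<in>H2T. L2inner (\<lambda>z. f z - g z) h = 0))"

definition mult :: "(complex \<Rightarrow> complex) \<Rightarrow> (complex \<Rightarrow> complex) \<Rightarrow> (complex \<Rightarrow> complex)" where
  "mult \<phi> f = (\<lambda>z. \<phi> z * f z)"

definition toeplitz :: "(complex \<Rightarrow> complex) \<Rightarrow> (complex \<Rightarrow> complex) \<Rightarrow> (complex \<Rightarrow> complex)" where
  "toeplitz \<phi> f = Pproj (mult \<phi> f)"

definition bounded_op :: "(complex \<Rightarrow> complex) set \<Rightarrow>
    ((complex \<Rightarrow> complex) \<Rightarrow> (complex \<Rightarrow> complex)) \<Rightarrow> bool" where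
  "bounded_op V T \<longleftrightarrow>
     (\<forall>f\<in>V. T f \<in> V) \<and>
     (\<forall>f\<in>V. \<forall>g\<in>V. (AE z in circ_meas. f z = g z) \<longrightarrow> (AE z in circ_meas. T f z = T g z)) \<and>
     (\<forall>f\<in>V. \<forall>g\<in>V. \<forall>c. AE z in circ_meas. T (\<lambda>w. c * f w + g w) z = c * T f z + T g z) \<and>
     (\<exists>C. \<forall>f\<in>V. L2norm (T f) \<le> C * L2norm f)"

definition op_eq :: "(complex \<Rightarrow> complex) set \<Rightarrow>
    ((complex \<Rightarrow> complex) \<Rightarrow> (complex \<Rightarrow> complex)) \<Rightarrow>
    ((complex \<Rightarrow> complex) \<Rightarrow> (complex \<Rightarrow> complex)) \<Rightarrow> bool" where
  "op_eq V T S \<longleftrightarrow> (\<forall>f\<in>V. AE z in circ_meas. T f z = S f z)"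

definition opnorm :: "(complex \<Rightarrow> complex) set \<Rightarrow>
    ((complex \<Rightarrow> complex) \<Rightarrow> (complex \<Rightarrow> complex)) \<Rightarrow> real" where
  "opnorm V T = Sup {L2norm (T f) | f. f \<in> V \<and> L2norm f \<le> 1}"

definition isometry_on :: "(complex \<Rightarrow> complex) set \<Rightarrow>
    ((complex \<Rightarrow> complex) \<Rightarrow> (complex \<Rightarrow> complex)) \<Rightarrow> bool" where
  "isometry_on V T \<longleftrightarrow> (\<forall>f\<in>V. L2norm (T f) = L2norm f)"

definition bfac :: "complex \<Rightarrow> complex \<Rightarrow> complex" where
  "bfac w z = (if w = 0 then z else (of_real (cmod w) / w) * ((w - z) / (1 - cnj w * z)))"

definition blaschke :: "complex list \<Rightarrow> complex \<Rightarrow> complex" where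
  "blaschke \<alpha>s z = prod_list (map (\<lambda>a. bfac a z) \<alpha>s)"

definition J0 :: "complex list \<Rightarrow> complex \<Rightarrow> complex" where
  "J0 \<alpha>s z = z * deriv (blaschke \<alpha>s) z / (of_nat (length \<alpha>s) * blaschke \<alpha>s z)"

text \<open>Outer function in the disc with boundary log-modulus k and positive value at 0
  (Herglotz representation).\<close>
definition outer_fn :: "(complex \<Rightarrow> real) \<Rightarrow> complex \<Rightarrow> complex" where
  "outer_fn k z = exp (LINT w|circ_meas. ((w + z) / (w - z)) * of_real (k w))"

text \<open>J: outer, J(0)>0, |J| = J0 on T.  J^(1/2): its outer square root.\<close>
definition J_outer :: "complex list \<Rightarrow> complex \<Rightarrow> complex" where
  "J_outer \<alpha>s = outer_fn (\<lambda>w. ln (cmod (J0 \<alpha>s w)))"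

definition J_half :: "complex list \<Rightarrow> complex \<Rightarrow> complex" where
  "J_half \<alpha>s = outer_fn (\<lambda>w. ln (cmod (J0 \<alpha>s w)) / 2)"

definition J_half_bd :: "complex list \<Rightarrow> complex \<Rightarrow> complex" where
  "J_half_bd \<alpha>s w = Lim (at_left 1) (\<lambda>r::real. J_half \<alpha>s (of_real r * w))"

definition Gamma :: "complex list \<Rightarrow> (complex \<Rightarrow> complex) \<Rightarrow> (complex \<Rightarrow> complex)" where
  "Gamma \<alpha>s f = f \<circ> blaschke \<alpha>s"

definition Cb :: "complex list \<Rightarrow> (complex \<Rightarrow> complex) \<Rightarrow> (complex \<Rightarrow> complex)" where
  "Cb \<alpha>s = mult (J_half_bd \<alpha>s) \<circ> Gamma \<alpha>s"

text \<open>Transfer operator L(xi)(z) = (1/N) sum over the preimages w of z under b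
  (these lie on T when z is on T).\<close>
definition transfer :: "complex list \<Rightarrow> (complex \<Rightarrow> real) \<Rightarrow> complex \<Rightarrow> real" where
  "transfer \<alpha>s \<xi> z = (1 / real (length \<alpha>s)) *
     (\<Sum>w\<in>{w. cmod w = 1 \<and> blaschke \<alpha>s w = z}. \<xi> w)"

end

theory Submission
  imports Defs "HOL-Complex_Analysis.Complex_Analysis"
begin

text \<open>
  On the circle \<open>b (cis t) = cis (\<theta> t)\<close> with \<open>\<theta>\<close> an increasing diffeomorphism of the line,
  \<open>\<theta> (t + 2\<pi>) = \<theta> t + 2\<pi>N\<close> and \<open>\<theta>' = N J0\<close>. Substituting \<open>\<theta>\<close> gives
  \<open>\<integral> (v \<circ> b) u J0 = \<integral> v \<L>(u)\<close>, hence \<open>\<parallel>m J\<^sup>1\<^sup>/\<^sup>2 (f \<circ> b)\<parallel>\<^sup>2 = \<integral> |f|\<^sup>2 \<L>(|m|\<^sup>2)\<close>. This identity yields the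
  norm and the isometry criterion: a real \<open>g\<close> in L1 with \<open>\<integral> |p|\<^sup>2 g \<ge> 0\<close> for all polynomials \<open>p\<close>
  is nonnegative almost everywhere, so analytic polynomials already detect the supremum of \<open>\<L>(|m|\<^sup>2)\<close>, and
  H2 behaves like L2. An intertwiner \<open>T\<close> satisfies \<open>T p = (p \<circ> b) T 1\<close>; so its symbol is
  \<open>m = T 1 / J\<^sup>1\<^sup>/\<^sup>2\<close>, the identity bounds \<open>m\<close>, and density of the polynomials does the rest.
  The function \<open>log J0\<close> extends holomorphically to a neighbourhood of the circle, so its Fourier
  coefficients are summable and \<open>J\<^sup>1\<^sup>/\<^sup>2\<close> is the exponential of an absolutely convergent
  power series on the closed disc; in particular \<open>J\<^sup>1\<^sup>/\<^sup>2\<close> and its inverse are in H-infinity.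
\<close>

text \<open>At the outset \<open>T 1 / J^(1/2)\<close> is only known to lie in L2, and if H2 is to
  be covered as well, \<open>T\<close> may be tested on analytic polynomials alone. The positivity
  criterion copes with both: \<open>|p / z^n| = |p|\<close> on the circle, so every trigonometric
  polynomial has the modulus of an analytic one, and the integrals of \<open>|p|^2 g\<close> carry
  the same information for H2 as for L2. On H2 the symbol must be analytic as well as bounded. This
  is why \<open>J^(1/2)\<close> is the outer square root and not the positive one: both have the
  modulus that the change of variables calls for, but the outer one and its inverse multiply H2 into
  itself. Functions are total on the plane, while equality means almost everywhere on the circle.
  Hence composition with \<open>b\<close> and \<open>transfer\<close> have to be shown compatible
  with null sets, and measurability has to be settled off the circle too: the radial limits that
  define \<open>J^(1/2)\<close> are therefore also evaluated outside the closed disc, by reflection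
  in the circle.\<close>

section \<open>Normalised arc length on the unit circle\<close>

lemma sets_circ_meas [measurable_cong, simp]: "sets circ_meas = sets borel"
  by (simp add: circ_meas_def)

lemma space_circ_meas [simp]: "space circ_meas = UNIV"
  by (simp add: circ_meas_def)

lemma measurable_circ_meas [simp]: "measurable circ_meas N = measurable borel N"
  by (rule measurable_cong_sets) auto

lemma cis_measurable [measurable]: "cis \<in> borel_measurable borel"
  by (intro borel_measurable_continuous_onI continuous_on_cis continuous_intros)

lemma nn_integral_circ:
  assumes [measurable]: "f \<in> borel_measurable borel"
  shows "(\<integral>\<^sup>+z. f z \<partial>circ_meas)
       = (\<integral>\<^sup>+t. ennreal (indicator {0..2*pi} t / (2*pi)) * f (cis t) \<partial>lborel)"
  unfolding circ_meas_def by (subst nn_integral_distr) (auto simp: nn_integral_density)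

lemma integral_circ:
  fixes f :: "complex \<Rightarrow> 'a::{banach, second_countable_topology}"
  assumes [measurable]: "f \<in> borel_measurable borel"
  shows "(LINT z|circ_meas. f z) = (1 / (2*pi)) *\<^sub>R (LINT t:{0..2*pi}|lborel. f (cis t))"
proof -
  have "(LINT z|circ_meas. f z) = (LINT t|lborel. (indicator {0..2*pi} t / (2*pi)) *\<^sub>R f (cis t))"
    unfolding circ_meas_def by (subst integral_distr) (auto simp: integral_density)
  also have "\<dots> = (LINT t|lborel. (1 / (2*pi)) *\<^sub>R (indicator {0..2*pi} t *\<^sub>R f (cis t)))"
    by (intro Bochner_Integration.integral_cong) auto
  finally show ?thesis unfolding set_lebesgue_integral_def by (simp only: integral_scaleR_right)
qed

lemma emeasure_circ_UNIV: "emeasure circ_meas UNIV = 1"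
proof -
  have "emeasure circ_meas UNIV = (\<integral>\<^sup>+z. 1 \<partial>circ_meas)" by simp
  also have "\<dots> = (\<integral>\<^sup>+t. ennreal (1 / (2*pi)) * indicator {0..2*pi} t \<partial>lborel)"
    by (subst nn_integral_circ) (auto intro!: nn_integral_cong split: split_indicator)
  also have "\<dots> = ennreal (1 / (2*pi)) * ennreal (2*pi)"
    by (subst nn_integral_cmult_indicator) auto
  also have "\<dots> = 1" by (subst ennreal_mult[symmetric]) auto
  finally show ?thesis .
qed

interpretation circ: finite_measure circ_meas
  by standard (simp add: emeasure_circ_UNIV)

lemma measure_circ_UNIV [simp]: "measure circ_meas UNIV = 1"
  by (simp add: measure_def emeasure_circ_UNIV)

lemma AE_circ_norm: "AE z in circ_meas. cmod z = 1"
  unfolding circ_meas_def by (subst AE_distr_iff) auto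

lemma AE_circI: "(\<And>z. cmod z = 1 \<Longrightarrow> P z) \<Longrightarrow> AE z in circ_meas. P z"
  using AE_circ_norm by eventually_elim auto

lemma integrable_circ_bounded:
  fixes f :: "complex \<Rightarrow> 'a::{banach, second_countable_topology}"
  assumes "f \<in> borel_measurable borel" "\<And>z. cmod z = 1 \<Longrightarrow> norm (f z) \<le> B"
  shows "integrable circ_meas f"
  using assms by (intro circ.integrable_const_bound[of _ B] AE_circI) auto

lemma integral_circ_cong:
  assumes "f \<in> borel_measurable borel" "g \<in> borel_measurable borel"
    "\<And>z. cmod z = 1 \<Longrightarrow> f z = g z"
  shows "integral\<^sup>L circ_meas f = integral\<^sup>L circ_meas g"
  using assms by (intro integral_cong_AE AE_circI) auto

text \<open>This is Cauchy's integral formula at 0: on \<open>u = cis t\<close> the form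
  \<open>f u / u du\<close> becomes \<open>\<i> * f (cis t) dt\<close>. Continuity up to the circle
  makes it apply to boundary values directly, with no passage through smaller radii.\<close>

lemma integral_circ_mean_value:
  assumes [measurable]: "f \<in> borel_measurable borel"
    and cont: "continuous_on (cball 0 1) f" and holo: "f holomorphic_on ball 0 1"
  shows "(LINT z|circ_meas. f z) = f 0"
proof -
  have "((\<lambda>u. f u / (u - 0)) has_contour_integral 2 * complex_of_real pi * \<i> * f 0) (circlepath 0 1)"
    using Cauchy_integral_circlepath[OF cont holo, of 0] by simp
  then have "((\<lambda>t. f (cis t) / cis t * \<i> * cis t) has_integral 2 * complex_of_real pi * \<i> * f 0) {0..2*pi}"
    unfolding circlepath_def by (simp add: has_contour_integral_part_circlepath_iff circlepath_def)
  then have "((\<lambda>t. f (cis t) * \<i>) has_integral 2 * complex_of_real pi * \<i> * f 0) {0..2*pi}"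
    by simp
  then have "((\<lambda>t. f (cis t) * \<i> * (-\<i>)) has_integral 2 * complex_of_real pi * \<i> * f 0 * (-\<i>)) {0..2*pi}"
    by (rule has_integral_mult_left)
  then have hi: "((\<lambda>t. f (cis t)) has_integral 2 * complex_of_real pi * f 0) {0..2*pi}"
    by (simp add: algebra_simps)
  have "continuous_on {0..2*pi} (\<lambda>t. f (cis t))"
    by (intro continuous_on_compose2[OF cont] continuous_on_cis continuous_intros) auto
  then have "set_integrable lborel {0..2*pi} (\<lambda>t. f (cis t))"
    by (intro borel_integrable_atLeastAtMost') auto
  then have "(LINT t:{0..2*pi}|lborel. f (cis t)) = 2 * complex_of_real pi * f 0"
    using set_borel_integral_eq_integral(2) integral_unique[OF hi] by metis
  then show ?thesis by (subst integral_circ) (auto simp: scaleR_conv_of_real)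
qed

text \<open>For negative \<open>n\<close> the factor \<open>z powi (-n)\<close> is a positive power
  of \<open>z\<close>, so the coefficient is the value at 0 of a holomorphic function that vanishes
  there.\<close>

lemma fourier_holomorphic:
  assumes [measurable]: "f \<in> borel_measurable borel"
    and cont: "continuous_on (cball 0 1) f" and holo: "f holomorphic_on ball 0 1" and "n < 0"
  shows "fourier f n = 0"
proof -
  have e: "z powi (-n) = z ^ nat (-n)" for z :: complex using \<open>n < 0\<close> by (simp add: power_int_def)
  have "(LINT z|circ_meas. f z * z ^ nat (-n)) = f 0 * 0 ^ nat (-n)"
    by (rule integral_circ_mean_value) (use cont holo in \<open>auto intro!: continuous_intros holomorphic_intros\<close>)
  then show ?thesis using \<open>n < 0\<close> unfolding fourier_def e by simp
qed

section \<open>Approximation by trigonometric polynomials\<close>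

text \<open>On the circle \<open>cnj z = 1 / z\<close>, so the real and imaginary parts of
  \<open>z\<close> are Laurent polynomials. The shape \<open>poly p z / z ^ n\<close> encodes a
  Laurent polynomial by an ordinary one; common denominators give closure under sums and
  products.\<close>

lemma real_polynomial_trig:
  assumes "real_polynomial_function (g :: complex \<Rightarrow> real)"
  shows "\<exists>p n. \<forall>z. cmod z = 1 \<longrightarrow> complex_of_real (g z) = poly p z / z ^ n"
  using assms
proof induction
  case (linear f)
  then interpret bounded_linear f .
  have f: "f z = f 1 * Re z + f \<i> * Im z" for z
  proof -
    have "f z = f (Re z *\<^sub>R 1 + Im z *\<^sub>R \<i>)"
      by (rule arg_cong[of _ _ f]) (simp add: complex_eq_iff)
    then show ?thesis by (simp only: add scaleR) simp
  qed
  \<comment> \<open>The coefficients come from \<open>Re z = (z + 1/z) / 2\<close> and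
    \<open>Im z = -\<i> * (z - 1/z) / 2\<close>, after multiplication by \<open>z\<close>.\<close>
  let ?p = "[: (f 1 + \<i> * f \<i>) / 2, 0, (f 1 - \<i> * f \<i>) / 2 :]"
  have "complex_of_real (f z) = poly ?p z / z ^ 1" if "cmod z = 1" for z
  proof -
    have z: "z * cnj z = 1" and nz: "z \<noteq> 0" using that by (auto simp: complex_norm_square[symmetric])
    have "complex_of_real (f z) = f 1 * ((z + cnj z)/2) + f \<i> * (-\<i> * (z - cnj z) / 2)"
      by (subst f) (simp add: complex_eq_iff)
    also have "\<dots> = (f 1 * ((z * z + z * cnj z)/2) + f \<i> * (-\<i> * (z * z - z * cnj z) / 2)) / z"
      using nz by (simp add: field_simps)
    also have "\<dots> = poly ?p z / z ^ 1" unfolding z by (simp add: field_simps)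
    finally show ?thesis .
  qed
  then show ?case by blast
next
  case (const c)
  have "\<forall>z. cmod z = 1 \<longrightarrow> complex_of_real c = poly [:of_real c:] z / z ^ 0" by simp
  then show ?case by blast
next
  case (add f g)
  then obtain p n q m where
    p: "\<And>z. cmod z = 1 \<Longrightarrow> complex_of_real (f z) = poly p z / z ^ n" and
    q: "\<And>z. cmod z = 1 \<Longrightarrow> complex_of_real (g z) = poly q z / z ^ m" by blast
  have "complex_of_real (f z + g z) = poly (p * monom 1 m + q * monom 1 n) z / z ^ (n + m)"
    if "cmod z = 1" for z
  proof -
    have "z \<noteq> 0" using that by auto
    then show ?thesis using p[OF that] q[OF that] by (simp add: poly_monom power_add field_simps)
  qed
  then show ?case by blast
next
  case (mult f g)
  then obtain p n q m where
    p: "\<And>z. cmod z = 1 \<Longrightarrow> complex_of_real (f z) = poly p z / z ^ n" and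
    q: "\<And>z. cmod z = 1 \<Longrightarrow> complex_of_real (g z) = poly q z / z ^ m" by blast
  have "complex_of_real (f z * g z) = poly (p * q) z / z ^ (n + m)" if "cmod z = 1" for z
    using p[OF that] q[OF that] by (simp add: power_add)
  then show ?case by blast
qed

lemma trig_approx_continuous:
  assumes "continuous_on (sphere 0 1) (g :: complex \<Rightarrow> real)" "e > 0"
  shows "\<exists>p n. \<forall>z. cmod z = 1 \<longrightarrow> cmod (complex_of_real (g z) - poly p z / z ^ n) < e"
proof -
  obtain h where h: "real_polynomial_function h" "\<And>x. x \<in> sphere 0 1 \<Longrightarrow> \<bar>g x - h x\<bar> < e"
    using Stone_Weierstrass_real_polynomial_function[OF _ assms] by auto
  obtain p n where "\<forall>z. cmod z = 1 \<longrightarrow> complex_of_real (h z) = poly p z / z ^ n"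
    using real_polynomial_trig[OF h(1)] by blast
  moreover have "cmod (complex_of_real (g z) - complex_of_real (h z)) < e" if "cmod z = 1" for z
    using h(2)[of z] that by (metis dist_0_norm mem_sphere norm_of_real of_real_diff)
  ultimately have "\<forall>z. cmod z = 1 \<longrightarrow> cmod (complex_of_real (g z) - poly p z / z ^ n) < e" by auto
  then show ?thesis by blast
qed

lemma poly_measurable [measurable]:
  fixes p :: "complex poly"
  shows "(\<lambda>x. poly p x) \<in> borel_measurable borel"
  by (intro borel_measurable_continuous_onI continuous_intros)

text \<open>Outer regularity encloses \<open>A\<close> in an open \<open>U\<close> of almost the
  same measure, and the truncated multiples of the distance to the complement of \<open>U\<close>
  tend to the indicator of \<open>U\<close>.\<close>

lemma indicator_approx_continuous:
  assumes [measurable]: "A \<in> sets (borel :: complex measure)" and "e > 0"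
  obtains g :: "complex \<Rightarrow> real" where "continuous_on UNIV g" "\<And>z. 0 \<le> g z" "\<And>z. g z \<le> 1"
    "(LINT z|circ_meas. \<bar>g z - indicator A z\<bar>) < e"
proof -
  have "emeasure circ_meas A = Inf (emeasure circ_meas ` {U. A \<subseteq> U \<and> open U})"
    by (rule outer_regular) auto
  moreover have "emeasure circ_meas A < emeasure circ_meas A + ennreal (e/2)"
    using \<open>e > 0\<close> by (simp add: circ.emeasure_eq_measure ennreal_less_iff flip: ennreal_plus)
  ultimately obtain U where U: "A \<subseteq> U" "open U" and lt: "emeasure circ_meas U < emeasure circ_meas A + ennreal (e/2)"
    unfolding Inf_less_iff by (auto simp: Inf_less_iff)
  have [measurable]: "U \<in> sets borel" using U by auto
  have lt': "measure circ_meas U < measure circ_meas A + e/2"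
    using lt \<open>e > 0\<close> by (simp add: circ.emeasure_eq_measure ennreal_less_iff flip: ennreal_plus)
  show thesis
  \<comment> \<open>The distance to the empty set is 0 by convention, so for \<open>U = UNIV\<close>
    the functions \<open>\<phi> n\<close> would all vanish; the constant 1 is used instead.\<close>
  proof (cases "U = UNIV")
    case True
    have "(LINT z|circ_meas. \<bar>1 - indicator A z\<bar>) = (LINT z|circ_meas. indicator U z - indicat_real A z)"
      by (intro Bochner_Integration.integral_cong) (auto simp: True split: split_indicator)
    also have "\<dots> = measure circ_meas U - measure circ_meas A"
      by (subst Bochner_Integration.integral_diff) (auto simp: circ.emeasure_eq_measure)
    also have "\<dots> < e" using lt' \<open>e > 0\<close> by simp
    finally show thesis using that[of "\<lambda>_. 1"] by (auto intro!: continuous_intros)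
  next
    case False
    define \<phi> where "\<phi> n z = min 1 (real n * infdist z (-U))" for n z
    have c: "continuous_on UNIV (\<phi> n)" for n unfolding \<phi>_def
      by (intro continuous_intros)
    then have [measurable]: "\<phi> n \<in> borel_measurable borel" for n by (rule borel_measurable_continuous_onI)
    have b: "0 \<le> \<phi> n z" "\<phi> n z \<le> 1" for n z unfolding \<phi>_def by (auto simp: infdist_nonneg)
    have ab: "\<bar>\<phi> n z - indicator U z\<bar> \<le> 1" for n z using b[of n z] by (auto split: split_indicator)
    have lim: "(\<lambda>n. \<phi> n z) \<longlonglongrightarrow> indicator U z" for z
    proof (cases "z \<in> U")
      case True
      have "infdist z (-U) > 0" using True U False
        by (metis Compl_iff closed_Compl boolean_algebra.compl_eq_compl_iff  double_complement in_closed_iff_infdist_zero infdist_nonneg less_eq_real_def Compl_UNIV_eq)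
      then obtain n0 where n0: "1 < real n0 * infdist z (-U)" using ex_less_of_nat_mult by blast
      have "1 < real n * infdist z (-U)" if "n \<ge> n0" for n
        using n0 mult_right_mono[of "real n0" "real n" "infdist z (-U)"] that by (simp add: infdist_nonneg)
      then have "eventually (\<lambda>n. \<phi> n z = 1) sequentially"
        unfolding eventually_sequentially \<phi>_def by (intro exI[of _ n0]) force
      then show ?thesis using True by (simp add: tendsto_eventually)
    next
      case False
      then show ?thesis unfolding \<phi>_def by simp
    qed
    have "(\<lambda>n. LINT z|circ_meas. \<bar>\<phi> n z - indicator U z\<bar>) \<longlonglongrightarrow> (LINT z|circ_meas. 0)"
    proof (rule integral_dominated_convergence[where w = "\<lambda>_. 1"])
      show "AE z in circ_meas. (\<lambda>n. \<bar>\<phi> n z - indicator U z\<bar>) \<longlonglongrightarrow> 0"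
        using lim by (auto intro!: tendsto_rabs_zero simp: LIM_zero_iff)
      show "AE z in circ_meas. norm \<bar>\<phi> n z - indicator U z\<bar> \<le> 1" for n
        using ab by simp
    qed auto
    then have "eventually (\<lambda>n. (LINT z|circ_meas. \<bar>\<phi> n z - indicator U z\<bar>) < e/2) sequentially"
      using \<open>e > 0\<close> by (intro order_tendstoD(2)) auto
    then obtain n where n: "(LINT z|circ_meas. \<bar>\<phi> n z - indicator U z\<bar>) < e/2"
      unfolding eventually_sequentially by blast
    have i1: "integrable circ_meas (\<lambda>z. \<bar>\<phi> n z - indicator U z\<bar>)"
      by (rule integrable_circ_bounded[of _ 1]) (use ab in auto)
    have "(LINT z|circ_meas. \<bar>\<phi> n z - indicator A z\<bar>)
        \<le> (LINT z|circ_meas. \<bar>\<phi> n z - indicator U z\<bar> + (indicator U z - indicator A z))"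
    proof (intro integral_mono Bochner_Integration.integrable_add i1)
      show "integrable circ_meas (\<lambda>z. \<bar>\<phi> n z - indicator A z\<bar>)"
      proof (rule integrable_circ_bounded[of _ 1])
        show "norm \<bar>\<phi> n z - indicator A z\<bar> \<le> 1" for z using b[of n z] by (auto split: split_indicator)
      qed measurable
      show "integrable circ_meas (\<lambda>z. indicat_real U z - indicator A z)"
        by (rule integrable_circ_bounded[of _ 1]) (auto split: split_indicator)
      show "\<bar>\<phi> n z - indicator A z\<bar> \<le> \<bar>\<phi> n z - indicator U z\<bar> + (indicator U z - indicator A z)" for z
        using U(1) b[of n z] by (auto split: split_indicator)
    qed
    also have "\<dots> = (LINT z|circ_meas. \<bar>\<phi> n z - indicator U z\<bar>) + (measure circ_meas U - measure circ_meas A)"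
      by (subst Bochner_Integration.integral_add) (use i1 in \<open>auto simp: circ.emeasure_eq_measure\<close>)
    also have "\<dots> < e" using n lt' by simp
    finally show thesis using that[of "\<phi> n"] c b by blast
  qed
qed

text \<open>Closeness in L1 is not enough when the approximants are integrated against an arbitrary
  integrable function. Convergence almost everywhere with values in [0, 1] is, by dominated
  convergence, and a subsequence provides it.\<close>

lemma indicator_approx_AE:
  assumes [measurable]: "A \<in> sets (borel :: complex measure)"
  obtains g :: "nat \<Rightarrow> complex \<Rightarrow> real" where "\<And>n. continuous_on UNIV (g n)" "\<And>n z. 0 \<le> g n z" "\<And>n z. g n z \<le> 1"
    "AE z in circ_meas. (\<lambda>n. g n z) \<longlonglongrightarrow> indicator A z"
proof -
  have "\<exists>g :: complex \<Rightarrow> real. continuous_on UNIV g \<and> (\<forall>z. 0 \<le> g z) \<and> (\<forall>z. g z \<le> 1) \<and>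
    (LINT z|circ_meas. \<bar>g z - indicator A z\<bar>) < 1 / real (Suc n)" for n
    using indicator_approx_continuous[OF assms, of "1 / real (Suc n)"] by (metis of_nat_0_less_iff zero_less_Suc zero_less_divide_1_iff)
  then obtain g :: "nat \<Rightarrow> complex \<Rightarrow> real" where g: "\<And>n. continuous_on UNIV (g n)" "\<And>n z. 0 \<le> g n z" "\<And>n z. g n z \<le> 1"
    "\<And>n. (LINT z|circ_meas. \<bar>g n z - indicator A z\<bar>) < 1 / real (Suc n)" by metis
  have [measurable]: "g n \<in> borel_measurable borel" for n by (rule borel_measurable_continuous_onI) (rule g)
  have "\<exists>r. strict_mono r \<and> (AE z in circ_meas. (\<lambda>n. g (r n) z - indicator A z) \<longlonglongrightarrow> 0)"
  proof (rule tendsto_L1_AE_subseq[of circ_meas "\<lambda>n z. g n z - indicator A z"])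
    show "integrable circ_meas (\<lambda>z. g n z - indicator A z)" for n
    proof (rule integrable_circ_bounded[of _ 1])
      show "norm (g n z - indicat_real A z) \<le> 1" for z
        using g(2)[of n z] g(3)[of n z] by (auto split: split_indicator)
    qed measurable
    show "(\<lambda>n. LINT z|circ_meas. norm (g n z - indicator A z)) \<longlonglongrightarrow> 0"
    proof (rule tendsto_sandwich[OF _ _ tendsto_const])
      show "(\<lambda>n. 1 / real (Suc n)) \<longlonglongrightarrow> 0" using LIMSEQ_inverse_real_of_nat by (simp add: inverse_eq_divide)
    qed (use g(4) in \<open>auto intro!: always_eventually simp: less_imp_le\<close>)
  qed
  then obtain r where "AE z in circ_meas. (\<lambda>n. g (r n) z - indicator A z) \<longlonglongrightarrow> 0" by blast
  then have "AE z in circ_meas. (\<lambda>n. g (r n) z) \<longlonglongrightarrow> indicator A z"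
    by eventually_elim (simp add: LIM_zero_iff)
  then show thesis using that[of "\<lambda>n. g (r n)"] g by auto
qed

section \<open>The spaces L2 and H2\<close>

lemma powi_measurable [measurable]: "(\<lambda>z::complex. z powi n) \<in> borel_measurable borel"
  unfolding power_int_def by (cases "n \<ge> 0") auto

lemma L2T_iff: "f \<in> L2T \<longleftrightarrow> f \<in> borel_measurable borel \<and> integrable circ_meas (\<lambda>z. (cmod (f z))^2)"
  by (simp add: L2T_def)

lemma L2T_measurable: "f \<in> L2T \<Longrightarrow> f \<in> borel_measurable borel"
  by (simp add: L2T_iff)

lemma L2T_integrable: "f \<in> L2T \<Longrightarrow> integrable circ_meas (\<lambda>z. (cmod (f z))^2)"
  by (simp add: L2T_iff)

lemma L2norm_nonneg: "L2norm f \<ge> 0"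
  by (simp add: L2norm_def)

lemma L2norm_power2: "(L2norm f)^2 = (LINT z|circ_meas. (cmod (f z))^2)"
  by (simp add: L2norm_def)

lemma L2norm_cong_AE:
  assumes "f \<in> borel_measurable borel" "g \<in> borel_measurable borel" "AE z in circ_meas. f z = g z"
  shows "L2norm f = L2norm g"
proof -
  have "(LINT z|circ_meas. (cmod (f z))^2) = (LINT z|circ_meas. (cmod (g z))^2)"
    by (rule integral_cong_AE) (use assms in auto)
  then show ?thesis by (simp add: L2norm_def)
qed

lemma L2norm_eq_0_AE:
  assumes "f \<in> L2T" "L2norm f = 0"
  shows "AE z in circ_meas. f z = 0"
proof -
  have "(LINT z|circ_meas. (cmod (f z))^2) = 0" using assms(2) L2norm_power2[of f] by simp
  then have "AE z in circ_meas. (cmod (f z))^2 = 0"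
    using integral_nonneg_eq_0_iff_AE[OF L2T_integrable[OF assms(1)]] by simp
  then show ?thesis by eventually_elim simp
qed

lemma L2T_mult_integrable:
  assumes "f \<in> L2T" "g \<in> L2T"
  shows "integrable circ_meas (\<lambda>z. f z * g z)"
proof (rule Bochner_Integration.integrable_bound)
  show "integrable circ_meas (\<lambda>z. (cmod (f z))^2 + (cmod (g z))^2)"
    using assms by (intro Bochner_Integration.integrable_add L2T_integrable)
  show "(\<lambda>z. f z * g z) \<in> borel_measurable circ_meas"
    using assms[THEN L2T_measurable] by simp
  show "AE z in circ_meas. norm (f z * g z) \<le> norm ((cmod (f z))^2 + (cmod (g z))^2)"
  proof (intro AE_I2)
    fix z
    have "2 * (cmod (f z) * cmod (g z)) \<le> (cmod (f z))^2 + (cmod (g z))^2"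
      using sum_squares_bound[of "cmod (f z)" "cmod (g z)"] by simp
    moreover have "0 \<le> cmod (f z) * cmod (g z)" by simp
    ultimately have "cmod (f z) * cmod (g z) \<le> (cmod (f z))^2 + (cmod (g z))^2" by linarith
    then show "norm (f z * g z) \<le> norm ((cmod (f z))^2 + (cmod (g z))^2)"
      by (simp add: norm_mult)
  qed
qed

text \<open>Integrating \<open>2 |f g| \<le> t |f|^2 + |g|^2 / t\<close> gives the claim when
  \<open>t\<close> is the ratio of the two norms, for which both terms on the right have the same
  integral. A vanishing norm has to be treated apart, since \<open>t\<close> would be 0 or
  undefined.\<close>

lemma L2T_Cauchy_Schwarz:
  assumes f: "f \<in> L2T" and g: "g \<in> L2T"
  shows "(LINT z|circ_meas. cmod (f z * g z)) \<le> L2norm f * L2norm g"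
proof (cases "L2norm f = 0 \<or> L2norm g = 0")
  case True
  then have "AE z in circ_meas. f z = 0 \<or> g z = 0"
    using L2norm_eq_0_AE[OF f] L2norm_eq_0_AE[OF g] by auto
  then have "AE z in circ_meas. cmod (f z * g z) = 0" by eventually_elim auto
  then have "(LINT z|circ_meas. cmod (f z * g z)) = 0"
    by (intro integral_eq_zero_AE)
  then show ?thesis by (simp add: L2norm_nonneg)
next
  case False
  then have pos: "L2norm f > 0" "L2norm g > 0" using L2norm_nonneg[of f] L2norm_nonneg[of g] by auto
  define t where "t = L2norm g / L2norm f"
  have t: "t > 0" using pos by (simp add: t_def)
  have "(LINT z|circ_meas. cmod (f z * g z)) \<le> (LINT z|circ_meas. (t * (cmod (f z))^2 + (cmod (g z))^2 / t) / 2)"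
  proof (rule integral_mono)
    show "integrable circ_meas (\<lambda>z. cmod (f z * g z))"
      using L2T_mult_integrable[OF f g] by simp
    show "integrable circ_meas (\<lambda>z. (t * (cmod (f z))\<^sup>2 + (cmod (g z))\<^sup>2 / t) / 2)"
      using L2T_integrable[OF f] L2T_integrable[OF g] by auto
    fix z
    have "0 \<le> (t * cmod (f z) - cmod (g z))^2 / t" using t by simp
    also have "\<dots> = t * (cmod (f z))\<^sup>2 + (cmod (g z))\<^sup>2 / t - 2 * (cmod (f z) * cmod (g z))"
      using t by (simp add: field_simps power2_eq_square)
    finally show "cmod (f z * g z) \<le> (t * (cmod (f z))\<^sup>2 + (cmod (g z))\<^sup>2 / t) / 2"
      by (simp add: norm_mult)
  qed
  also have "\<dots> = (t * (L2norm f)^2 + (L2norm g)^2 / t) / 2"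
    unfolding L2norm_power2 using L2T_integrable[OF f] L2T_integrable[OF g] by simp
  also have "\<dots> = L2norm f * L2norm g"
    unfolding t_def using pos by (simp add: field_simps power2_eq_square)
  finally show ?thesis .
qed

lemma L2T_bounded:
  assumes "f \<in> borel_measurable borel" "\<And>z. cmod z = 1 \<Longrightarrow> cmod (f z) \<le> B"
  shows "f \<in> L2T"
  unfolding L2T_iff using assms
  by (auto intro!: integrable_circ_bounded[of _ "B^2"] power_mono)

lemma L2T_cmult: "f \<in> L2T \<Longrightarrow> (\<lambda>z. c * f z) \<in> L2T"
  unfolding L2T_iff by (auto simp: norm_mult power_mult_distrib)

lemma L2norm_cmult: "L2norm (\<lambda>z. c * f z) = cmod c * L2norm f"
  unfolding L2norm_def by (simp add: norm_mult power_mult_distrib real_sqrt_mult)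

lemma L2T_add:
  assumes "f \<in> L2T" "g \<in> L2T"
  shows "(\<lambda>z. f z + g z) \<in> L2T"
  unfolding L2T_iff
proof
  show "(\<lambda>z. f z + g z) \<in> borel_measurable borel" using assms[THEN L2T_measurable] by simp
  show "integrable circ_meas (\<lambda>z. (cmod (f z + g z))\<^sup>2)"
  proof (rule Bochner_Integration.integrable_bound)
    show "integrable circ_meas (\<lambda>z. 2 * (cmod (f z))^2 + 2 * (cmod (g z))^2)"
      using assms[THEN L2T_integrable] by simp
    show "(\<lambda>z. (cmod (f z + g z))\<^sup>2) \<in> borel_measurable circ_meas"
      using assms[THEN L2T_measurable] by simp
    show "AE z in circ_meas. norm ((cmod (f z + g z))\<^sup>2) \<le> norm (2 * (cmod (f z))^2 + 2 * (cmod (g z))^2)"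
    proof (intro AE_I2)
      fix z
      have "(cmod (f z + g z))\<^sup>2 \<le> (cmod (f z) + cmod (g z))^2"
        by (intro power_mono norm_triangle_ineq) auto
      also have "\<dots> \<le> 2 * (cmod (f z))^2 + 2 * (cmod (g z))^2"
        using sum_squares_bound[of "cmod (f z)" "cmod (g z)"] by (simp add: power2_sum)
      finally show "norm ((cmod (f z + g z))\<^sup>2) \<le> norm (2 * (cmod (f z))^2 + 2 * (cmod (g z))^2)" by simp
    qed
  qed
qed

lemma L2T_diff:
  assumes "f \<in> L2T" "g \<in> L2T"
  shows "(\<lambda>z. f z - g z) \<in> L2T"
  using L2T_add[OF assms(1) L2T_cmult[OF assms(2), of "-1"]] by simp

lemma L2norm_triangle:
  assumes f: "f \<in> L2T" and g: "g \<in> L2T"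
  shows "L2norm (\<lambda>z. f z + g z) \<le> L2norm f + L2norm g"
proof -
  have i: "integrable circ_meas (\<lambda>z. cmod (f z * g z))" using L2T_mult_integrable[OF f g] by simp
  have "(L2norm (\<lambda>z. f z + g z))^2 \<le> (LINT z|circ_meas. (cmod (f z))^2 + (cmod (g z))^2 + 2 * cmod (f z * g z))"
    unfolding L2norm_power2
  proof (rule integral_mono)
    show "integrable circ_meas (\<lambda>z. (cmod (f z + g z))\<^sup>2)" by (intro L2T_integrable L2T_add f g)
    show "integrable circ_meas (\<lambda>z. (cmod (f z))^2 + (cmod (g z))^2 + 2 * cmod (f z * g z))"
      using L2T_integrable[OF f] L2T_integrable[OF g] i by simp
    fix z
    have "(cmod (f z + g z))\<^sup>2 \<le> (cmod (f z) + cmod (g z))^2"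
      by (intro power_mono norm_triangle_ineq) auto
    then show "(cmod (f z + g z))\<^sup>2 \<le> (cmod (f z))^2 + (cmod (g z))^2 + 2 * cmod (f z * g z)"
      by (simp add: power2_sum norm_mult)
  qed
  also have "\<dots> = (L2norm f)^2 + (L2norm g)^2 + 2 * (LINT z|circ_meas. cmod (f z * g z))"
    unfolding L2norm_power2 using L2T_integrable[OF f] L2T_integrable[OF g] i by simp
  also have "\<dots> \<le> (L2norm f)^2 + (L2norm g)^2 + 2 * (L2norm f * L2norm g)"
    using L2T_Cauchy_Schwarz[OF f g] by simp
  also have "\<dots> = (L2norm f + L2norm g)^2" by (simp add: power2_sum)
  finally show ?thesis by (rule power2_le_imp_le) (simp add: L2norm_nonneg)
qed

lemma L2norm_diff_triangle:
  assumes "f \<in> L2T" "g \<in> L2T" "h \<in> L2T"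
  shows "L2norm (\<lambda>z. f z - h z) \<le> L2norm (\<lambda>z. f z - g z) + L2norm (\<lambda>z. g z - h z)"
  using L2norm_triangle[OF L2T_diff[OF assms(1,2)] L2T_diff[OF assms(2,3)]] by simp

lemma L2T_eq_AE_if_close:
  assumes f: "f \<in> L2T" and g: "g \<in> L2T" and close: "\<And>e. e > 0 \<Longrightarrow> L2norm (\<lambda>z. f z - g z) \<le> e"
  shows "AE z in circ_meas. f z = g z"
proof -
  have "L2norm (\<lambda>z. f z - g z) = 0"
    using field_le_epsilon[of "L2norm (\<lambda>z. f z - g z)" 0] close L2norm_nonneg[of "\<lambda>z. f z - g z"] by auto
  then have "AE z in circ_meas. f z - g z = 0" using L2norm_eq_0_AE[OF L2T_diff[OF f g]] by simp
  then show ?thesis by eventually_elim simp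
qed

lemma LinfT_measurable: "\<phi> \<in> LinfT \<Longrightarrow> \<phi> \<in> borel_measurable borel"
  by (simp add: LinfT_def)

lemma LinfT_bound:
  assumes "\<phi> \<in> LinfT"
  obtains C where "C > 0" "AE z in circ_meas. cmod (\<phi> z) \<le> C"
proof -
  obtain C where C: "AE z in circ_meas. cmod (\<phi> z) \<le> C" using assms by (auto simp: LinfT_def)
  have "AE z in circ_meas. cmod (\<phi> z) \<le> max C 1" using C by eventually_elim auto
  then show thesis using that[of "max C 1"] by simp
qed

lemma LinfT_bounded:
  assumes "f \<in> borel_measurable borel" "\<And>z. cmod z = 1 \<Longrightarrow> cmod (f z) \<le> B"
  shows "f \<in> LinfT"
  unfolding LinfT_def using assms by (auto intro!: AE_circI)

lemma
  assumes g: "g \<in> borel_measurable borel" and f: "f \<in> L2T" and "B \<ge> 0"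
    and le: "AE z in circ_meas. cmod (g z) \<le> B * cmod (f z)"
  shows L2T_dominated: "g \<in> L2T" and L2norm_dominated: "L2norm g \<le> B * L2norm f"
proof -
  have le2: "AE z in circ_meas. (cmod (g z))^2 \<le> B^2 * (cmod (f z))^2"
    using le by eventually_elim (metis norm_ge_zero power_mono power_mult_distrib)
  have i: "integrable circ_meas (\<lambda>z. (cmod (g z))^2)"
    by (rule Bochner_Integration.integrable_bound[OF integrable_mult_right[OF L2T_integrable[OF f], of "B^2"]])
       (use g le2 in auto)
  then show "g \<in> L2T" using g by (simp add: L2T_iff)
  have "(L2norm g)^2 \<le> (LINT z|circ_meas. B^2 * (cmod (f z))^2)"
    unfolding L2norm_power2 by (rule integral_mono_AE) (use i L2T_integrable[OF f] le2 in auto)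
  also have "\<dots> = (B * L2norm f)^2" by (simp add: L2norm_power2 power_mult_distrib)
  finally show "L2norm g \<le> B * L2norm f"
    by (rule power2_le_imp_le) (use \<open>B \<ge> 0\<close> in \<open>simp add: L2norm_nonneg\<close>)
qed

lemma LinfT_subset_L2T: "\<phi> \<in> LinfT \<Longrightarrow> \<phi> \<in> L2T"
proof -
  assume a: "\<phi> \<in> LinfT"
  then obtain C where "C > 0" "AE z in circ_meas. cmod (\<phi> z) \<le> C" by (rule LinfT_bound)
  then show ?thesis
    using L2T_dominated[of \<phi> "\<lambda>_. 1" C] L2T_bounded[of "\<lambda>_. 1" 1] LinfT_measurable[OF a] by simp
qed

lemma LinfT_mult_L2T:
  assumes "\<phi> \<in> LinfT" "f \<in> L2T"
  shows "(\<lambda>z. \<phi> z * f z) \<in> L2T"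
proof -
  obtain C where C: "C > 0" "AE z in circ_meas. cmod (\<phi> z) \<le> C" using assms(1) by (rule LinfT_bound)
  have "AE z in circ_meas. cmod (\<phi> z * f z) \<le> C * cmod (f z)"
    using C(2) by eventually_elim (simp add: norm_mult mult_right_mono)
  then show ?thesis
    using L2T_dominated[of "\<lambda>z. \<phi> z * f z" f C] C LinfT_measurable[OF assms(1)] assms(2) L2T_measurable[OF assms(2)]
    by simp
qed

lemma fourier_integrable:
  assumes "f \<in> L2T"
  shows "integrable circ_meas (\<lambda>z. f z * z powi n)"
  by (rule L2T_mult_integrable[OF assms L2T_bounded[of _ 1]]) (auto simp: norm_power_int)

lemma fourier_bound:
  assumes f: "f \<in> L2T"
  shows "cmod (fourier f n) \<le> L2norm f"
proof -
  have p: "(\<lambda>z. z powi (-n)) \<in> L2T" by (rule L2T_bounded[of _ 1]) (auto simp: norm_power_int)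
  have "L2norm (\<lambda>z. z powi (-n)) = 1"
  proof -
    have "(LINT z|circ_meas. (cmod (z powi (-n)))^2) = (LINT z|circ_meas. 1)"
    proof (rule integral_circ_cong)
      show "(\<lambda>z. (cmod (z powi (-n)))^2) \<in> borel_measurable borel" by measurable
    qed (auto simp: norm_power_int)
    then show ?thesis by (simp add: L2norm_def)
  qed
  then have "(LINT z|circ_meas. cmod (f z * z powi (-n))) \<le> L2norm f"
    using L2T_Cauchy_Schwarz[OF f p] by simp
  then show ?thesis unfolding fourier_def by (rule order_trans[OF integral_norm_bound])
qed

lemma fourier_diff:
  assumes "f \<in> L2T" "g \<in> L2T"
  shows "fourier (\<lambda>z. f z - g z) n = fourier f n - fourier g n"
  unfolding fourier_def using assms[THEN fourier_integrable] by (simp add: left_diff_distrib)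

lemma fourier_lincomb:
  assumes "f \<in> L2T" "g \<in> L2T"
  shows "fourier (\<lambda>z. c * f z + g z) n = c * fourier f n + fourier g n"
  unfolding fourier_def using assms[THEN fourier_integrable] by (simp add: distrib_right mult.assoc)

lemma H2T_L2T: "f \<in> H2T \<Longrightarrow> f \<in> L2T" by (simp add: H2T_def)

lemma H2T_diff: "f \<in> H2T \<Longrightarrow> g \<in> H2T \<Longrightarrow> (\<lambda>z. f z - g z) \<in> H2T"
  by (simp add: H2T_def L2T_diff fourier_diff)

text \<open>Each Fourier coefficient is norm continuous by \<open>fourier_bound\<close>, so a
  nonzero coefficient of negative index would keep \<open>f\<close> at a positive distance from
  H2.\<close>

lemma H2T_closed:
  assumes f: "f \<in> L2T" and approx: "\<And>e. e > 0 \<Longrightarrow> \<exists>h\<in>H2T. L2norm (\<lambda>z. f z - h z) < e"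
  shows "f \<in> H2T"
proof -
  have "fourier f n = 0" if "n < 0" for n
  proof (rule ccontr)
    assume "fourier f n \<noteq> 0"
    then obtain h where h: "h \<in> H2T" "L2norm (\<lambda>z. f z - h z) < cmod (fourier f n)"
      using approx[of "cmod (fourier f n)"] by auto
    have "fourier (\<lambda>z. f z - h z) n = fourier f n"
      using h(1) that by (simp add: fourier_diff[OF f H2T_L2T[OF h(1)]] H2T_def)
    then show False using h(2) fourier_bound[OF L2T_diff[OF f H2T_L2T[OF h(1)]], of n] by simp
  qed
  then show ?thesis using f by (simp add: H2T_def)
qed

lemma trig_LinfT: "(\<lambda>z. poly p z / z ^ n) \<in> LinfT"
proof -
  have "compact (poly p ` sphere 0 1)" by (intro compact_continuous_image continuous_intros) auto
  then have "bounded (poly p ` sphere 0 1)" by (rule compact_imp_bounded)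
  then obtain B where "\<forall>z\<in>sphere 0 1. cmod (poly p z) \<le> B" unfolding bounded_iff by auto
  then have "cmod (poly p z) \<le> B" if "cmod z = 1" for z using that by auto
  then show ?thesis by (intro LinfT_bounded[of _ B]) (auto simp: norm_divide norm_power)
qed

lemma trig_L2T: "(\<lambda>z. poly p z / z ^ n) \<in> L2T"
  by (rule LinfT_subset_L2T[OF trig_LinfT])

text \<open>The criterion that places polynomials, polynomials in \<open>b\<close>,
  \<open>J^(1/2)\<close> and its inverse in H-infinity.\<close>

lemma HinfT_holomorphic:
  assumes m: "h \<in> borel_measurable borel" and c: "continuous_on (cball 0 1) h" and h: "h holomorphic_on ball 0 1"
  shows "h \<in> HinfT"
proof -
  have "bounded (h ` cball 0 1)" by (intro compact_imp_bounded compact_continuous_image c) auto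
  then obtain M where "\<forall>z\<in>cball 0 1. cmod (h z) \<le> M" unfolding bounded_iff by auto
  then have "h \<in> LinfT" by (intro LinfT_bounded[OF m, of M]) simp
  then show ?thesis using fourier_holomorphic[OF m c h] by (simp add: HinfT_def)
qed

lemma poly_holomorphic: "poly p holomorphic_on A"
  unfolding holomorphic_on_def field_differentiable_def
  by (meson poly_DERIV has_field_derivative_at_within)

lemma poly_HinfT: "(\<lambda>z. poly p z) \<in> HinfT"
  by (rule HinfT_holomorphic) (auto intro!: continuous_intros poly_holomorphic)

lemma HinfT_H2T: "f \<in> HinfT \<Longrightarrow> f \<in> H2T"
  by (auto simp: HinfT_def H2T_def LinfT_subset_L2T)

lemma poly_H2T: "(\<lambda>z. poly p z) \<in> H2T"
  by (rule HinfT_H2T[OF poly_HinfT])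

subsection \<open>Density\<close>

definition trig_approximable :: "(complex \<Rightarrow> complex) \<Rightarrow> bool" where
  "trig_approximable f \<longleftrightarrow> (\<forall>e>0. \<exists>p n. L2norm (\<lambda>z. f z - poly p z / z ^ n) < e)"

lemma trig_approximable_closed:
  assumes f: "f \<in> L2T" and a: "\<And>e. e > 0 \<Longrightarrow> \<exists>g\<in>L2T. trig_approximable g \<and> L2norm (\<lambda>z. f z - g z) < e"
  shows "trig_approximable f"
  unfolding trig_approximable_def
proof (intro allI impI)
  fix e :: real assume "e > 0"
  then obtain g where g: "g \<in> L2T" "trig_approximable g" "L2norm (\<lambda>z. f z - g z) < e/2"
    using a[of "e/2"] by auto
  then obtain p n where "L2norm (\<lambda>z. g z - poly p z / z ^ n) < e/2"
    using \<open>e > 0\<close> unfolding trig_approximable_def by (meson half_gt_zero)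
  then show "\<exists>p n. L2norm (\<lambda>z. f z - poly p z / z ^ n) < e"
    using L2norm_diff_triangle[OF f g(1) trig_L2T[of p n]] g(3) by (intro exI[of _ p] exI[of _ n]) linarith
qed

lemma trig_approximable_add:
  assumes f: "f \<in> L2T" "trig_approximable f" and g: "g \<in> L2T" "trig_approximable g"
  shows "trig_approximable (\<lambda>z. f z + g z)"
  unfolding trig_approximable_def
proof (intro allI impI)
  fix e :: real assume "e > 0"
  then obtain p n q m where p: "L2norm (\<lambda>z. f z - poly p z / z ^ n) < e/2" and q: "L2norm (\<lambda>z. g z - poly q z / z ^ m) < e/2"
    using f(2) g(2) unfolding trig_approximable_def by (meson half_gt_zero)
  let ?r = "p * monom 1 m + q * monom 1 n"
  note [measurable] = f(1)[THEN L2T_measurable] g(1)[THEN L2T_measurable]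
  have eq: "L2norm (\<lambda>z. (f z + g z) - poly ?r z / z ^ (n + m)) = L2norm (\<lambda>z. (f z - poly p z / z ^ n) + (g z - poly q z / z ^ m))"
  proof (rule L2norm_cong_AE)
    show "AE z in circ_meas. (f z + g z) - poly ?r z / z ^ (n + m) = (f z - poly p z / z ^ n) + (g z - poly q z / z ^ m)"
    proof (rule AE_circI)
      fix z :: complex assume "cmod z = 1"
      then have "z \<noteq> 0" by auto
      then show "(f z + g z) - poly ?r z / z ^ (n + m) = (f z - poly p z / z ^ n) + (g z - poly q z / z ^ m)"
        by (simp add: poly_monom power_add field_simps)
    qed
  qed measurable
  have "L2norm (\<lambda>z. (f z - poly p z / z ^ n) + (g z - poly q z / z ^ m)) < e"
    using L2norm_triangle[OF L2T_diff[OF f(1) trig_L2T[of p n]] L2T_diff[OF g(1) trig_L2T[of q m]]] p q by linarith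
  then show "\<exists>p n. L2norm (\<lambda>z. (f z + g z) - poly p z / z ^ n) < e" using eq by metis
qed

lemma trig_approximable_cmult:
  assumes "trig_approximable f"
  shows "trig_approximable (\<lambda>z. c * f z)"
  unfolding trig_approximable_def
proof (intro allI impI)
  fix e :: real assume "e > 0"
  \<comment> \<open>Adding 1 to the denominator includes the case \<open>c = 0\<close>.\<close>
  then have "e / (cmod c + 1) > 0" by (simp add: add_nonneg_pos)
  then obtain p n where p: "L2norm (\<lambda>z. f z - poly p z / z ^ n) < e / (cmod c + 1)"
    using assms unfolding trig_approximable_def by blast
  have "L2norm (\<lambda>z. c * f z - poly (smult c p) z / z ^ n) = cmod c * L2norm (\<lambda>z. f z - poly p z / z ^ n)"
    unfolding L2norm_cmult[symmetric] by (simp add: algebra_simps)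
  also have "\<dots> \<le> cmod c * (e / (cmod c + 1))" using p by (intro mult_left_mono) auto
  also have "\<dots> < e"
  proof -
    have "0 < cmod c + 1" by (simp add: add_nonneg_pos)
    then show ?thesis using \<open>e > 0\<close> by (simp add: field_simps)
  qed
  finally show "\<exists>p n. L2norm (\<lambda>z. c * f z - poly p z / z ^ n) < e" by blast
qed

text \<open>Two functions with values in [0, 1] satisfy \<open>|u - v|^2 \<le> |u - v|\<close>, so
  an L1 error below \<open>(e/2)^2\<close> is an L2 error below \<open>e/2\<close>. The other half
  of \<open>e\<close> pays for the uniform approximation of the continuous function.\<close>

lemma trig_approximable_indicator:
  assumes [measurable]: "A \<in> sets (borel :: complex measure)"
  shows "trig_approximable (\<lambda>z. of_real (indicator A z))"
  unfolding trig_approximable_def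
proof (intro allI impI)
  fix e :: real assume e: "e > 0"
  obtain g :: "complex \<Rightarrow> real" where g: "continuous_on UNIV g" "\<And>z. 0 \<le> g z" "\<And>z. g z \<le> 1"
    "(LINT z|circ_meas. \<bar>g z - indicator A z\<bar>) < (e/2)^2"
    using indicator_approx_continuous[OF assms, of "(e/2)^2"] e by (metis half_gt_zero zero_less_power)
  have [measurable]: "g \<in> borel_measurable borel" by (rule borel_measurable_continuous_onI) (rule g)
  have b: "\<bar>indicator A z - g z\<bar> \<le> 1" for z using g(2)[of z] g(3)[of z] by (auto split: split_indicator)
  have gL: "(\<lambda>z. complex_of_real (g z)) \<in> L2T" by (rule L2T_bounded[of _ 1]) (use g(2,3) in auto)
  have iL: "(\<lambda>z. complex_of_real (indicator A z)) \<in> L2T" by (rule L2T_bounded[of _ 1]) (auto split: split_indicator)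
  have "(L2norm (\<lambda>z. of_real (indicator A z) - of_real (g z)))^2 \<le> (LINT z|circ_meas. \<bar>g z - indicator A z\<bar>)"
    unfolding L2norm_power2
  proof (rule integral_mono)
    show "integrable circ_meas (\<lambda>z. (cmod (of_real (indicator A z) - of_real (g z)))^2)"
      by (intro L2T_integrable L2T_diff gL iL)
    show "integrable circ_meas (\<lambda>z. \<bar>g z - indicator A z\<bar>)"
      by (rule integrable_circ_bounded[of _ 1]) (use b in \<open>auto simp: abs_minus_commute\<close>)
    fix z
    have "(cmod (of_real (indicator A z) - of_real (g z)))^2 = \<bar>indicator A z - g z\<bar> * \<bar>indicator A z - g z\<bar>"
      by (metis norm_of_real of_real_diff power2_eq_square)
    also have "\<dots> \<le> \<bar>indicator A z - g z\<bar> * 1" by (intro mult_left_mono b) auto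
    finally show "(cmod (of_real (indicator A z) - of_real (g z)))^2 \<le> \<bar>g z - indicator A z\<bar>"
      by (simp add: abs_minus_commute)
  qed
  also have "\<dots> < (e/2)^2" by (rule g(4))
  finally have 1: "L2norm (\<lambda>z. of_real (indicator A z) - of_real (g z)) < e/2"
    using e by (meson half_gt_zero less_imp_le power_less_imp_less_base)
  obtain p n where p: "\<And>z. cmod z = 1 \<Longrightarrow> cmod (complex_of_real (g z) - poly p z / z ^ n) < e/2"
    using trig_approx_continuous[of g "e/2"] g(1) e continuous_on_subset by (metis half_gt_zero subset_UNIV)
  have "L2norm (\<lambda>z. of_real (g z) - poly p z / z ^ n) \<le> (e/2) * L2norm (\<lambda>_. 1)"
    by (rule L2norm_dominated) (use p e in \<open>auto intro!: AE_circI L2T_bounded[of _ 1] simp: less_imp_le\<close>)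
  moreover have "L2norm (\<lambda>_. 1) = 1" by (simp add: L2norm_def)
  ultimately have 2: "L2norm (\<lambda>z. of_real (g z) - poly p z / z ^ n) \<le> e/2" by simp
  show "\<exists>p n. L2norm (\<lambda>z. of_real (indicator A z) - poly p z / z ^ n) < e"
    using L2norm_diff_triangle[OF iL gL trig_L2T[of p n]] 1 2 by (intro exI[of _ p] exI[of _ n]) linarith
qed

lemma simple_approximable:
  assumes "finite I" "\<And>i. i \<in> I \<Longrightarrow> A i \<in> sets (borel :: complex measure)"
  shows "(\<lambda>z. \<Sum>i\<in>I. c i * of_real (indicator (A i) z)) \<in> L2T \<and>
         trig_approximable (\<lambda>z. \<Sum>i\<in>I. c i * of_real (indicator (A i) z))"
  using assms
proof (induction I rule: finite_induct)
  case empty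
  have "trig_approximable (\<lambda>z. 0 * of_real (indicator {} z))"
    by (intro trig_approximable_cmult trig_approximable_indicator) auto
  moreover have "(\<lambda>z. 0) \<in> L2T" by (rule L2T_bounded[of _ 0]) auto
  ultimately show ?case by simp
next
  case (insert i I)
  have [measurable]: "A i \<in> sets borel" using insert by auto
  have "(\<lambda>z. complex_of_real (indicator (A i) z)) \<in> L2T" by (rule L2T_bounded[of _ 1]) (auto split: split_indicator)
  then have "(\<lambda>z. c i * complex_of_real (indicator (A i) z)) \<in> L2T" by (rule L2T_cmult)
  moreover have "trig_approximable (\<lambda>z. c i * complex_of_real (indicator (A i) z))"
    by (intro trig_approximable_cmult trig_approximable_indicator) auto
  ultimately show ?case using insert by (auto simp: intro!: L2T_add trig_approximable_add)
qed

text \<open>Simple functions bounded by \<open>2 |f|\<close> converge to \<open>f\<close> pointwise.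
  Then \<open>|f - F i| \<le> 3 |f|\<close>, and \<open>9 |f|^2\<close> dominates the squared
  errors, so that simple functions, and with them trigonometric polynomials, come arbitrarily
  close.\<close>

lemma trig_dense:
  assumes f: "f \<in> L2T" and "e > 0"
  shows "\<exists>p n. L2norm (\<lambda>z. f z - poly p z / z ^ n) < e"
proof -
  have [measurable]: "f \<in> borel_measurable borel" using f by (rule L2T_measurable)
  obtain F where F: "\<And>i. simple_function borel (F i)" "\<And>x. (\<lambda>i. F i x) \<longlonglongrightarrow> f x" "\<And>i x. cmod (F i x) \<le> 2 * cmod (f x)"
    using borel_measurable_implies_sequence_metric[of f borel 0] by auto
  have Fm [measurable]: "F i \<in> borel_measurable borel" for i using F(1) by (rule borel_measurable_simple_function)
  have FL: "F i \<in> L2T" for i by (rule L2T_dominated[OF Fm f, of 2]) (use F(3) in auto)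
  have Ft: "trig_approximable (F i)" for i
  proof -
    let ?I = "range (F i)"
    have fin: "finite ?I" using F(1)[of i] by (simp add: simple_function_def)
    have meas: "F i -` {y} \<in> sets borel" for y using measurable_sets[OF Fm[of i], of "{y}"] by simp
    have "(\<Sum>y\<in>?I. y * of_real (indicator (F i -` {y}) z)) = F i z" for z
    proof -
      have "(\<Sum>y\<in>?I. y * of_real (indicator (F i -` {y}) z)) = (\<Sum>y\<in>?I. if F i z = y then y else 0)"
        by (intro sum.cong refl) (simp split: split_indicator)
      also have "\<dots> = F i z" by (subst sum.delta'[OF fin]) simp
      finally show ?thesis .
    qed
    then have eq: "(\<lambda>z. \<Sum>y\<in>?I. y * of_real (indicator (F i -` {y}) z)) = F i" by (rule ext)
    have "trig_approximable (\<lambda>z. \<Sum>y\<in>?I. y * of_real (indicator (F i -` {y}) z))"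
      by (rule simple_approximable[THEN conjunct2, OF fin meas])
    then show ?thesis by (simp only: eq)
  qed
  have lim: "(\<lambda>i. LINT z|circ_meas. (cmod (f z - F i z))^2) \<longlonglongrightarrow> (LINT z|circ_meas. 0)"
  proof (rule integral_dominated_convergence[where w = "\<lambda>z. 9 * (cmod (f z))^2"])
    show "integrable circ_meas (\<lambda>z. 9 * (cmod (f z))^2)" using L2T_integrable[OF f] by simp
    show "AE z in circ_meas. (\<lambda>i. (cmod (f z - F i z))^2) \<longlonglongrightarrow> 0"
    proof (intro AE_I2)
      fix z
      have "(\<lambda>i. (cmod (f z - F i z))^2) \<longlonglongrightarrow> (cmod (f z - f z))^2" by (intro tendsto_intros F)
      then show "(\<lambda>i. (cmod (f z - F i z))^2) \<longlonglongrightarrow> 0" by simp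
    qed
    show "AE z in circ_meas. norm ((cmod (f z - F i z))^2) \<le> 9 * (cmod (f z))^2" for i
    proof (intro AE_I2)
      fix z
      have "cmod (f z - F i z) \<le> 3 * cmod (f z)" using norm_triangle_ineq4[of "f z" "F i z"] F(3)[of i z] by simp
      then have "(cmod (f z - F i z))^2 \<le> (3 * cmod (f z))^2" by (intro power_mono) auto
      then show "norm ((cmod (f z - F i z))^2) \<le> 9 * (cmod (f z))^2" by (simp add: power_mult_distrib)
    qed
  qed auto
  have "trig_approximable f"
  proof (rule trig_approximable_closed[OF f])
    fix d :: real assume "d > 0"
    then have "eventually (\<lambda>i. (LINT z|circ_meas. (cmod (f z - F i z))^2) < d^2) sequentially"
      using lim by (intro order_tendstoD(2)) auto
    then obtain i where "(L2norm (\<lambda>z. f z - F i z))^2 < d^2" unfolding L2norm_power2 eventually_sequentially by blast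
    then have "L2norm (\<lambda>z. f z - F i z) < d" using \<open>d > 0\<close> by (meson less_imp_le power_less_imp_less_base)
    then show "\<exists>g\<in>L2T. trig_approximable g \<and> L2norm (\<lambda>z. f z - g z) < d" using FL Ft by blast
  qed
  then show ?thesis using \<open>e > 0\<close> by (simp add: trig_approximable_def)
qed

lemma cnj_measurable [measurable]: "cnj \<in> borel_measurable borel"
  by (intro borel_measurable_continuous_onI continuous_intros)

text \<open>When \<open>degree r < n\<close>, the quotient \<open>r / z^n\<close> has only negative
  frequencies and is orthogonal to H2. The alternative \<open>r = 0\<close> is what remains for
  \<open>n = 0\<close>, where no degree lies below \<open>n\<close>.\<close>

lemma cnj_trig_integral:
  assumes u: "u \<in> H2T" and deg: "degree r < n \<or> r = 0"
  shows "(LINT z|circ_meas. u z * cnj (poly r z / z ^ n)) = 0"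
proof (cases "r = 0")
  case False
  then have deg: "degree r < n" using deg by simp
  have uL: "u \<in> L2T" using u by (rule H2T_L2T)
  have um [measurable]: "u \<in> borel_measurable borel" using uL by (rule L2T_measurable)
  have "(LINT z|circ_meas. u z * cnj (poly r z / z ^ n))
      = (LINT z|circ_meas. (\<Sum>k\<le>degree r. cnj (coeff r k) * (u z * z powi (int n - int k))))"
  proof (rule integral_circ_cong)
    show "(\<lambda>z. u z * cnj (poly r z / z ^ n)) \<in> borel_measurable borel"
      by measurable
    fix z :: complex assume z: "cmod z = 1"
    have nz: "z \<noteq> 0" using z by auto
    have c: "cnj z = inverse z" using z nz by (simp add: field_simps complex_norm_square[symmetric] mult.commute)
    have "cnj (poly r z / z ^ n) = (\<Sum>k\<le>degree r. cnj (coeff r k) * inverse z ^ k) * z ^ n"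
      by (simp add: poly_altdef c divide_inverse power_inverse)
    then have "u z * cnj (poly r z / z ^ n) = (\<Sum>k\<le>degree r. u z * (cnj (coeff r k) * (inverse z ^ k * z ^ n)))"
      by (simp only: sum_distrib_left sum_distrib_right mult.assoc)
    also have "\<dots> = (\<Sum>k\<le>degree r. cnj (coeff r k) * (u z * z powi (int n - int k)))"
    proof (rule sum.cong)
      fix k
      have "inverse z ^ k * z ^ n = z powi (int n - int k)"
        using nz by (simp add: power_int_diff field_simps)
      then show "u z * (cnj (coeff r k) * (inverse z ^ k * z ^ n)) = cnj (coeff r k) * (u z * z powi (int n - int k))"
        by simp
    qed simp
    finally show "u z * cnj (poly r z / z ^ n) = (\<Sum>k\<le>degree r. cnj (coeff r k) * (u z * z powi (int n - int k)))" .
  qed measurable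
  also have "\<dots> = (\<Sum>k\<le>degree r. cnj (coeff r k) * fourier u (int k - int n))"
    using fourier_integrable[OF uL] by (simp add: fourier_def)
  also have "\<dots> = 0"
    using u deg by (intro sum.neutral) (auto simp: H2T_def)
  finally show ?thesis .
qed simp

text \<open>Division by \<open>z^n\<close> splits a trigonometric approximant into an analytic
  polynomial \<open>q\<close> and a remainder \<open>r / z^n\<close> that is orthogonal to H2. Since
  \<open>f - q\<close> lies in H2, dropping the remainder can only reduce the error, by
  Pythagoras.\<close>

lemma poly_dense:
  assumes f: "f \<in> H2T" and e: "e > 0"
  shows "\<exists>p. L2norm (\<lambda>z. f z - poly p z) < e"
proof -
  have fL: "f \<in> L2T" using f by (rule H2T_L2T)
  obtain p n where p: "L2norm (\<lambda>z. f z - poly p z / z ^ n) < e" using trig_dense[OF fL e] by blast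
  define q where "q = p div monom 1 n"
  define r where "r = p mod monom 1 n"
  have pqr: "p = monom 1 n * q + r" unfolding q_def r_def by simp
  have deg: "degree r < n \<or> r = 0"
    unfolding r_def using degree_mod_less[of "monom 1 n" p] by (auto simp: degree_monom_eq)
  define u where "u z = f z - poly q z" for z
  define d where "d z = poly r z / z ^ n" for z
  have uH: "u \<in> H2T" unfolding u_def by (rule H2T_diff[OF f poly_H2T])
  have uL: "u \<in> L2T" using uH by (rule H2T_L2T)
  have dL: "d \<in> L2T" unfolding d_def by (rule trig_L2T)
  have cd: "(\<lambda>z. cnj (d z)) \<in> L2T" using dL by (auto simp: L2T_iff)
  note [measurable] = uL[THEN L2T_measurable] dL[THEN L2T_measurable] fL[THEN L2T_measurable]
  have "(L2norm (\<lambda>z. f z - poly p z / z ^ n))^2 = (LINT z|circ_meas. (cmod (u z))^2 + (cmod (d z))^2 - 2 * Re (u z * cnj (d z)))"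
    unfolding L2norm_power2
  proof (rule integral_circ_cong)
    fix z :: complex assume "cmod z = 1"
    then have "z \<noteq> 0" by auto
    then have "f z - poly p z / z ^ n = u z - d z" unfolding u_def d_def pqr by (simp add: poly_monom field_simps)
    show "(cmod (f z - poly p z / z ^ n))^2 = (cmod (u z))^2 + (cmod (d z))^2 - 2 * Re (u z * cnj (d z))"
      unfolding \<open>f z - poly p z / z ^ n = u z - d z\<close> by (simp add: cmod_power2 power2_diff)
  qed measurable
  also have "\<dots> = (L2norm u)^2 + (L2norm d)^2 - 2 * Re (LINT z|circ_meas. u z * cnj (d z))"
    unfolding L2norm_power2
  proof -
    have "(LINT z|circ_meas. (cmod (u z))^2 + (cmod (d z))^2 - 2 * Re (c z))
        = (LINT z|circ_meas. (cmod (u z))^2) + (LINT z|circ_meas. (cmod (d z))^2) - 2 * Re (LINT z|circ_meas. c z)"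
      if "integrable circ_meas c" for c
      using that L2T_integrable[OF uL] L2T_integrable[OF dL] by simp
    from this[OF L2T_mult_integrable[OF uL cd]] show "(LINT z|circ_meas. (cmod (u z))^2 + (cmod (d z))^2 - 2 * Re (u z * cnj (d z)))
        = (LINT z|circ_meas. (cmod (u z))^2) + (LINT z|circ_meas. (cmod (d z))^2) - 2 * Re (LINT z|circ_meas. u z * cnj (d z))" .
  qed
  also have "(LINT z|circ_meas. u z * cnj (d z)) = 0" unfolding d_def by (rule cnj_trig_integral[OF uH deg])
  finally have "(L2norm u)^2 \<le> (L2norm (\<lambda>z. f z - poly p z / z ^ n))^2" by simp
  then have "L2norm u \<le> L2norm (\<lambda>z. f z - poly p z / z ^ n)"
    by (rule power2_le_imp_le) (rule L2norm_nonneg)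
  then have "L2norm (\<lambda>z. f z - poly q z) < e" using p by (simp add: u_def[abs_def])
  then show ?thesis by blast
qed

section \<open>Bounded analytic multipliers and Toeplitz operators on H2\<close>

text \<open>Multiplication by \<open>z^k\<close> shifts Fourier coefficients upwards by
  \<open>k\<close>, so a coefficient of negative index of the product involves only coefficients of
  negative index of \<open>\<phi>\<close>.\<close>

lemma HinfT_mult_poly:
  assumes \<phi>: "\<phi> \<in> HinfT"
  shows "(\<lambda>z. \<phi> z * poly p z) \<in> H2T"
proof -
  have \<phi>L: "\<phi> \<in> L2T" and \<phi>i: "\<phi> \<in> LinfT" using \<phi> by (auto simp: HinfT_def LinfT_subset_L2T)
  have [measurable]: "\<phi> \<in> borel_measurable borel" using \<phi>L by (rule L2T_measurable)
  have "fourier (\<lambda>z. \<phi> z * poly p z) n = 0" if n: "n < 0" for n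
  proof -
    have "fourier (\<lambda>z. \<phi> z * poly p z) n = (LINT z|circ_meas. (\<Sum>k\<le>degree p. coeff p k * (\<phi> z * z powi (int k - n))))"
      unfolding fourier_def
    proof (rule integral_circ_cong)
      fix z :: complex assume "cmod z = 1"
      then have nz: "z \<noteq> 0" by auto
      show "\<phi> z * poly p z * z powi (-n) = (\<Sum>k\<le>degree p. coeff p k * (\<phi> z * z powi (int k - n)))"
        unfolding poly_altdef using nz
        by (simp add: sum_distrib_left sum_distrib_right mult_ac power_int_diff power_int_minus divide_inverse)
    qed measurable
    also have "\<dots> = (\<Sum>k\<le>degree p. coeff p k * fourier \<phi> (n - int k))"
      using fourier_integrable[OF \<phi>L] by (simp add: fourier_def)
    also have "\<dots> = 0" using \<phi> n by (intro sum.neutral) (auto simp: HinfT_def)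
    finally show ?thesis .
  qed
  moreover have "(\<lambda>z. \<phi> z * poly p z) \<in> L2T" by (rule LinfT_mult_L2T[OF \<phi>i H2T_L2T[OF poly_H2T]])
  ultimately show ?thesis by (simp add: H2T_def)
qed

lemma HinfT_mult_H2T:
  assumes \<phi>: "\<phi> \<in> HinfT" and f: "f \<in> H2T"
  shows "(\<lambda>z. \<phi> z * f z) \<in> H2T"
proof (rule H2T_closed)
  have \<phi>i: "\<phi> \<in> LinfT" using \<phi> by (auto simp: HinfT_def)
  have [measurable]: "\<phi> \<in> borel_measurable borel" using \<phi>i by (rule LinfT_measurable)
  have fL: "f \<in> L2T" using f by (rule H2T_L2T)
  note [measurable] = fL[THEN L2T_measurable]
  show "(\<lambda>z. \<phi> z * f z) \<in> L2T" by (rule LinfT_mult_L2T[OF \<phi>i fL])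
  obtain C where C: "C > 0" "AE z in circ_meas. cmod (\<phi> z) \<le> C" using \<phi>i by (rule LinfT_bound)
  fix e :: real assume "e > 0"
  then obtain p where p: "L2norm (\<lambda>z. f z - poly p z) < e / C" using poly_dense[OF f, of "e / C"] C by auto
  have "L2norm (\<lambda>z. \<phi> z * f z - \<phi> z * poly p z) \<le> C * L2norm (\<lambda>z. f z - poly p z)"
  proof (rule L2norm_dominated)
    show "AE z in circ_meas. cmod (\<phi> z * f z - \<phi> z * poly p z) \<le> C * cmod (f z - poly p z)"
      using C(2) by eventually_elim (simp add: norm_mult mult_right_mono flip: right_diff_distrib)
  qed (use C in \<open>auto intro!: L2T_diff fL H2T_L2T[OF poly_H2T]\<close>)
  also have "\<dots> < e" using p C by (simp add: field_simps)
  finally show "\<exists>h\<in>H2T. L2norm (\<lambda>z. \<phi> z * f z - h z) < e"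
    using bexI[OF _ HinfT_mult_poly[OF \<phi>, of p], of "\<lambda>h. L2norm (\<lambda>z. \<phi> z * f z - h z) < e"] by simp
qed

text \<open>\<open>Pproj\<close> is a choice among functions. For \<open>g\<close> in H2,
  \<open>g\<close> itself satisfies the condition, so the choice is legitimate; and whatever is
  chosen differs from \<open>g\<close> by an element of H2 orthogonal to itself, that is, by a null
  function.\<close>

lemma
  assumes g: "g \<in> H2T"
  shows Pproj_H2T_in: "Pproj g \<in> H2T" and Pproj_H2T_AE: "AE z in circ_meas. Pproj g z = g z"
proof -
  let ?P = "\<lambda>g'. g' \<in> H2T \<and> (\<forall>h\<in>H2T. L2inner (\<lambda>z. g z - g' z) h = 0)"
  have "?P g" using g by (simp add: L2inner_def)
  then have P: "?P (Pproj g)" unfolding Pproj_def by (rule someI[of ?P])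
  then show in_H: "Pproj g \<in> H2T" by blast
  let ?d = "\<lambda>z. g z - Pproj g z"
  have d: "?d \<in> H2T" by (rule H2T_diff[OF g in_H])
  then have "L2inner ?d ?d = 0" using P by blast
  then have "of_real (LINT z|circ_meas. (cmod (?d z))^2) = (0::complex)"
    unfolding L2inner_def by (simp only: complex_norm_square[symmetric] integral_complex_of_real)
  then have "L2norm ?d = 0" by (simp add: L2norm_def)
  then have "AE z in circ_meas. ?d z = 0" by (rule L2norm_eq_0_AE[OF H2T_L2T[OF d]])
  then show "AE z in circ_meas. Pproj g z = g z" by eventually_elim simp
qed

lemma
  assumes "\<phi> \<in> HinfT" "f \<in> H2T"
  shows toeplitz_H2T: "toeplitz \<phi> f \<in> H2T"
    and toeplitz_AE: "AE z in circ_meas. toeplitz \<phi> f z = \<phi> z * f z"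
  using Pproj_H2T_in[OF HinfT_mult_H2T[OF assms]] Pproj_H2T_AE[OF HinfT_mult_H2T[OF assms]]
  by (simp_all add: toeplitz_def mult_def)

section \<open>Uniqueness and positivity\<close>

lemma integrable_mult_bounded:
  fixes f g :: "complex \<Rightarrow> complex"
  assumes "integrable circ_meas g" "f \<in> borel_measurable borel" "\<And>z. cmod z = 1 \<Longrightarrow> cmod (f z) \<le> B"
  shows "integrable circ_meas (\<lambda>z. f z * g z)"
proof (rule Bochner_Integration.integrable_bound)
  show "integrable circ_meas (\<lambda>z. B * cmod (g z))" using assms(1) by simp
  show "AE z in circ_meas. norm (f z * g z) \<le> norm (B * cmod (g z))"
  proof (rule AE_circI)
    fix z :: complex assume z: "cmod z = 1"
    have "0 \<le> B" using assms(3)[OF z] norm_ge_zero[of "f z"] by linarith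
    then show "norm (f z * g z) \<le> norm (B * cmod (g z))"
      using assms(3)[OF z] by (simp add: norm_mult mult_right_mono)
  qed
qed (use assms(1,2) in auto)

lemma integral_limit_bounded:
  fixes g :: "complex \<Rightarrow> complex"
  assumes g: "integrable circ_meas g"
    and f: "\<And>n. f n \<in> borel_measurable borel" "\<And>n z. cmod z = 1 \<Longrightarrow> cmod (f n z) \<le> B"
    and f0: "f0 \<in> borel_measurable borel"
    and lim: "AE z in circ_meas. (\<lambda>n. f n z) \<longlonglongrightarrow> f0 z"
  shows "(\<lambda>n. LINT z|circ_meas. f n z * g z) \<longlonglongrightarrow> (LINT z|circ_meas. f0 z * g z)"
proof (rule integral_dominated_convergence[where w = "\<lambda>z. B * cmod (g z)"])
  have [measurable]: "g \<in> borel_measurable borel" using g by auto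
  show "(\<lambda>z. f0 z * g z) \<in> borel_measurable circ_meas" "\<And>n. (\<lambda>z. f n z * g z) \<in> borel_measurable circ_meas"
    using f(1) f0 by auto
  show "integrable circ_meas (\<lambda>z. B * cmod (g z))" using g by simp
  show "AE z in circ_meas. (\<lambda>n. f n z * g z) \<longlonglongrightarrow> f0 z * g z"
    using lim by eventually_elim (intro tendsto_intros)
  show "AE z in circ_meas. norm (f n z * g z) \<le> B * cmod (g z)" for n
    by (rule AE_circI) (simp add: norm_mult mult_right_mono f(2))
qed

lemma trig_limit_continuous:
  assumes h: "continuous_on UNIV (h :: complex \<Rightarrow> real)" "\<And>z. \<bar>h z\<bar> \<le> 1"
  obtains p n where "\<And>k z. cmod z = 1 \<Longrightarrow> cmod (poly (p k) z / z ^ n k) \<le> 2"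
    "AE z in circ_meas. (\<lambda>k. poly (p k) z / z ^ n k) \<longlonglongrightarrow> complex_of_real (h z)"
proof -
  have "\<exists>p n. \<forall>z. cmod z = 1 \<longrightarrow> cmod (complex_of_real (h z) - poly p z / z ^ n) < 1 / real (Suc k)" for k
    by (rule trig_approx_continuous) (use h(1) continuous_on_subset in auto)
  then obtain p n where p: "\<And>k z. cmod z = 1 \<Longrightarrow> cmod (complex_of_real (h z) - poly (p k) z / z ^ n k) < 1 / real (Suc k)"
    by metis
  show thesis
  proof (rule that)
    \<comment> \<open>The bound is 1 for \<open>h\<close> plus the error, which is largest at
      \<open>k = 0\<close> and then below 1. Its independence of \<open>k\<close> is what dominated
      convergence asks for.\<close>
    show "cmod (poly (p k) z / z ^ n k) \<le> 2" if "cmod z = 1" for k z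
    proof -
      have "1 / real (Suc k) \<le> 1" by simp
      moreover have "cmod (complex_of_real (h z)) \<le> 1" using h(2) by simp
      ultimately show ?thesis
        using p[OF that, of k] norm_triangle_ineq2[of "poly (p k) z / z ^ n k" "complex_of_real (h z)"]
        unfolding norm_minus_commute[of "poly (p k) z / z ^ n k"] by linarith
    qed
    show "AE z in circ_meas. (\<lambda>k. poly (p k) z / z ^ n k) \<longlonglongrightarrow> of_real (h z)"
    proof (rule AE_circI)
      fix z :: complex assume z: "cmod z = 1"
      have "(\<lambda>k. complex_of_real (h z) - poly (p k) z / z ^ n k) \<longlonglongrightarrow> 0"
      proof (rule tendsto_norm_zero_cancel, rule tendsto_sandwich[OF _ _ tendsto_const])
        show "(\<lambda>n. 1 / real (Suc n)) \<longlonglongrightarrow> 0" using LIMSEQ_inverse_real_of_nat by (simp add: inverse_eq_divide)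
      qed (use p[OF z] in \<open>auto intro!: always_eventually simp: less_imp_le\<close>)
      from tendsto_diff[OF tendsto_const[of "complex_of_real (h z)"] this]
      show "(\<lambda>k. poly (p k) z / z ^ n k) \<longlonglongrightarrow> of_real (h z)" by simp
    qed
  qed
qed

text \<open>The functional "integrate against \<open>g\<close>" vanishes on powers of
  \<open>z\<close>, hence on Laurent polynomials, hence on continuous functions as bounded limits of
  these, hence on indicators. So \<open>g\<close> has integral 0 over every Borel set.\<close>

lemma fourier_zero_imp_AE_zero:
  assumes g: "integrable circ_meas g" and fz: "\<And>n. fourier g n = 0"
  shows "AE z in circ_meas. g z = 0"
proof (rule circ.density_zero[OF g])
  have [measurable]: "g \<in> borel_measurable borel" using g by auto
  have trig: "(LINT z|circ_meas. (poly p z / z ^ n) * g z) = 0" for p n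
  proof -
    have "(LINT z|circ_meas. (poly p z / z ^ n) * g z) = (LINT z|circ_meas. (\<Sum>k\<le>degree p. coeff p k * (g z * z powi (- (int n - int k)))))"
    proof (rule integral_circ_cong)
      fix z :: complex assume "cmod z = 1"
      then have nz: "z \<noteq> 0" by auto
      show "(poly p z / z ^ n) * g z = (\<Sum>k\<le>degree p. coeff p k * (g z * z powi (- (int n - int k))))"
        unfolding poly_altdef using nz
        by (simp add: sum_distrib_left sum_distrib_right sum_divide_distrib mult_ac power_int_diff power_int_minus divide_inverse)
    qed measurable
    also have "\<dots> = (\<Sum>k\<le>degree p. coeff p k * fourier g (int n - int k))"
    proof -
      have "integrable circ_meas (\<lambda>z. g z * z powi (- (int n - int k)))" for k
        using integrable_mult_bounded[OF g, of "\<lambda>z. z powi (- (int n - int k))" 1] by (simp add: norm_power_int mult.commute)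
      then show ?thesis by (simp add: fourier_def)
    qed
    also have "\<dots> = 0" using fz by simp
    finally show ?thesis .
  qed
  have cont: "(LINT z|circ_meas. of_real (h z) * g z) = 0" if h: "continuous_on UNIV (h :: complex \<Rightarrow> real)" "\<And>z. \<bar>h z\<bar> \<le> 1" for h
  proof -
    obtain p n where p: "\<And>k z. cmod z = 1 \<Longrightarrow> cmod (poly (p k) z / z ^ n k) \<le> 2"
      "AE z in circ_meas. (\<lambda>k. poly (p k) z / z ^ n k) \<longlonglongrightarrow> complex_of_real (h z)"
      by (rule trig_limit_continuous[OF h]) blast
    have [measurable]: "h \<in> borel_measurable borel" using h(1) by (rule borel_measurable_continuous_onI)
    have "(\<lambda>k. LINT z|circ_meas. (poly (p k) z / z ^ n k) * g z) \<longlonglongrightarrow> (LINT z|circ_meas. of_real (h z) * g z)"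
      by (rule integral_limit_bounded[OF g _ p(1) _ p(2)]) measurable
    then show ?thesis unfolding trig by (simp add: LIMSEQ_const_iff)
  qed
  fix A assume "A \<in> sets circ_meas"
  then have [measurable]: "A \<in> sets borel" by simp
  then obtain h :: "nat \<Rightarrow> complex \<Rightarrow> real" where h: "\<And>n. continuous_on UNIV (h n)" "\<And>n z. 0 \<le> h n z" "\<And>n z. h n z \<le> 1"
    "AE z in circ_meas. (\<lambda>n. h n z) \<longlonglongrightarrow> indicator A z" by (rule indicator_approx_AE) blast
  have [measurable]: "h n \<in> borel_measurable borel" for n by (rule borel_measurable_continuous_onI) (rule h)
  have "(\<lambda>n. LINT z|circ_meas. of_real (h n z) * g z) \<longlonglongrightarrow> (LINT z|circ_meas. of_real (indicator A z) * g z)"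
  proof (rule integral_limit_bounded[OF g, where B = 1])
    show "AE z in circ_meas. (\<lambda>n. complex_of_real (h n z)) \<longlonglongrightarrow> of_real (indicator A z)"
      using h(4) by eventually_elim (rule tendsto_of_real)
  qed (use h(2,3) in \<open>auto\<close>)
  moreover have "(LINT z|circ_meas. of_real (h n z) * g z) = 0" for n
    by (rule cont) (use h(1-3) in \<open>auto\<close>)
  ultimately have "(LINT z|circ_meas. of_real (indicator A z) * g z) = 0" by (simp add: LIMSEQ_const_iff)
  then show "set_lebesgue_integral circ_meas A g = 0"
    by (simp add: set_lebesgue_integral_def scaleR_conv_of_real)
qed

text \<open>The passage from polynomials to continuous functions to indicators also works for the
  quadratic expression in \<open>|f|^2\<close>. It ends with integrals of \<open>g\<close> over
  Borel sets because an indicator is its own square.\<close>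

lemma AE_nonneg_if_poly_integrals_nonneg:
  fixes g :: "complex \<Rightarrow> real"
  assumes g: "integrable circ_meas g"
    and pos: "\<And>p. (LINT z|circ_meas. (cmod (poly p z))^2 * g z) \<ge> 0"
  shows "AE z in circ_meas. g z \<ge> 0"
proof (rule circ.density_nonneg[OF g])
  have [measurable]: "g \<in> borel_measurable borel" using g by auto
  have lim: "(\<lambda>n. LINT z|circ_meas. (cmod (f n z))^2 * g z) \<longlonglongrightarrow> (LINT z|circ_meas. (cmod (f0 z))^2 * g z)"
    if m: "\<And>n. f n \<in> borel_measurable borel" "f0 \<in> borel_measurable borel"
    and b: "\<And>n z. cmod z = 1 \<Longrightarrow> cmod (f n z) \<le> B"
    and l: "AE z in circ_meas. (\<lambda>n. f n z) \<longlonglongrightarrow> f0 z" for f :: "nat \<Rightarrow> complex \<Rightarrow> complex" and f0 B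
  proof (rule integral_dominated_convergence[where w = "\<lambda>z. B^2 * \<bar>g z\<bar>"])
    note [measurable] = m
    show "(\<lambda>z. (cmod (f0 z))^2 * g z) \<in> borel_measurable circ_meas" "\<And>n. (\<lambda>z. (cmod (f n z))^2 * g z) \<in> borel_measurable circ_meas"
      by simp_all
    show "integrable circ_meas (\<lambda>z. B^2 * \<bar>g z\<bar>)" using g by simp
    show "AE z in circ_meas. (\<lambda>n. (cmod (f n z))^2 * g z) \<longlonglongrightarrow> (cmod (f0 z))^2 * g z"
      using l by eventually_elim (intro tendsto_intros)
    show "AE z in circ_meas. norm ((cmod (f n z))^2 * g z) \<le> B^2 * \<bar>g z\<bar>" for n
      by (rule AE_circI) (simp add: abs_mult mult_right_mono power_mono b)
  qed
  have trig: "(LINT z|circ_meas. (cmod (poly p z / z ^ n))^2 * g z) \<ge> 0" for p n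
  proof -
    have "(LINT z|circ_meas. (cmod (poly p z / z ^ n))^2 * g z) = (LINT z|circ_meas. (cmod (poly p z))^2 * g z)"
      by (rule integral_circ_cong) (auto simp: norm_divide norm_power)
    then show ?thesis using pos by simp
  qed
  have cont: "(LINT z|circ_meas. (cmod (of_real (h z)))^2 * g z) \<ge> 0" if h: "continuous_on UNIV (h :: complex \<Rightarrow> real)" "\<And>z. \<bar>h z\<bar> \<le> 1" for h
  proof -
    obtain p n where p: "\<And>k z. cmod z = 1 \<Longrightarrow> cmod (poly (p k) z / z ^ n k) \<le> 2"
      "AE z in circ_meas. (\<lambda>k. poly (p k) z / z ^ n k) \<longlonglongrightarrow> complex_of_real (h z)"
      by (rule trig_limit_continuous[OF h]) blast
    have [measurable]: "h \<in> borel_measurable borel" using h(1) by (rule borel_measurable_continuous_onI)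
    have "(\<lambda>k. LINT z|circ_meas. (cmod (poly (p k) z / z ^ n k))^2 * g z) \<longlonglongrightarrow> (LINT z|circ_meas. (cmod (of_real (h z)))^2 * g z)"
      by (rule lim[OF _ _ p(1) p(2)]) measurable
    then show ?thesis by (rule LIMSEQ_le_const) (use trig in auto)
  qed
  fix A assume "A \<in> sets circ_meas"
  then have [measurable]: "A \<in> sets borel" by simp
  then obtain h :: "nat \<Rightarrow> complex \<Rightarrow> real" where h: "\<And>n. continuous_on UNIV (h n)" "\<And>n z. 0 \<le> h n z" "\<And>n z. h n z \<le> 1"
    "AE z in circ_meas. (\<lambda>n. h n z) \<longlonglongrightarrow> indicator A z" by (rule indicator_approx_AE) blast
  have [measurable]: "h n \<in> borel_measurable borel" for n by (rule borel_measurable_continuous_onI) (rule h)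
  have "(\<lambda>n. LINT z|circ_meas. (cmod (of_real (h n z)))^2 * g z) \<longlonglongrightarrow> (LINT z|circ_meas. (cmod (of_real (indicator A z)))^2 * g z)"
  proof (rule lim[where B = 1])
    show "AE z in circ_meas. (\<lambda>n. complex_of_real (h n z)) \<longlonglongrightarrow> of_real (indicator A z)"
      using h(4) by eventually_elim (rule tendsto_of_real)
  qed (use h(2,3) in \<open>auto\<close>)
  moreover have "(LINT z|circ_meas. (cmod (of_real (h n z)))^2 * g z) \<ge> 0" for n
    by (rule cont) (use h(1-3) in \<open>auto\<close>)
  ultimately have "(LINT z|circ_meas. (cmod (of_real (indicator A z)))^2 * g z) \<ge> 0"
    by (intro LIMSEQ_le_const) auto
  also have "(\<lambda>z. (cmod (of_real (indicator A z)))^2 * g z) = (\<lambda>z. indicator A z *\<^sub>R g z)"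
    by (auto split: split_indicator)
  finally show "set_lebesgue_integral circ_meas A g \<ge> 0"
    by (simp add: set_lebesgue_integral_def)
qed

section \<open>Finite Blaschke products on the circle\<close>

lemma bfac_measurable [measurable]: "bfac a \<in> borel_measurable borel"
  unfolding bfac_def[abs_def] by measurable

lemma blaschke_Nil [simp]: "blaschke [] z = 1"
  and blaschke_Cons [simp]: "blaschke (a # as) z = bfac a z * blaschke as z"
  by (simp_all add: blaschke_def)

lemma blaschke_measurable [measurable]: "blaschke as \<in> borel_measurable borel"
proof (induction as)
  case (Cons a as)
  have "blaschke (a # as) = (\<lambda>z. bfac a z * blaschke as z)" by auto
  then show ?case using Cons by simp
qed (simp add: blaschke_def[abs_def])

lemma one_minus_cnj_mult_Re_pos:
  assumes "cmod a < 1" "cmod z \<le> 1"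
  shows "0 < Re (1 - cnj a * z)"
proof -
  have "cmod (cnj a * z) \<le> cmod a * 1" unfolding norm_mult complex_mod_cnj by (intro mult_left_mono) (use assms in auto)
  then show ?thesis using assms(1) complex_Re_le_cmod[of "cnj a * z"] by simp
qed

lemma one_minus_cnj_mult_nonzero:
  assumes "cmod a < 1" "cmod z \<le> 1"
  shows "1 - cnj a * z \<noteq> 0"
  using one_minus_cnj_mult_Re_pos[OF assms] by (metis less_irrefl zero_complex.sel(1))

text \<open>A smooth choice of the argument of \<open>bfac a (cis t)\<close>. With
  \<open>z = cis t\<close> and \<open>w = 1 - cnj a * z\<close> one has
  \<open>a - z = - z * cnj w\<close>, so the factor is the unimodular constant
  \<open>- |a| / a\<close> times \<open>z * cnj w / w\<close>. As \<open>Re w > 0\<close>, the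
  principal logarithm of \<open>w\<close> is smooth and periodic in \<open>t\<close>; the summand
  \<open>t\<close> carries the winding.\<close>

definition bfac_angle :: "complex \<Rightarrow> real \<Rightarrow> real" where
  "bfac_angle a t = (if a = 0 then 0 else Arg (- of_real (cmod a) / a)) + t - 2 * Im (Ln (1 - cnj a * cis t))"

lemma bfac_cis:
  assumes "cmod a < 1"
  shows "bfac a (cis t) = cis (bfac_angle a t)"
proof (cases "a = 0")
  case False
  define w where "w = 1 - cnj a * cis t"
  have wnz: "w \<noteq> 0" unfolding w_def by (rule one_minus_cnj_mult_nonzero[OF assms]) simp
  have k: "- of_real (cmod a) / a = cis (Arg (- of_real (cmod a) / a))"
    using cis_Arg_unique[of "- of_real (cmod a) / a"] Arg_correct[of "- of_real (cmod a) / a"] False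
    by (simp add: sgn_div_norm norm_divide)
  have w: "w = of_real (cmod w) * cis (Im (Ln w))"
    using exp_Ln[OF wnz] Re_Ln[OF wnz] wnz by (metis exp_eq_polar exp_ln exp_of_real zero_less_norm_iff)
  have "cis (- (2 * Im (Ln w))) * w = cnj w"
  proof -
    have "cis (- (2 * Im (Ln w))) * (of_real (cmod w) * cis (Im (Ln w))) = of_real (cmod w) * cis (- Im (Ln w))"
      by (simp add: cis_mult mult.left_commute)
    also have "\<dots> = cnj (of_real (cmod w) * cis (Im (Ln w)))" by (simp add: cis_cnj)
    finally show ?thesis using w by metis
  qed
  then have q: "cis (- (2 * Im (Ln w))) = cnj w / w" using wnz by (simp add: field_simps)
  have c: "cis t * cnj w = cis t - a" unfolding w_def by (simp add: algebra_simps cis_cnj cis_mult)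
  have "cis (bfac_angle a t) = cis (Arg (- of_real (cmod a) / a)) * cis t * cis (- (2 * Im (Ln w)))"
    using False by (simp add: bfac_angle_def w_def cis_mult)
  also have "\<dots> = (- of_real (cmod a) / a) * ((cis t * cnj w) / w)" unfolding q k[symmetric] by simp
  also have "\<dots> = bfac a (cis t)" unfolding c using False by (simp add: bfac_def w_def divide_simps) (simp add: algebra_simps)
  finally show ?thesis by simp
qed (simp add: bfac_def bfac_angle_def)

text \<open>The Poisson kernel of the point \<open>a\<close>.\<close>

definition bfac_angle_deriv :: "complex \<Rightarrow> real \<Rightarrow> real" where
  "bfac_angle_deriv a t = (1 - (cmod a)^2) / (cmod (1 - cnj a * cis t))^2"

text \<open>With \<open>w = 1 - cnj a * cis t\<close> the derivative is
  \<open>2 Re (1/w) - 1 = (2 Re w - |w|^2) / |w|^2\<close>, and \<open>|1 - w| = |a|\<close> turns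
  the numerator into \<open>1 - |a|^2\<close>.\<close>

lemma bfac_angle_has_derivative:
  assumes "cmod a < 1"
  shows "(bfac_angle a has_real_derivative bfac_angle_deriv a t) (at t)"
proof -
  define w where "w = 1 - cnj a * cis t"
  have Re: "0 < Re w" unfolding w_def by (rule one_minus_cnj_mult_Re_pos[OF assms]) simp
  then have wnz: "w \<noteq> 0" and wL: "w \<notin> \<real>\<^sub>\<le>\<^sub>0" by (auto simp: complex_nonpos_Reals_iff)
  have "(cis has_vector_derivative \<i> * cis t) (at t)"
    unfolding cis_conv_exp
    by (rule has_vector_derivative_real_field) (auto intro!: derivative_eq_intros simp: exp_def[symmetric])
  then have h1: "((\<lambda>t. 1 - cnj a * cis t) has_vector_derivative (0 - cnj a * (\<i> * cis t))) (at t)"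
    by (intro derivative_intros)
  have h2: "(Ln has_field_derivative inverse w) (at (1 - cnj a * cis t))"
    using has_field_derivative_Ln[OF wL] by (simp add: w_def)
  have "((\<lambda>t. Ln (1 - cnj a * cis t)) has_vector_derivative (0 - cnj a * (\<i> * cis t)) * inverse w) (at t)"
    using field_vector_diff_chain_at[OF h1 h2] by (simp add: o_def)
  then have "((\<lambda>t. Im (Ln (1 - cnj a * cis t))) has_vector_derivative Im ((0 - cnj a * (\<i> * cis t)) * inverse w)) (at t)"
    by (rule bounded_linear.has_vector_derivative[OF bounded_linear_Im])
  then have h3: "((\<lambda>t. Im (Ln (1 - cnj a * cis t))) has_real_derivative Im ((0 - cnj a * (\<i> * cis t)) * inverse w)) (at t)"
    by (simp add: has_real_derivative_iff_has_vector_derivative)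
  have "(bfac_angle a has_real_derivative 0 + 1 - 2 * Im ((0 - cnj a * (\<i> * cis t)) * inverse w)) (at t)"
    unfolding bfac_angle_def[abs_def]
    by (intro DERIV_diff DERIV_add DERIV_const DERIV_ident DERIV_cmult h3)
  moreover have "0 + 1 - 2 * Im ((0 - cnj a * (\<i> * cis t)) * inverse w) = bfac_angle_deriv a t"
  proof -
    have "(0 - cnj a * (\<i> * cis t)) * inverse w = \<i> * ((w - 1) * inverse w)" unfolding w_def by simp
    also have "\<dots> = \<i> * (1 - inverse w)" using wnz by (simp add: left_diff_distrib)
    finally have "0 + 1 - 2 * Im ((0 - cnj a * (\<i> * cis t)) * inverse w) = 2 * Re (inverse w) - 1" by simp
    also have "\<dots> = (2 * Re w - (cmod w)^2) / (cmod w)^2"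
    proof -
      have "Re (inverse w) = Re w / (cmod w)^2" by (simp add: cmod_power2)
      then show ?thesis using wnz by (simp add: diff_divide_distrib)
    qed
    also have "2 * Re w - (cmod w)^2 = 1 - (cmod a)^2"
    proof -
      have "(cmod (cnj a * cis t))^2 = (cmod a)^2" by (simp add: norm_mult)
      moreover have "(cmod (1 - w))^2 = 1 - 2 * Re w + (cmod w)^2" by (simp add: cmod_power2 power2_diff algebra_simps)
      moreover have "1 - w = cnj a * cis t" by (simp add: w_def)
      ultimately show ?thesis by simp
    qed
    finally show ?thesis by (simp add: bfac_angle_deriv_def w_def)
  qed
  ultimately show ?thesis by simp
qed

locale finite_blaschke =
  fixes \<alpha>s :: "complex list"
  assumes nonempty: "\<alpha>s \<noteq> []" and zeros_in_disc: "\<forall>a\<in>set \<alpha>s. cmod a < 1"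
begin

abbreviation b :: "complex \<Rightarrow> complex" where "b \<equiv> blaschke \<alpha>s"
abbreviation N :: nat where "N \<equiv> length \<alpha>s"

text \<open>The map \<open>\<theta>\<close> of the overview: \<open>b\<close> on the circle, lifted
  to the universal cover.\<close>

definition lift :: "real \<Rightarrow> real" where "lift t = (\<Sum>a\<leftarrow>\<alpha>s. bfac_angle a t)"
definition lift_deriv :: "real \<Rightarrow> real" where "lift_deriv t = (\<Sum>a\<leftarrow>\<alpha>s. bfac_angle_deriv a t)"

lemma N_pos: "N > 0" using nonempty by simp

lemma blaschke_cis: "b (cis t) = cis (lift t)"
proof -
  have "blaschke as (cis t) = cis (\<Sum>a\<leftarrow>as. bfac_angle a t)" if "\<forall>a\<in>set as. cmod a < 1" for as
    using that by (induction as) (auto simp: bfac_cis cis_mult)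
  then show ?thesis using zeros_in_disc by (simp add: lift_def)
qed

lemma norm_blaschke_circle: "cmod z = 1 \<Longrightarrow> cmod (b z) = 1"
  using blaschke_cis[of "Arg z"] cis_Arg[of z] by (cases "z = 0") (auto simp: sgn_div_norm)

lemma circle_cis: "cmod z = 1 \<Longrightarrow> z = cis (Im (Ln z))"
  using exp_Ln[of z] Re_Ln[of z] exp_eq_polar[of "Ln z"] by (cases "z = 0") auto

lemma lift_has_derivative: "(lift has_real_derivative lift_deriv t) (at t)"
proof -
  have "((\<lambda>t. \<Sum>a\<leftarrow>as. bfac_angle a t) has_real_derivative (\<Sum>a\<leftarrow>as. bfac_angle_deriv a t)) (at t)"
    if "\<forall>a\<in>set as. cmod a < 1" for as
    using that by (induction as) (auto intro!: derivative_eq_intros bfac_angle_has_derivative)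
  then show ?thesis using zeros_in_disc by (simp add: lift_def[abs_def] lift_deriv_def)
qed

lemma lift_deriv_pos: "lift_deriv t > 0"
proof -
  have p: "0 < bfac_angle_deriv a t" if "cmod a < 1" for a
    unfolding bfac_angle_deriv_def using one_minus_cnj_mult_nonzero[OF that, of "cis t"] that
    by (auto intro!: divide_pos_pos simp: abs_square_less_1)
  have "0 < (\<Sum>a\<leftarrow>as. bfac_angle_deriv a t)" if "\<forall>a\<in>set as. cmod a < 1" "as \<noteq> []" for as
    using that
  proof (induction as)
    case (Cons a as)
    then show ?case using p[of a] by (cases "as = []") auto
  qed simp
  then show ?thesis using zeros_in_disc nonempty by (simp add: lift_deriv_def)
qed

lemma continuous_lift_deriv: "continuous_on A lift_deriv"
proof -
  have "continuous_on A (\<lambda>t. \<Sum>a\<leftarrow>as. bfac_angle_deriv a t)" if "\<forall>a\<in>set as. cmod a < 1" for as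
    using that
  proof (induction as)
    case (Cons a as)
    have "continuous_on A (bfac_angle_deriv a)" unfolding bfac_angle_deriv_def[abs_def]
      using Cons.prems one_minus_cnj_mult_nonzero by (intro continuous_intros continuous_on_cis) auto
    then show ?case using Cons by (auto intro!: continuous_intros)
  qed simp
  then show ?thesis using zeros_in_disc by (simp add: lift_deriv_def[abs_def])
qed

text \<open>In each angle only the summand \<open>t\<close> fails to be periodic, so every zero
  contributes one turn: \<open>b\<close> winds the circle \<open>N\<close> times around
  itself.\<close>

lemma lift_shift: "lift (t + 2 * pi * of_int k) = lift t + 2 * pi * of_int (int N * k)"
proof -
  have c: "cis (t + 2 * pi * of_int k) = cis t"
    using cis_multiple_2pi[of "of_int k"] by (simp flip: cis_mult)
  have "(\<Sum>a\<leftarrow>as. bfac_angle a (t + 2 * pi * of_int k)) = (\<Sum>a\<leftarrow>as. bfac_angle a t) + 2 * pi * of_int (int (length as) * k)" for as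
  proof (induction as)
    case (Cons a as)
    have "bfac_angle a (t + 2 * pi * of_int k) = bfac_angle a t + 2 * pi * of_int k"
      unfolding bfac_angle_def c by simp
    then show ?case using Cons by (simp add: algebra_simps)
  qed simp
  then show ?thesis by (simp add: lift_def)
qed

lemma strict_mono_lift: "strict_mono lift"
proof (rule strict_monoI)
  fix s t :: real assume "s < t"
  then show "lift s < lift t"
    using DERIV_pos_imp_increasing[of s t lift] lift_has_derivative lift_deriv_pos by blast
qed

lemma continuous_lift: "continuous_on A lift"
  using lift_has_derivative by (meson DERIV_isCont continuous_at_imp_continuous_on)

lemma bij_lift: "bij lift"
proof (rule bijI)
  show "inj lift" using strict_mono_lift by (rule strict_mono_imp_inj_on)
  show "surj lift"
    unfolding surj_def
  proof
    fix y :: real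
    \<comment> \<open>\<open>k\<close> turns in either direction carry \<open>lift 0\<close> past
      \<open>y\<close>, because each of them changes \<open>lift\<close> by
      \<open>2 pi N \<ge> 1\<close>.\<close>
    define k :: int where "k = \<lceil>\<bar>y - lift 0\<bar>\<rceil>"
    have k: "\<bar>y - lift 0\<bar> \<le> of_int k" "k \<ge> 0" unfolding k_def by auto
    have "of_int k \<le> 2 * pi * of_int (int N * k)"
    proof -
      have "1 * real_of_int k \<le> 2 * pi * real N * real_of_int k"
      proof (rule mult_right_mono)
        have "1 \<le> real N" using N_pos by linarith
        then have "1 * 1 \<le> (2 * pi) * real N" using pi_gt3 by (intro mult_mono) auto
        then show "1 \<le> 2 * pi * real N" by simp
      qed (use k in simp)
      then show ?thesis by simp
    qed
    then have "lift (0 + 2 * pi * of_int (-k)) \<le> y" "y \<le> lift (0 + 2 * pi * of_int k)"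
      unfolding lift_shift using k(1) by auto
    moreover have "0 + 2 * pi * real_of_int (-k) \<le> 0 + 2 * pi * of_int k" using k(2) by simp
    ultimately obtain x where "lift x = y"
      using IVT'[of lift "0 + 2 * pi * of_int (-k)" y "0 + 2 * pi * of_int k"] continuous_lift by blast
    then show "\<exists>x. y = lift x" by blast
  qed
qed

definition unlift :: "real \<Rightarrow> real" where "unlift = inv lift"

lemma lift_unlift [simp]: "lift (unlift s) = s" and unlift_lift [simp]: "unlift (lift t) = t"
  using bij_lift by (simp_all add: unlift_def surj_f_inv_f bij_is_surj bij_is_inj)

lemma unlift_measurable [measurable]: "unlift \<in> borel_measurable borel"
proof (rule borel_measurable_mono, rule monoI)
  fix x y :: real assume "x \<le> y"
  then have "lift (unlift x) \<le> lift (unlift y)" by simp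
  then show "unlift x \<le> unlift y" using strict_mono_less_eq[OF strict_mono_lift] by blast
qed

lemma unlift_shift: "unlift (s + 2 * pi * of_int (int N * k)) = unlift s + 2 * pi * of_int k"
  using lift_shift[of "unlift s" k] by (metis lift_unlift unlift_lift)

lemma cis_eq_iff: "cis x = cis y \<longleftrightarrow> (\<exists>k::int. x = y + 2 * pi * of_int k)"
proof
  assume "cis x = cis y"
  then have "sin x = sin y \<and> cos x = cos y" by (simp add: complex_eq_iff)
  then show "\<exists>k::int. x = y + 2 * pi * of_int k" by (simp add: sin_cos_eq_iff)
next
  assume "\<exists>k::int. x = y + 2 * pi * of_int k"
  then show "cis x = cis y" by (auto simp: cis_multiple_2pi simp flip: cis_mult)
qed

text \<open>A point \<open>cis t\<close> lies over \<open>cis s\<close> exactly when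
  \<open>lift t = s + 2 pi j\<close> for some integer \<open>j\<close>. Increasing \<open>j\<close>
  by \<open>N\<close> moves \<open>t\<close> by a full turn, so the residues of \<open>j\<close>
  modulo \<open>N\<close> list the fibre without repetition.\<close>

lemma preimage_blaschke:
  shows "{w. cmod w = 1 \<and> b w = cis s} = (\<lambda>k. cis (unlift (s + 2 * pi * real k))) ` {..<N}"
    and "inj_on (\<lambda>k. cis (unlift (s + 2 * pi * real k))) {..<N}"
proof -
  show "{w. cmod w = 1 \<and> b w = cis s} = (\<lambda>k. cis (unlift (s + 2 * pi * real k))) ` {..<N}" (is "?A = ?B")
  proof
    show "?B \<subseteq> ?A"
      using cis_multiple_2pi by (auto simp: blaschke_cis simp flip: cis_mult)
    show "?A \<subseteq> ?B"
    proof
      fix w assume "w \<in> ?A"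
      then have w: "cmod w = 1" "b w = cis s" by auto
      obtain t where t: "w = cis t" using circle_cis[OF w(1)] by blast
      then obtain j :: int where j: "lift t = s + 2 * pi * of_int j" using w(2) by (auto simp: blaschke_cis cis_eq_iff)
      define k where "k = nat (j mod int N)"
      define q where "q = j div int N"
      have k: "k < N" "int k = j mod int N" using N_pos by (auto simp: k_def nat_less_iff)
      have jq: "j = int N * q + int k" unfolding k q_def by simp
      have "unlift (s + 2 * pi * real k + 2 * pi * of_int (int N * q)) = t"
        using arg_cong[OF j, of unlift] unfolding jq by (simp add: algebra_simps)
      then have "t = unlift (s + 2 * pi * real k) + 2 * pi * of_int q" by (simp only: unlift_shift)
      then have "w = cis (unlift (s + 2 * pi * real k))" unfolding t cis_eq_iff by blast
      then show "w \<in> ?B" using k by blast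
    qed
  qed
  show "inj_on (\<lambda>k. cis (unlift (s + 2 * pi * real k))) {..<N}"
  proof (rule inj_onI)
    fix k l assume kl: "k \<in> {..<N}" "l \<in> {..<N}" "cis (unlift (s + 2 * pi * real k)) = cis (unlift (s + 2 * pi * real l))"
    then obtain q :: int where "unlift (s + 2 * pi * real k) = unlift (s + 2 * pi * real l) + 2 * pi * of_int q"
      using cis_eq_iff by blast
    then have "lift (unlift (s + 2 * pi * real k)) = lift (unlift (s + 2 * pi * real l + 2 * pi * of_int (int N * q)))"
      unfolding unlift_shift by simp
    then have "2 * pi * real k = 2 * pi * (real l + of_int (int N * q))" by (simp add: algebra_simps)
    then have "real k = real l + of_int (int N * q)" by simp
    then have e: "int k = int l + int N * q" by (metis of_int_add of_int_eq_iff of_int_of_nat_eq)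
    have "int k = int k mod int N" "int l = int l mod int N" using kl by auto
    then show "k = l" using e by (metis mod_mult_self2 of_nat_eq_iff)
  qed
qed

lemma transfer_cis: "transfer \<alpha>s u (cis s) = (\<Sum>k<N. u (cis (unlift (s + 2 * pi * real k)))) / real N"
  unfolding transfer_def preimage_blaschke(1)
  by (subst sum.reindex[OF preimage_blaschke(2)]) simp

text \<open>The sum over a varying fibre becomes a sum of \<open>N\<close> measurable branches, with
  \<open>Im (Ln z)\<close> as the argument of \<open>z\<close>. Off the circle the fibre is empty,
  as \<open>b\<close> preserves the circle, and the sum is 0.\<close>

lemma transfer_measurable [measurable]:
  assumes [measurable]: "u \<in> borel_measurable borel"
  shows "transfer \<alpha>s u \<in> borel_measurable borel"
proof -
  have "transfer \<alpha>s u = (\<lambda>z. if cmod z = 1 then (\<Sum>k<N. u (cis (unlift (Im (Ln z) + 2 * pi * real k)))) / real N else 0)"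
  proof
    fix z :: complex
    show "transfer \<alpha>s u z = (if cmod z = 1 then (\<Sum>k<N. u (cis (unlift (Im (Ln z) + 2 * pi * real k)))) / real N else 0)"
    proof (cases "cmod z = 1")
      case True
      then show ?thesis using transfer_cis[of u "Im (Ln z)"] circle_cis[OF True] by simp
    next
      case False
      then have e: "{w. cmod w = 1 \<and> b w = z} = {}" using norm_blaschke_circle by auto
      show ?thesis using False unfolding transfer_def e by simp
    qed
  qed
  moreover have "(\<lambda>z. if cmod z = 1 then (\<Sum>k<N. u (cis (unlift (Im (Ln z) + 2 * pi * real k)))) / real N else 0) \<in> borel_measurable borel"
    by measurable
  ultimately show ?thesis by simp
qed

lemma transfer_nonneg: "(\<And>z. u z \<ge> 0) \<Longrightarrow> transfer \<alpha>s u z \<ge> 0"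
  unfolding transfer_def by (intro mult_nonneg_nonneg sum_nonneg) auto

text \<open>The point \<open>z\<close> belongs to the fibre over \<open>b z\<close>, so its own term
  is one of the nonnegative summands. Through this inequality a bound on the transfer becomes a
  bound on the symbol.\<close>

lemma transfer_ge_at_image:
  assumes "\<And>z. u z \<ge> 0" "cmod z = 1"
  shows "u z \<le> real N * transfer \<alpha>s u (b z)"
proof -
  have fin: "finite {w. cmod w = 1 \<and> b w = b z}"
  proof -
    obtain s where "b z = cis s" using circle_cis[OF norm_blaschke_circle[OF assms(2)]] by blast
    then show ?thesis using preimage_blaschke(1)[of s] by simp
  qed
  have "u z \<le> (\<Sum>w\<in>{w. cmod w = 1 \<and> b w = b z}. u w)"
    using member_le_sum[of z _ u] assms fin by auto
  then show ?thesis unfolding transfer_def using N_pos by simp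
qed

end

section \<open>Change of variables\<close>

lemma nn_integral_shift_interval:
  fixes G :: "real \<Rightarrow> ennreal"
  assumes [measurable]: "G \<in> borel_measurable borel"
  shows "(\<integral>\<^sup>+x\<in>{c + d..<c + e}. G x \<partial>lborel) = (\<integral>\<^sup>+x\<in>{d..<e}. G (c + x) \<partial>lborel)"
  by (subst nn_integral_real_affine[of _ 1 c]) (auto intro!: nn_integral_cong split: split_indicator)

lemma nn_integral_split_interval:
  fixes G :: "real \<Rightarrow> ennreal"
  assumes [measurable]: "G \<in> borel_measurable borel" and "a \<le> b" "b \<le> c"
  shows "(\<integral>\<^sup>+x\<in>{a..<c}. G x \<partial>lborel) = (\<integral>\<^sup>+x\<in>{a..<b}. G x \<partial>lborel) + (\<integral>\<^sup>+x\<in>{b..<c}. G x \<partial>lborel)"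
  using nn_integral_disjoint_pair[of G lborel "{a..<b}" "{b..<c}"] assms(2,3) by (simp add: ivl_disj_un_two(3))

lemma nn_integral_period:
  fixes G :: "real \<Rightarrow> ennreal"
  assumes [measurable]: "G \<in> borel_measurable borel" and "p > 0" and per: "\<And>x. G (p + x) = G x"
  shows "(\<integral>\<^sup>+x\<in>{a..<a + p}. G x \<partial>lborel) = (\<integral>\<^sup>+x\<in>{0..<p}. G x \<partial>lborel)"
proof -
  \<comment> \<open>\<open>c\<close> is the first multiple of \<open>p\<close> from \<open>a\<close>
    on. Moving the piece from \<open>a\<close> to \<open>c\<close> up by one period completes the
    rest to the full period that starts at \<open>c\<close>.\<close>
  define n where "n = \<lceil>a / p\<rceil>"
  define c where "c = p * of_int n"
  have perk: "G (p * of_int k + x) = G x" for x k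
  proof -
    have 1: "G (p * of_nat m + x) = G x" for m x
    proof (induction m)
      case (Suc m)
      have "G (p * of_nat (Suc m) + x) = G (p + (p * of_nat m + x))" by (simp add: algebra_simps)
      then show ?case using per Suc by simp
    qed simp
    show ?thesis
    proof (cases k)
      case (nonneg m)
      then show ?thesis using 1[of m x] by simp
    next
      case (neg m)
      have e: "p * of_nat (Suc m) + (p * of_int k + x) = x" unfolding neg by (simp add: algebra_simps)
      show ?thesis using 1[of "Suc m" "p * of_int k + x"] unfolding e by (rule sym)
    qed
  qed
  have "a / p \<le> of_int n" "of_int n - 1 < a / p" unfolding n_def using ceiling_correct[of "a / p"] by auto
  then have "a \<le> of_int n * p" "(of_int n - 1) * p < a"
    using \<open>p > 0\<close> by (simp_all only: pos_divide_le_eq pos_less_divide_eq)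
  then have "a \<le> c" "c < a + p"
    unfolding c_def by (simp_all add: algebra_simps)
  then have ac: "a \<le> c" "c \<le> a + p" "a + p \<le> c + p" by auto
  have "(\<integral>\<^sup>+x\<in>{a..<a + p}. G x \<partial>lborel) = (\<integral>\<^sup>+x\<in>{a..<c}. G x \<partial>lborel) + (\<integral>\<^sup>+x\<in>{c..<a + p}. G x \<partial>lborel)"
    using ac by (intro nn_integral_split_interval) auto
  also have "(\<integral>\<^sup>+x\<in>{a..<c}. G x \<partial>lborel) = (\<integral>\<^sup>+x\<in>{p + a..<p + c}. G x \<partial>lborel)"
    by (subst nn_integral_shift_interval) (auto simp: per)
  also have "\<dots> + (\<integral>\<^sup>+x\<in>{c..<a + p}. G x \<partial>lborel) = (\<integral>\<^sup>+x\<in>{c..<c + p}. G x \<partial>lborel)"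
    using ac nn_integral_split_interval[of G c "a + p" "c + p"] by (simp add: add.commute)
  also have "\<dots> = (\<integral>\<^sup>+x\<in>{0..<p}. G x \<partial>lborel)"
    using nn_integral_shift_interval[of G c 0 p] by (simp add: c_def perk)
  finally show ?thesis .
qed

lemma nn_integral_split_periods:
  fixes G :: "real \<Rightarrow> ennreal"
  assumes [measurable]: "G \<in> borel_measurable borel" and "p \<ge> 0"
  shows "(\<integral>\<^sup>+x\<in>{a..<a + p * real n}. G x \<partial>lborel) = (\<integral>\<^sup>+x\<in>{a..<a + p}. (\<Sum>k<n. G (x + p * real k)) \<partial>lborel)"
proof (induction n)
  case (Suc n)
  have "(\<integral>\<^sup>+x\<in>{a..<a + p * real (Suc n)}. G x \<partial>lborel)
      = (\<integral>\<^sup>+x\<in>{a..<a + p * real n}. G x \<partial>lborel) + (\<integral>\<^sup>+x\<in>{a + p * real n..<a + p * real (Suc n)}. G x \<partial>lborel)"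
    using assms(2) by (intro nn_integral_split_interval) (auto intro!: mult_left_mono)
  also have "(\<integral>\<^sup>+x\<in>{a + p * real n..<a + p * real (Suc n)}. G x \<partial>lborel) = (\<integral>\<^sup>+x\<in>{a..<a + p}. G (x + p * real n) \<partial>lborel)"
    using nn_integral_shift_interval[of G "p * real n" a "a + p"] by (simp add: algebra_simps)
  finally show ?case unfolding Suc.IH
    by (simp add: nn_integral_add distrib_right flip: sum_distrib_right)
qed simp

text \<open>Dropping the endpoint, a null set, leaves a half-open interval, whose translates tile
  the line without overlap.\<close>

lemma nn_integral_circ_half_open:
  assumes [measurable]: "f \<in> borel_measurable borel"
  shows "(\<integral>\<^sup>+z. f z \<partial>circ_meas) = ennreal (1 / (2*pi)) * (\<integral>\<^sup>+t\<in>{0..<2*pi}. f (cis t) \<partial>lborel)"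
proof -
  have "(\<integral>\<^sup>+z. f z \<partial>circ_meas) = (\<integral>\<^sup>+t. ennreal (1 / (2*pi)) * (f (cis t) * indicator {0..<2*pi} t) \<partial>lborel)"
    unfolding nn_integral_circ[OF assms]
    by (rule nn_integral_cong_AE, rule AE_mp[OF AE_lborel_singleton[of "2 * pi"]])
       (auto intro!: AE_I2 split: split_indicator simp: mult.commute)
  then show ?thesis by (simp add: nn_integral_cmult)
qed

context finite_blaschke
begin

text \<open>The density of the substitution \<open>z = b w\<close>; it agrees with \<open>J0\<close> on the circle.\<close>

definition j0 :: "complex \<Rightarrow> real" where "j0 z = Re (J0 \<alpha>s z)"

definition dom :: "complex set" where
  "dom = {z. \<forall>a\<in>set \<alpha>s. 1 - cnj a * z \<noteq> 0}"

lemma open_dom: "open dom"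
proof -
  have "dom = (\<Inter>a\<in>set \<alpha>s. {z. 1 - cnj a * z \<noteq> 0})" by (auto simp: dom_def)
  moreover have "open (\<Inter>a\<in>set \<alpha>s. {z. 1 - cnj a * z \<noteq> 0})"
    by (intro open_INT ballI open_Collect_neq continuous_intros) auto
  ultimately show ?thesis by simp
qed

lemma cball_subset_dom: "cball 0 1 \<subseteq> dom"
  using zeros_in_disc one_minus_cnj_mult_nonzero by (auto simp: dom_def)

lemma holomorphic_b: "b holomorphic_on dom"
proof -
  have "blaschke as holomorphic_on dom" if "set as \<subseteq> set \<alpha>s" for as
    using that
  proof (induction as)
    case Nil
    show ?case by (simp add: blaschke_def[abs_def])
  next
    case (Cons a as)
    have "bfac a holomorphic_on dom"
    proof (cases "a = 0")
      case False
      have "(\<lambda>z. (of_real (cmod a) / a) * ((a - z) / (1 - cnj a * z))) holomorphic_on dom"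
        using Cons.prems by (intro holomorphic_intros) (auto simp: dom_def)
      then show ?thesis using False by (simp add: bfac_def[abs_def])
    qed (simp add: bfac_def[abs_def])
    moreover have "blaschke (a # as) = (\<lambda>z. bfac a z * blaschke as z)" by auto
    ultimately show ?case using Cons by (auto intro!: holomorphic_intros)
  qed
  then show ?thesis by blast
qed

text \<open>The curve \<open>b (cis t) = cis (lift t)\<close> is differentiated in two ways, through
  \<open>b\<close> and through \<open>lift\<close>. Comparison gives
  \<open>z * b' z = lift' * b z\<close>, so the logarithmic derivative \<open>J0\<close> is real on
  the circle.\<close>

lemma J0_cis: "J0 \<alpha>s (cis t) = of_real (lift_deriv t / real N)"
proof -
  have in_dom: "cis t \<in> dom" using cball_subset_dom by auto
  have c: "(cis has_vector_derivative \<i> * cis t) (at t)" for t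
    unfolding cis_conv_exp
    by (rule has_vector_derivative_real_field) (auto intro!: derivative_eq_intros simp: exp_def[symmetric])
  have "(b has_field_derivative deriv b (cis t)) (at (cis t))"
    using holomorphic_derivI[OF holomorphic_b open_dom in_dom] .
  from field_vector_diff_chain_at[OF c this]
  have 1: "((\<lambda>t. b (cis t)) has_vector_derivative (\<i> * cis t) * deriv b (cis t)) (at t)" by (simp add: o_def)
  have "((\<lambda>t. cis (lift t)) has_vector_derivative lift_deriv t *\<^sub>R (\<i> * cis (lift t))) (at t)"
    using vector_diff_chain_at[OF lift_has_derivative[unfolded has_real_derivative_iff_has_vector_derivative] c]
    by (simp add: o_def)
  then have 2: "((\<lambda>t. b (cis t)) has_vector_derivative lift_deriv t *\<^sub>R (\<i> * b (cis t))) (at t)"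
    by (simp add: blaschke_cis)
  have "(\<i> * cis t) * deriv b (cis t) = lift_deriv t *\<^sub>R (\<i> * b (cis t))"
    using vector_derivative_unique_at[OF 1 2] .
  then have "cis t * deriv b (cis t) = of_real (lift_deriv t) * b (cis t)"
    by (simp add: scaleR_conv_of_real)
  moreover have "b (cis t) \<noteq> 0" using norm_blaschke_circle[of "cis t"] by auto
  ultimately show ?thesis unfolding J0_def using N_pos by (simp add: field_simps)
qed

lemma j0_cis: "j0 (cis t) = lift_deriv t / real N"
  unfolding j0_def J0_cis by simp

lemma J0_eq_j0: "cmod z = 1 \<Longrightarrow> J0 \<alpha>s z = of_real (j0 z)"
  using circle_cis[of z] J0_cis[of "Im (Ln z)"] j0_cis[of "Im (Ln z)"] by simp

lemma j0_pos: "cmod z = 1 \<Longrightarrow> j0 z > 0"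
  using circle_cis[of z] j0_cis[of "Im (Ln z)"] lift_deriv_pos N_pos by simp

lemma holomorphic_deriv_b: "deriv b holomorphic_on dom"
  by (rule holomorphic_deriv[OF holomorphic_b open_dom])

text \<open>The derivative of \<open>b\<close> is continuous away from the finitely many poles
  \<open>1 / cnj a\<close>. Whatever values \<open>deriv\<close> takes at the poles, preimages there
  are finite sets and therefore Borel.\<close>

lemma J0_measurable [measurable]: "J0 \<alpha>s \<in> borel_measurable borel"
proof -
  have [measurable]: "dom \<in> sets borel" using open_dom by simp
  have cont: "continuous_on dom (deriv b)" by (rule holomorphic_on_imp_continuous_on[OF holomorphic_deriv_b])
  have fin: "finite (- dom)"
  proof (rule finite_subset)
    show "- dom \<subseteq> (\<lambda>a. 1 / cnj a) ` set \<alpha>s"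
    proof
      fix z assume "z \<in> - dom"
      then obtain a where a: "a \<in> set \<alpha>s" "1 = cnj a * z" by (auto simp: dom_def)
      then have "z = 1 / cnj a" by (cases "a = 0") (auto simp: field_simps)
      then show "z \<in> (\<lambda>a. 1 / cnj a) ` set \<alpha>s" using a by blast
    qed
  qed simp
  have "deriv b \<in> borel_measurable borel"
  proof (rule borel_measurableI)
    fix S :: "complex set" assume "open S"
    have "open (deriv b -` S \<inter> dom)" using cont open_dom \<open>open S\<close> by (simp add: continuous_on_open_vimage)
    then have "deriv b -` S \<inter> dom \<in> sets borel" by simp
    moreover have "deriv b -` S \<inter> - dom \<in> sets borel"
      by (rule borel_closed, rule finite_imp_closed) (use fin in auto)
    ultimately have "(deriv b -` S \<inter> dom) \<union> (deriv b -` S \<inter> - dom) \<in> sets borel" by (rule sets.Un)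
    also have "(deriv b -` S \<inter> dom) \<union> (deriv b -` S \<inter> - dom) = deriv b -` S" by auto
    finally show "deriv b -` S \<inter> space borel \<in> sets borel" by simp
  qed
  then show ?thesis unfolding J0_def[abs_def] by measurable
qed

lemma j0_measurable [measurable]: "j0 \<in> borel_measurable borel"
  unfolding j0_def[abs_def] by measurable

text \<open>The substitution \<open>s = lift t\<close> stretches one turn to \<open>N\<close> turns.
  Cutting these apart yields one summand for each branch of the inverse, and the \<open>1/N\<close>
  in \<open>j0 = lift' / N\<close> becomes the \<open>1/N\<close> of the transfer operator. The
  resulting integrand depends only on \<open>cis s\<close>, so the turn that starts at
  \<open>lift 0\<close> may be replaced by the one that starts at 0.\<close>

lemma nn_integral_transfer:
  assumes [measurable]: "u \<in> borel_measurable borel" "v \<in> borel_measurable borel"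
    and u: "\<And>z. u z \<ge> 0" and v: "\<And>z. v z \<ge> 0"
  shows "(\<integral>\<^sup>+z. ennreal (v (b z) * u z * j0 z) \<partial>circ_meas) = (\<integral>\<^sup>+z. ennreal (v z * transfer \<alpha>s u z) \<partial>circ_meas)"
proof -
  have [measurable]: "lift \<in> borel_measurable borel"
    by (intro borel_measurable_continuous_onI continuous_lift)
  define f where "f s = v (cis s) * u (cis (unlift s)) / real N" for s
  have [measurable]: "f \<in> borel_measurable borel" unfolding f_def[abs_def] by measurable
  have f0: "f s \<ge> 0" for s unfolding f_def using u v by simp
  define c where "c = ennreal (1 / (2*pi))"
  have l2: "lift (2 * pi) = lift 0 + 2 * pi * real N" using lift_shift[of 0 1] by simp
  have ind: "indicator {0..2 * pi} t = (indicator {lift 0..lift (2*pi)} (lift t) :: real)" for t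
    using strict_mono_less_eq[OF strict_mono_lift] by (auto split: split_indicator)
  have "(\<integral>\<^sup>+z. ennreal (v (b z) * u z * j0 z) \<partial>circ_meas)
      = (\<integral>\<^sup>+t. ennreal (indicator {0..2*pi} t / (2*pi)) * ennreal (v (b (cis t)) * u (cis t) * j0 (cis t)) \<partial>lborel)"
    by (rule nn_integral_circ) measurable
  also have "\<dots> = (\<integral>\<^sup>+t. c * ennreal (f (lift t) * lift_deriv t * indicator {0..2*pi} t) \<partial>lborel)"
    by (intro nn_integral_cong) (auto simp: c_def f_def blaschke_cis j0_cis split: split_indicator)
  also have "\<dots> = c * (\<integral>\<^sup>+t. ennreal (f (lift t) * lift_deriv t * indicator {0..2*pi} t) \<partial>lborel)"
  proof (rule nn_integral_cmult)
    have [measurable]: "lift_deriv \<in> borel_measurable borel"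
      by (intro borel_measurable_continuous_onI continuous_lift_deriv)
    show "(\<lambda>t. ennreal (f (lift t) * lift_deriv t * indicator {0..2*pi} t)) \<in> borel_measurable lborel" by measurable
  qed
  also have "(\<integral>\<^sup>+t. ennreal (f (lift t) * lift_deriv t * indicator {0..2*pi} t) \<partial>lborel)
      = (\<integral>\<^sup>+s. ennreal (f s * indicator {lift 0..lift (2*pi)} s) \<partial>lborel)"
  proof (rule nn_integral_substitution[symmetric])
    show "set_borel_measurable borel {lift 0..lift (2 * pi)} f"
      unfolding set_borel_measurable_def by measurable
  qed (use lift_has_derivative lift_deriv_pos continuous_lift_deriv in \<open>auto intro: less_imp_le\<close>)
  also have "\<dots> = (\<integral>\<^sup>+s\<in>{lift 0..<lift 0 + 2 * pi * real N}. ennreal (f s) \<partial>lborel)"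
    by (rule nn_integral_cong_AE, rule AE_mp[OF AE_lborel_singleton[of "lift (2*pi)"]])
       (auto intro!: AE_I2 split: split_indicator simp: l2)
  also have "\<dots> = (\<integral>\<^sup>+s\<in>{lift 0..<lift 0 + 2 * pi}. (\<Sum>k<N. ennreal (f (s + 2 * pi * real k))) \<partial>lborel)"
    by (rule nn_integral_split_periods) auto
  also have "\<dots> = (\<integral>\<^sup>+s\<in>{lift 0..<lift 0 + 2 * pi}. ennreal (v (cis s) * transfer \<alpha>s u (cis s)) \<partial>lborel)"
  proof (intro nn_integral_cong arg_cong2[where f = "(*)"] refl)
    fix s
    have cs: "cis (s + 2 * pi * real k) = cis s" for k using cis_eq_iff[of "s + 2 * pi * real k" s] of_int_of_nat_eq by metis
    have "(\<Sum>k<N. ennreal (f (s + 2 * pi * real k))) = ennreal (\<Sum>k<N. f (s + 2 * pi * real k))"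
      using f0 by (intro sum_ennreal) auto
    also have "(\<Sum>k<N. f (s + 2 * pi * real k)) = v (cis s) * transfer \<alpha>s u (cis s)"
      unfolding f_def transfer_cis cs by (simp add: sum_distrib_left sum_divide_distrib)
    finally show "(\<Sum>k<N. ennreal (f (s + 2 * pi * real k))) = ennreal (v (cis s) * transfer \<alpha>s u (cis s))" .
  qed
  also have "\<dots> = (\<integral>\<^sup>+s\<in>{0..<2 * pi}. ennreal (v (cis s) * transfer \<alpha>s u (cis s)) \<partial>lborel)"
  proof (rule nn_integral_period)
    show "ennreal (v (cis (2 * pi + x)) * transfer \<alpha>s u (cis (2 * pi + x))) = ennreal (v (cis x) * transfer \<alpha>s u (cis x))" for x
      by (simp flip: cis_mult)
  qed auto
  also have "c * \<dots> = (\<integral>\<^sup>+z. ennreal (v z * transfer \<alpha>s u z) \<partial>circ_meas)"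
    unfolding c_def by (rule nn_integral_circ_half_open[symmetric]) measurable
  finally show ?thesis .
qed

text \<open>Both integrands are nonnegative almost everywhere, so the equality of extended integrals
  carries finiteness in both directions. The equivalence later decides membership in L2.\<close>

lemma
  assumes [measurable]: "u \<in> borel_measurable borel" "v \<in> borel_measurable borel"
    and u: "\<And>z. u z \<ge> 0" and v: "\<And>z. v z \<ge> 0"
  shows integral_transfer: "(LINT z|circ_meas. v (b z) * u z * j0 z) = (LINT z|circ_meas. v z * transfer \<alpha>s u z)"
    and integrable_transfer_iff: "integrable circ_meas (\<lambda>z. v (b z) * u z * j0 z) \<longleftrightarrow> integrable circ_meas (\<lambda>z. v z * transfer \<alpha>s u z)"
proof -
  have 1: "AE z in circ_meas. 0 \<le> v (b z) * u z * j0 z"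
    by (rule AE_circI) (intro mult_nonneg_nonneg u v less_imp_le[OF j0_pos])
  have 2: "AE z in circ_meas. 0 \<le> v z * transfer \<alpha>s u z"
    by (intro AE_I2 mult_nonneg_nonneg v transfer_nonneg u)
  have m: "(\<lambda>z. v (b z) * u z * j0 z) \<in> borel_measurable circ_meas" "(\<lambda>z. v z * transfer \<alpha>s u z) \<in> borel_measurable circ_meas"
    by simp_all
  show "(LINT z|circ_meas. v (b z) * u z * j0 z) = (LINT z|circ_meas. v z * transfer \<alpha>s u z)"
    using nn_integral_transfer[OF assms] m 1 2 by (simp add: integral_eq_nn_integral)
  have i: "integrable circ_meas h \<longleftrightarrow> (\<integral>\<^sup>+z. ennreal (h z) \<partial>circ_meas) < \<infinity>"
    if h: "h \<in> borel_measurable circ_meas" "AE z in circ_meas. 0 \<le> h z" for h :: "complex \<Rightarrow> real"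
  proof -
    have "(\<integral>\<^sup>+z. ennreal (norm (h z)) \<partial>circ_meas) = (\<integral>\<^sup>+z. ennreal (h z) \<partial>circ_meas)"
      by (rule nn_integral_cong_AE) (use h(2) in eventually_elim, simp)
    then show ?thesis using h(1) by (simp add: integrable_iff_bounded)
  qed
  show "integrable circ_meas (\<lambda>z. v (b z) * u z * j0 z) \<longleftrightarrow> integrable circ_meas (\<lambda>z. v z * transfer \<alpha>s u z)"
    unfolding i[OF m(1) 1] i[OF m(2) 2] nn_integral_transfer[OF assms] ..
qed

text \<open>Preimages of null sets under \<open>b\<close> are null: the change of variables, applied
  to the indicator of a null set \<open>A\<close>, makes the integral of \<open>j0\<close> over the
  preimage of \<open>A\<close> vanish, and \<open>j0\<close> is positive on the circle.\<close>

lemma AE_compose_blaschke: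
  assumes "AE z in circ_meas. P z"
  shows "AE z in circ_meas. P (b z)"
proof -
  obtain A where A: "{z. \<not> P z} \<subseteq> A" "A \<in> null_sets circ_meas"
    using assms by (auto simp: eventually_ae_filter)
  then have [measurable]: "A \<in> sets borel" by auto
  have nA: "AE z in circ_meas. z \<notin> A" using A(2) by (rule AE_not_in)
  have "(\<integral>\<^sup>+z. ennreal (indicator A (b z) * 1 * j0 z) \<partial>circ_meas) = (\<integral>\<^sup>+z. ennreal (indicator A z * transfer \<alpha>s (\<lambda>_. 1) z) \<partial>circ_meas)"
    by (rule nn_integral_transfer) auto
  also have "\<dots> = (\<integral>\<^sup>+z. 0 \<partial>circ_meas)"
    by (rule nn_integral_cong_AE) (use nA in eventually_elim, simp)
  finally have "(\<integral>\<^sup>+z. ennreal (indicator A (b z) * 1 * j0 z) \<partial>circ_meas) = 0" by simp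
  then have "AE z in circ_meas. ennreal (indicator A (b z) * 1 * j0 z) = 0"
    by (subst (asm) nn_integral_0_iff_AE) auto
  then show ?thesis using AE_circ_norm
  proof eventually_elim
    fix z assume "ennreal (indicator A (b z) * 1 * j0 z) = 0" "cmod z = 1"
    then have "b z \<notin> A" using j0_pos[of z] by (auto split: split_indicator_asm)
    then show "P (b z)" using A(1) by blast
  qed
qed

end

section \<open>Outer functions with smooth modulus\<close>

lemma cnj_eq_inverse: "cmod z = 1 \<Longrightarrow> cnj z = inverse z"
  by (metis complex_norm_square div_by_1 inverse_unique mult.commute of_real_1 power_one)

lemma fourier_cnj:
  assumes [measurable]: "f \<in> borel_measurable borel"
  shows "fourier (\<lambda>z. cnj (f z)) m = cnj (fourier f (- m))"
proof -
  have "fourier (\<lambda>z. cnj (f z)) m = (LINT z|circ_meas. cnj (f z * z powi (- (- m))))"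
    unfolding fourier_def
  proof (rule integral_circ_cong)
    fix z :: complex assume z: "cmod z = 1"
    have "cnj (z powi m) = (cnj z) powi m" by (simp add: power_int_def)
    also have "\<dots> = z powi (- m)" unfolding cnj_eq_inverse[OF z] by (simp add: power_int_minus power_int_inverse)
    finally show "cnj (f z) * z powi (- m) = cnj (f z * z powi (- (- m)))" by simp
  qed measurable
  also have "\<dots> = cnj (LINT z|circ_meas. f z * z powi (- (- m)))" by (simp del: complex_cnj_mult)
  finally show ?thesis unfolding fourier_def[of f] .
qed

lemma integral_circ_powi: "(LINT z|circ_meas. z powi m) = (if m = 0 then 1 else 0)"
proof -
  have pos: "(LINT z|circ_meas. z powi m) = 0" if "m > 0" for m
  proof -
    have "fourier (\<lambda>_. 1) (- m) = 0" using that by (intro fourier_holomorphic) auto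
    then show ?thesis by (simp add: fourier_def)
  qed
  show ?thesis
  proof (cases m "0::int" rule: linorder_cases)
    case less
    have "fourier (\<lambda>z. cnj 1) (- m) = cnj (fourier (\<lambda>_. 1) (- (- m)))" by (rule fourier_cnj) simp
    then show ?thesis using pos[of "- m"] less by (simp add: fourier_def)
  qed (use pos in auto)
qed

text \<open>\<open>k\<close> is the logarithm of the prescribed modulus. Quadratic decay makes its
  Fourier series absolutely summable; the coefficients of negative index are conjugates of the
  others because \<open>k\<close> is real.\<close>

locale outer_boundary =
  fixes k :: "complex \<Rightarrow> real" and B C :: real
  assumes k_measurable [measurable]: "k \<in> borel_measurable borel"
    and k_bounded: "\<And>z. cmod z = 1 \<Longrightarrow> \<bar>k z\<bar> \<le> B"
    and fourier_decay: "\<And>n::nat. n > 0 \<Longrightarrow> cmod (fourier (\<lambda>z. of_real (k z)) (int n)) \<le> C / real n ^ 2"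
begin

definition cf :: "int \<Rightarrow> complex" where "cf n = fourier (\<lambda>z. of_real (k z)) n"

text \<open>The Taylor coefficients of the Herglotz integral of \<open>k\<close>: the kernel
  \<open>(w + z) / (w - z)\<close> is \<open>1 + 2 (z/w) + 2 (z/w)^2 + ...\<close>, whence the
  factor 2 beyond the constant term.\<close>

definition a :: "nat \<Rightarrow> complex" where "a n = (if n = 0 then 1 else 2) * cf (int n)"

definition G :: "complex \<Rightarrow> complex" where "G z = (\<Sum>n. a n * z ^ n)"

lemma summable_norm_a: "summable (\<lambda>n. cmod (a n))"
proof (rule summable_comparison_test)
  show "\<exists>n0. \<forall>n\<ge>n0. norm (cmod (a n)) \<le> 2 * C * inverse (real n ^ 2)"
    using fourier_decay unfolding a_def cf_def
    by (intro exI[of _ 1]) (auto simp: norm_mult divide_inverse mult.assoc)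
  show "summable (\<lambda>n. 2 * C * inverse (real n ^ 2))"
    by (intro summable_mult inverse_power_summable) simp
qed

lemma norm_term_le: "cmod z \<le> 1 \<Longrightarrow> cmod (a n * z ^ n) \<le> cmod (a n)"
  by (simp add: norm_mult norm_power mult_left_le power_le_one)

lemma G_sums: "cmod z \<le> 1 \<Longrightarrow> (\<lambda>n. a n * z ^ n) sums G z"
  unfolding G_def using norm_term_le
  by (intro summable_sums summable_norm_cancel[OF summable_comparison_test[OF _ summable_norm_a]]) auto

lemma G_measurable [measurable]: "G \<in> borel_measurable borel"
  unfolding G_def[abs_def] by measurable

lemma continuous_G: "continuous_on (cball 0 1) G"
proof -
  have "uniform_limit (cball 0 1) (\<lambda>n z. \<Sum>i<n. a i * z ^ i) (\<lambda>z. \<Sum>i. a i * z ^ i) sequentially"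
    by (rule Weierstrass_m_test[OF _ summable_norm_a]) (use norm_term_le in auto)
  then have "continuous_on (cball 0 1) (\<lambda>z. \<Sum>i. a i * z ^ i)"
    by (rule uniform_limit_theorem[rotated]) (auto intro!: always_eventually continuous_intros)
  then show ?thesis by (simp add: G_def[abs_def])
qed

lemma holomorphic_G: "G holomorphic_on ball 0 1"
  by (rule power_series_holomorphic[of 0 1 a]) (use G_sums in \<open>auto simp: less_imp_le\<close>)

lemma cf_0_real: "cnj (cf 0) = cf 0" and cf_minus: "cf (- n) = cnj (cf n)"
proof -
  have "fourier (\<lambda>z. cnj (of_real (k z))) m = cnj (fourier (\<lambda>z. of_real (k z)) (- m))" for m
    by (rule fourier_cnj) measurable
  then have *: "cf m = cnj (cf (- m))" for m unfolding cf_def complex_cnj_complex_of_real .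
  have "cf 0 = cnj (cf 0)" using *[of 0] unfolding minus_zero .
  then show "cnj (cf 0) = cf 0" by (rule sym)
  show "cf (- n) = cnj (cf n)" using *[of "- n"] unfolding minus_minus .
qed

lemma fourier_G: "fourier G m = (if m < 0 then 0 else a (nat m))"
proof -
  have "fourier G m = (LINT z|circ_meas. (\<Sum>n. a n * z powi (int n - m)))"
    unfolding fourier_def
  proof (rule integral_circ_cong)
    fix z :: complex assume z: "cmod z = 1"
    then have nz: "z \<noteq> 0" by auto
    have "(\<lambda>n. a n * z ^ n * z powi (- m)) sums (G z * z powi (- m))"
      by (intro sums_mult2 G_sums) (use z in simp)
    moreover have "a n * z ^ n * z powi (- m) = a n * z powi (int n - m)" for n
      using nz by (simp add: power_int_diff power_int_minus divide_inverse)
    ultimately show "G z * z powi (- m) = (\<Sum>n. a n * z powi (int n - m))" by (simp add: sums_iff)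
  qed measurable
  also have "\<dots> = (\<Sum>n. LINT z|circ_meas. a n * z powi (int n - m))"
  proof (rule integral_suminf)
    show "integrable circ_meas (\<lambda>z. a n * z powi (int n - m))" for n
      by (rule integrable_circ_bounded[of _ "cmod (a n)"]) (auto simp: norm_mult norm_power_int)
    show "AE z in circ_meas. summable (\<lambda>n. norm (a n * z powi (int n - m)))"
      by (rule AE_circI) (simp add: norm_mult norm_power_int summable_norm_a)
    have "(LINT z|circ_meas. norm (a n * z powi (int n - m))) = (LINT z|circ_meas. cmod (a n))" for n
    proof (rule integral_circ_cong)
      show "(\<lambda>z. norm (a n * z powi (int n - m))) \<in> borel_measurable borel" by measurable
    qed (auto simp: norm_mult norm_power_int)
    then show "summable (\<lambda>n. LINT z|circ_meas. norm (a n * z powi (int n - m)))" using summable_norm_a by simp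
  qed
  also have "\<dots> = (\<Sum>n. if int n = m then a n else 0)"
    by (intro suminf_cong) (simp add: integral_circ_powi)
  also have "\<dots> = (if m < 0 then 0 else a (nat m))"
  proof (cases "m < 0")
    case True
    then have "(\<lambda>n. if int n = m then a n else 0) = (\<lambda>n. 0)" by auto
    then show ?thesis using True by simp
  next
    case False
    then have "int n = m \<longleftrightarrow> n = nat m" for n by linarith
    then have "(\<lambda>n. if int n = m then a n else 0) = (\<lambda>n. if n = nat m then a n else 0)" by simp
    moreover have "(\<lambda>n. if n = nat m then a n else 0) sums a (nat m)" by (rule sums_single)
    ultimately show ?thesis using False by (simp add: sums_iff)
  qed
  finally show ?thesis .
qed

lemma norm_G_le: "cmod z \<le> 1 \<Longrightarrow> cmod (G z) \<le> (\<Sum>n. cmod (a n))"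
proof -
  assume z: "cmod z \<le> 1"
  have s: "summable (\<lambda>n. cmod (a n * z ^ n))"
    using norm_term_le[OF z] by (intro summable_comparison_test[OF _ summable_norm_a]) auto
  have "cmod (G z) \<le> (\<Sum>n. cmod (a n * z ^ n))" unfolding G_def by (rule summable_norm[OF s])
  also have "\<dots> \<le> (\<Sum>n. cmod (a n))" by (rule suminf_le[OF norm_term_le[OF z] s summable_norm_a])
  finally show ?thesis .
qed

text \<open>The function \<open>(G + cnj G) / 2\<close> has the Fourier coefficients of
  \<open>k\<close>: halving undoes the factor 2, the conjugate supplies the negative indices, and
  the constant term is real. Uniqueness of Fourier coefficients does the rest.\<close>

lemma Re_G_AE: "AE z in circ_meas. Re (G z) = k z"
proof -
  let ?h = "\<lambda>z. (1/2) * G z + ((1/2) * cnj (G z) + (-1) * of_real (k z))"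
  have GL: "G \<in> L2T" by (rule L2T_bounded[of _ "\<Sum>n. cmod (a n)"]) (auto intro: norm_G_le)
  have cGL: "(\<lambda>z. cnj (G z)) \<in> L2T" by (rule L2T_bounded[of _ "\<Sum>n. cmod (a n)"]) (auto intro: norm_G_le)
  have kL: "(\<lambda>z. complex_of_real (k z)) \<in> L2T" by (rule L2T_bounded[of _ B]) (use k_bounded in auto)
  have hL: "(\<lambda>z. (1/2) * cnj (G z) + (-1) * of_real (k z)) \<in> L2T"
    by (intro L2T_add L2T_cmult cGL kL)
  have "?h \<in> L2T" by (intro L2T_add L2T_cmult GL hL)
  have "integrable circ_meas (\<lambda>z. ?h z * 1)"
    by (rule L2T_mult_integrable[OF \<open>?h \<in> L2T\<close>]) (rule L2T_bounded[of _ 1], auto)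
  then have "integrable circ_meas ?h" by simp
  moreover have "fourier ?h m = 0" for m
  proof -
    have "fourier ?h m = (1/2) * fourier G m + ((1/2) * fourier (\<lambda>z. cnj (G z)) m + fourier (\<lambda>z. (-1) * of_real (k z)) m)"
      using fourier_lincomb[OF GL hL, of "1/2" m] fourier_lincomb[OF cGL L2T_cmult[OF kL, of "-1"], of "1/2" m] by simp
    also have "fourier (\<lambda>z. (-1) * of_real (k z)) m = - cf m" by (simp add: fourier_def cf_def)
    also have "fourier (\<lambda>z. cnj (G z)) m = cnj (fourier G (- m))" by (rule fourier_cnj) measurable
    also have "(1/2) * fourier G m + ((1/2) * cnj (fourier G (- m)) + - cf m) = 0"
      using cf_0_real cf_minus[of m] by (cases m "0::int" rule: linorder_cases) (auto simp: fourier_G a_def cf_minus)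
    finally show ?thesis .
  qed
  ultimately have "AE z in circ_meas. ?h z = 0" by (rule fourier_zero_imp_AE_zero)
  then show ?thesis
  proof eventually_elim
    fix z assume "?h z = 0"
    then have "Re (?h z) = 0" by simp
    then show "Re (G z) = k z" by simp
  qed
qed

text \<open>The kernel is expanded geometrically in \<open>z / w\<close>. For fixed \<open>z\<close>
  in the open disc the terms are bounded by \<open>2 B |z|^n\<close> on the whole circle, so the
  series may be integrated term by term.\<close>

lemma herglotz_disc:
  assumes z: "cmod z < 1"
  shows "(LINT w|circ_meas. ((w + z) / (w - z)) * of_real (k w)) = G z"
proof -
  define e :: "nat \<Rightarrow> complex" where "e n = (if n = 0 then 1 else 2)" for n
  define f where "f n w = e n * z ^ n * (of_real (k w) * w powi (- int n))" for n w
  have [measurable]: "f n \<in> borel_measurable borel" for n unfolding f_def[abs_def] by measurable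
  have kB: "B \<ge> 0" using k_bounded[of 1] by simp
  have nf: "norm (f n w) \<le> 2 * B * cmod z ^ n" if "cmod w = 1" for n w
  proof -
    have "norm (f n w) = cmod (e n) * cmod z ^ n * \<bar>k w\<bar>"
      using that by (simp add: f_def norm_mult norm_power norm_power_int)
    also have "\<dots> \<le> 2 * cmod z ^ n * B" using k_bounded[OF that] by (intro mult_mono) (auto simp: e_def)
    finally show ?thesis by (simp add: mult_ac)
  qed
  have sz: "summable (\<lambda>n. 2 * B * cmod z ^ n)" using z by (intro summable_mult summable_geometric) simp
  have int: "integrable circ_meas (f n)" for n by (rule integrable_circ_bounded[of _ "2 * B * cmod z ^ n"]) (use nf in auto)
  have sums: "(\<lambda>n. f n w) sums (((w + z) / (w - z)) * of_real (k w))" if w: "cmod w = 1" for w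
  proof -
    have nz: "w \<noteq> 0" "w \<noteq> z" using w z by auto
    have x: "norm (z / w) < 1" using w z by (simp add: norm_divide)
    have 1: "(\<lambda>n. 2 * (z / w) ^ n - (if n = 0 then 1 else 0)) sums (2 * (1 / (1 - z / w)) - 1)"
      by (intro sums_diff sums_mult geometric_sums x) (rule sums_single[of 0 "\<lambda>_. 1", simplified])
    have 2: "2 * (z / w) ^ n - (if n = 0 then 1 else 0) = e n * (z / w) ^ n" for n by (simp add: e_def)
    have 3: "2 * (1 / (1 - z / w)) - 1 = (w + z) / (w - z)" using nz by (simp add: field_simps)
    have 4: "e n * (z / w) ^ n * of_real (k w) = f n w" for n
      by (simp add: f_def power_mult_distrib power_int_minus divide_inverse power_inverse)
    show ?thesis using sums_mult2[OF 1, of "of_real (k w)"] unfolding 2 3 4 .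
  qed
  have "(LINT w|circ_meas. ((w + z) / (w - z)) * of_real (k w)) = (LINT w|circ_meas. (\<Sum>n. f n w))"
    by (rule integral_circ_cong) (use sums in \<open>auto simp: sums_iff\<close>)
  also have "\<dots> = (\<Sum>n. LINT w|circ_meas. f n w)"
  proof (rule integral_suminf[OF int])
    show "AE w in circ_meas. summable (\<lambda>n. norm (f n w))"
      by (rule AE_circI, rule summable_comparison_test[OF _ sz]) (use nf in auto)
    show "summable (\<lambda>n. LINT w|circ_meas. norm (f n w))"
    proof (rule summable_comparison_test[OF _ sz], intro exI allI impI)
      fix n
      have "(LINT w|circ_meas. norm (f n w)) \<le> (LINT w|circ_meas. 2 * B * cmod z ^ n)"
        by (rule integral_mono_AE) (use int nf in \<open>auto intro!: AE_circI\<close>)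
      then show "norm (LINT w|circ_meas. norm (f n w)) \<le> 2 * B * cmod z ^ n" by simp
    qed
  qed
  also have "\<dots> = G z"
    unfolding G_def a_def by (intro suminf_cong) (simp add: f_def e_def cf_def fourier_def)
  finally show ?thesis .
qed

text \<open>Reflecting \<open>z\<close> in the circle replaces the kernel by minus its conjugate,
  and \<open>k\<close> is real. The formula gives the boundary function a measurable expression
  outside the disc, where its definition by radial limits still assigns values.\<close>

lemma herglotz_exterior:
  assumes z: "cmod z > 1"
  shows "(LINT w|circ_meas. ((w + z) / (w - z)) * of_real (k w)) = - cnj (G (1 / cnj z))"
proof -
  let ?z' = "1 / cnj z"
  have z': "cmod ?z' < 1" using z by (auto simp: norm_divide divide_less_eq_1)
  have "(LINT w|circ_meas. ((w + z) / (w - z)) * of_real (k w)) = (LINT w|circ_meas. - cnj (((w + ?z') / (w - ?z')) * of_real (k w)))"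
  proof (rule integral_circ_cong)
    fix w :: complex assume w: "cmod w = 1"
    then have nz: "w \<noteq> 0" "w \<noteq> z" "z \<noteq> 0" using z by auto
    have "cnj (((w + ?z') / (w - ?z')) * of_real (k w)) = ((inverse w + 1 / z) / (inverse w - 1 / z)) * of_real (k w)"
      by (simp add: cnj_eq_inverse[OF w])
    also have "(inverse w + 1 / z) / (inverse w - 1 / z) = (z + w) / (z - w)" using nz by (simp add: field_simps)
    also have "\<dots> = - ((w + z) / (w - z))" using nz by (metis add.commute minus_diff_eq minus_divide_right)
    finally show "((w + z) / (w - z)) * of_real (k w) = - cnj (((w + ?z') / (w - ?z')) * of_real (k w))" by simp
  qed measurable
  also have "\<dots> = - cnj (LINT w|circ_meas. ((w + ?z') / (w - ?z')) * of_real (k w))" by (simp del: complex_cnj_mult complex_cnj_divide)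
  finally show ?thesis unfolding herglotz_disc[OF z'] .
qed

text \<open>By absolute summability \<open>G\<close> is continuous on the closed disc, so the limit
  exists at every point of the circle and not just almost everywhere. For \<open>w\<close> outside
  the closed disc the points \<open>r * w\<close> stay outside once \<open>r\<close> is close to
  1.\<close>

lemma radial_limit:
  "Lim (at_left 1) (\<lambda>r::real. outer_fn k (of_real r * w))
     = (if cmod w \<le> 1 then exp (G w) else exp (- cnj (G (1 / cnj w))))"
proof (rule tendsto_Lim)
  have rlim: "((\<lambda>r. of_real r * w) \<longlongrightarrow> of_real 1 * w) (at_left 1)"
    by (intro tendsto_intros)
  have left: "eventually (\<lambda>r::real. 0 < r \<and> r < 1) (at_left 1)"
    using eventually_at_left_real[of 0 1] by (simp add: eventually_mono)
  show "((\<lambda>r::real. outer_fn k (of_real r * w)) \<longlongrightarrow> (if cmod w \<le> 1 then exp (G w) else exp (- cnj (G (1 / cnj w))))) (at_left 1)"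
  proof (cases "cmod w \<le> 1")
    case True
    have r: "cmod (of_real r * w) < 1" if "0 < r \<and> r < 1" for r
    proof -
      have "r * cmod w \<le> r * 1" using True that by (intro mult_left_mono) auto
      moreover have "cmod (of_real r * w) = r * cmod w" using that by (simp add: norm_mult)
      ultimately show ?thesis using that by linarith
    qed
    have "((\<lambda>r. exp (G (of_real r * w))) \<longlongrightarrow> exp (G (of_real 1 * w))) (at_left 1)"
    proof (intro tendsto_exp continuous_on_tendsto_compose[OF continuous_G rlim])
      show "of_real 1 * w \<in> cball 0 1" using True by simp
      show "eventually (\<lambda>r. of_real r * w \<in> cball 0 1) (at_left 1)"
        using left by eventually_elim (use r in \<open>auto simp: less_imp_le\<close>)
    qed
    then have "((\<lambda>r. exp (G (of_real r * w))) \<longlongrightarrow> exp (G w)) (at_left 1)" by simp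
    moreover have "eventually (\<lambda>r. exp (G (of_real r * w)) = outer_fn k (of_real r * w)) (at_left 1)"
      using left by eventually_elim (use r herglotz_disc in \<open>auto simp: outer_fn_def\<close>)
    ultimately show ?thesis using True Lim_transform_eventually by fastforce
  next
    case False
    then have wn: "w \<noteq> 0" "cmod w > 1" by auto
    have "eventually (\<lambda>r. r * cmod w > 1) (at_left 1)"
    proof (rule order_tendstoD(1))
      show "((\<lambda>r. r * cmod w) \<longlongrightarrow> 1 * cmod w) (at_left 1)" by (intro tendsto_intros)
    qed (use wn in simp)
    then have ev: "eventually (\<lambda>r. cmod (of_real r * w) > 1) (at_left 1)"
      using left by eventually_elim (simp add: norm_mult)
    have "((\<lambda>r. exp (- cnj (G (1 / cnj (of_real r * w))))) \<longlongrightarrow> exp (- cnj (G (1 / cnj (of_real 1 * w))))) (at_left 1)"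
    proof (intro tendsto_exp tendsto_minus tendsto_cnj continuous_on_tendsto_compose[OF continuous_G])
      show "((\<lambda>r. 1 / cnj (of_real r * w)) \<longlongrightarrow> 1 / cnj (of_real 1 * w)) (at_left 1)"
        by (intro tendsto_divide tendsto_const tendsto_cnj rlim) (use wn in simp)
      show "1 / cnj (of_real 1 * w) \<in> cball 0 1" using wn by (simp add: norm_divide)
      show "eventually (\<lambda>r. 1 / cnj (of_real r * w) \<in> cball 0 1) (at_left 1)"
        using ev by eventually_elim (auto simp: norm_divide divide_le_eq_1 simp del: complex_cnj_mult)
    qed
    then have "((\<lambda>r. exp (- cnj (G (1 / cnj (of_real r * w))))) \<longlongrightarrow> exp (- cnj (G (1 / cnj w)))) (at_left 1)" by simp
    moreover have "eventually (\<lambda>r. exp (- cnj (G (1 / cnj (of_real r * w)))) = outer_fn k (of_real r * w)) (at_left 1)"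
      using ev by eventually_elim (simp only: outer_fn_def herglotz_exterior)
    ultimately show ?thesis using False Lim_transform_eventually by fastforce
  qed
qed simp

end

section \<open>Decay of Fourier coefficients of smooth functions\<close>

lemma integral_circ_HK:
  fixes f :: "complex \<Rightarrow> complex"
  assumes [measurable]: "f \<in> borel_measurable borel" and cont: "continuous_on {0..2*pi} (\<lambda>t. f (cis t))"
  shows "(LINT z|circ_meas. f z) = (1 / (2*pi)) *\<^sub>R integral {0..2*pi} (\<lambda>t. f (cis t))"
proof -
  have "set_integrable lborel {0..2*pi} (\<lambda>t. f (cis t))"
    using cont by (intro borel_integrable_atLeastAtMost') auto
  then have "(LINT t:{0..2*pi}|lborel. f (cis t)) = integral {0..2*pi} (\<lambda>t. f (cis t))"
    by (rule set_borel_integral_eq_integral(2))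
  then show ?thesis by (subst integral_circ) auto
qed

lemma has_vector_derivative_cis_mult:
  "((\<lambda>t. cis (c * t)) has_vector_derivative (of_real c * \<i>) * cis (c * t)) (at t within A)"
  unfolding has_vector_derivative_def
  by (auto intro!: derivative_eq_intros simp: scaleR_conv_of_real mult_ac)

text \<open>Two integrations by parts, done at once by differentiating
  \<open>(\<i>/n F + F1/n\<^sup>2) e\<^sup>-\<^sup>i\<^sup>n\<^sup>t\<close>.\<close>

lemma fourier_decay_C2:
  fixes F F1 F2 :: "real \<Rightarrow> complex"
  assumes [measurable]: "f \<in> borel_measurable borel" and f: "\<And>t. f (cis t) = F t"
    and F: "\<And>t. (F has_vector_derivative F1 t) (at t)" and F1: "\<And>t. (F1 has_vector_derivative F2 t) (at t)"
    and F2: "continuous_on {0..2*pi} F2" and per: "F (2*pi) = F 0" "F1 (2*pi) = F1 0"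
    and bound: "\<And>t. cmod (F2 t) \<le> M" and n: "n > 0"
  shows "cmod (fourier f (int n)) \<le> M / real n ^ 2"
proof -
  define e where "e t = cis (- real n * t)" for t
  have e': "(e has_vector_derivative (of_real (- real n) * \<i>) * e t) (at t within A)" for t A
    unfolding e_def[abs_def] by (rule has_vector_derivative_cis_mult)
  have [simp]: "cmod (e t) = 1" for t by (simp add: e_def)
  have cont_e: "continuous_on A e" for A
    using e' by (meson continuous_on_vector_derivative)
  have contF: "continuous_on A F" for A
    using F has_vector_derivative_at_within by (meson continuous_on_vector_derivative)
  let ?A = "\<i> / of_nat n" and ?B = "1 / (of_nat n)^2 :: complex"
  have nz: "(of_nat n :: complex) \<noteq> 0" using n by simp
  have "((\<lambda>t. F t * e t + ?B * (F2 t * e t)) has_integral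
      (?A * F (2*pi) + ?B * F1 (2*pi)) * e (2*pi) - (?A * F 0 + ?B * F1 0) * e 0) {0..2*pi}"
  proof (rule fundamental_theorem_of_calculus)
    fix t :: real
    have "((\<lambda>t. (?A * F t + ?B * F1 t) * e t) has_vector_derivative
      (?A * F t + ?B * F1 t) * ((of_real (- real n) * \<i>) * e t) + (?A * F1 t + ?B * F2 t) * e t) (at t within {0..2*pi})"
      by (intro has_vector_derivative_mult has_vector_derivative_add has_vector_derivative_mult_right e'
        has_vector_derivative_at_within[OF F] has_vector_derivative_at_within[OF F1])
    also have "(?A * F t + ?B * F1 t) * ((of_real (- real n) * \<i>) * e t) + (?A * F1 t + ?B * F2 t) * e t
        = F t * e t + ?B * (F2 t * e t)"
      using nz by (simp add: field_simps power2_eq_square)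
    finally show "((\<lambda>t. (?A * F t + ?B * F1 t) * e t) has_vector_derivative F t * e t + ?B * (F2 t * e t)) (at t within {0..2*pi})" .
  qed simp
  moreover have "e (2*pi) = e 0"
    unfolding e_def using cis_multiple_2pi[of "- real n"] by (simp add: mult_ac)
  ultimately have "((\<lambda>t. F t * e t + ?B * (F2 t * e t)) has_integral 0) {0..2*pi}" using per by simp
  then have "integral {0..2*pi} (\<lambda>t. F t * e t + ?B * (F2 t * e t)) = 0" by (rule integral_unique)
  moreover have "integral {0..2*pi} (\<lambda>t. F t * e t + ?B * (F2 t * e t))
      = integral {0..2*pi} (\<lambda>t. F t * e t) + ?B * integral {0..2*pi} (\<lambda>t. F2 t * e t)"
    by (subst Henstock_Kurzweil_Integration.integral_add)
       (use nz in \<open>auto intro!: integrable_continuous_interval continuous_intros contF cont_e F2\<close>)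
  ultimately have I: "integral {0..2*pi} (\<lambda>t. F t * e t) = - ?B * integral {0..2*pi} (\<lambda>t. F2 t * e t)"
    by (simp add: add_eq_0_iff2)
  have "cmod (integral {0..2*pi} (\<lambda>t. F2 t * e t)) \<le> M * (2*pi - 0)"
    by (rule integral_bound) (auto intro!: continuous_intros F2 cont_e simp: norm_mult bound)
  then have *: "cmod (integral {0..2*pi} (\<lambda>t. F t * e t)) \<le> (1 / real n ^ 2) * (M * (2*pi))"
    unfolding I by (simp add: norm_mult norm_divide norm_power divide_right_mono)
  have pe: "cis t powi (- int n) = e t" for t
    unfolding e_def by (simp add: cis_power_int)
  have "fourier f (int n) = (1 / (2*pi)) *\<^sub>R integral {0..2*pi} (\<lambda>t. f (cis t) * cis t powi (- int n))"
    unfolding fourier_def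
  proof (rule integral_circ_HK)
    show "continuous_on {0..2 * pi} (\<lambda>t. f (cis t) * cis t powi - int n)"
      unfolding f pe by (intro continuous_intros contF cont_e)
  qed measurable
  then have "cmod (fourier f (int n)) = (1 / (2*pi)) * cmod (integral {0..2*pi} (\<lambda>t. F t * e t))"
    unfolding f pe by simp
  also have "\<dots> \<le> (1 / (2*pi)) * ((1 / real n ^ 2) * (M * (2*pi)))"
    using * by (intro mult_left_mono) auto
  also have "\<dots> = M / real n ^ 2" by simp
  finally show ?thesis .
qed

text \<open>\<open>D h\<close> is the derivative of \<open>h (cis t)\<close> in \<open>t\<close>,
  written as a function on the plane. It is again holomorphic on \<open>W\<close>, so
  \<open>D\<close> can be iterated, and the second derivative is bounded because the circle is
  compact.\<close>

lemma fourier_decay_holomorphic: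
  assumes f: "f \<in> borel_measurable borel" and g: "g holomorphic_on W" "open W" "sphere 0 1 \<subseteq> W"
    and fg: "\<And>z. cmod z = 1 \<Longrightarrow> f z = g z"
  shows "\<exists>M. \<forall>n>0. cmod (fourier f (int n)) \<le> M / real n ^ 2"
proof -
  define D where "D h z = \<i> * z * deriv h z" for h z
  have Dh: "D h holomorphic_on W" if "h holomorphic_on W" for h
    unfolding D_def[abs_def] using that g(2) by (intro holomorphic_intros holomorphic_deriv)
  have der: "((\<lambda>t. h (cis t)) has_vector_derivative D h (cis t)) (at t)" if h: "h holomorphic_on W" for h t
  proof -
    have "cis t \<in> W" using g(3) by auto
    then have "(h has_field_derivative deriv h (cis t)) (at (cis t))" using holomorphic_derivI[OF h g(2)] by blast
    moreover have "(cis has_vector_derivative \<i> * cis t) (at t)"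
      using has_vector_derivative_cis_mult[of 1 t UNIV] by simp
    ultimately show ?thesis
      using field_vector_diff_chain_at[of cis "\<i> * cis t" t h] by (simp add: o_def D_def)
  qed
  have D2h: "D (D g) holomorphic_on W" by (intro Dh g)
  have contD2: "continuous_on (sphere 0 1) (D (D g))"
    using holomorphic_on_imp_continuous_on[OF D2h] continuous_on_subset g(3) by blast
  then have "bounded (D (D g) ` sphere 0 1)" by (intro compact_imp_bounded compact_continuous_image) auto
  then obtain M where "\<forall>z\<in>sphere 0 1. cmod (D (D g) z) \<le> M" unfolding bounded_iff by auto
  then have M: "cmod (D (D g) (cis t)) \<le> M" for t by simp
  have "cmod (fourier f (int n)) \<le> M / real n ^ 2" if "n > 0" for n
  proof (rule fourier_decay_C2[OF f, of "\<lambda>t. g (cis t)" "\<lambda>t. D g (cis t)" "\<lambda>t. D (D g) (cis t)"])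
    show "continuous_on {0..2*pi} (\<lambda>t. D (D g) (cis t))"
      by (intro continuous_on_compose2[OF contD2] continuous_on_cis continuous_intros) auto
  qed (use that M fg der[OF g(1)] der[OF Dh[OF g(1)]] in auto)
  then show ?thesis by blast
qed

section \<open>The outer square root of \<open>J0\<close>\<close>

context finite_blaschke
begin

definition half_log_j0 :: "complex \<Rightarrow> real" where "half_log_j0 w = ln (cmod (J0 \<alpha>s w)) / 2"

lemma half_log_j0_measurable [measurable]: "half_log_j0 \<in> borel_measurable borel"
  unfolding half_log_j0_def[abs_def] by measurable

lemma half_log_j0_decay: "\<exists>M. \<forall>n>0. cmod (fourier (\<lambda>z. of_real (half_log_j0 z)) (int n)) \<le> M / real n ^ 2"
  and half_log_j0_bounded: "\<exists>B. \<forall>z. cmod z = 1 \<longrightarrow> \<bar>half_log_j0 z\<bar> \<le> B"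
proof -
  \<comment> \<open>\<open>V\<close> leaves out the zeros of \<open>b\<close>, by which
    \<open>J0\<close> divides, and \<open>W\<close> also leaves out the branch cut of
    \<open>Ln\<close>. The circle lies in \<open>W\<close> because \<open>|b| = 1\<close> and
    \<open>J0 > 0\<close> there.\<close>
  define V where "V = {z \<in> dom. b z \<noteq> 0}"
  have "V = b -` (- {0}) \<inter> dom" by (auto simp: V_def)
  then have openV: "open V"
    using holomorphic_on_imp_continuous_on[OF holomorphic_b] open_dom
    by (simp add: continuous_on_open_vimage open_Compl)
  have J0V: "J0 \<alpha>s holomorphic_on V"
  proof -
    have "V \<subseteq> dom" by (auto simp: V_def)
    then have "deriv b holomorphic_on V" "b holomorphic_on V"
      using holomorphic_deriv_b holomorphic_b holomorphic_on_subset by blast+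
    then show ?thesis unfolding J0_def[abs_def]
      by (intro holomorphic_intros) (use N_pos openV in \<open>auto simp: V_def\<close>)
  qed
  define W where "W = J0 \<alpha>s -` (- \<real>\<^sub>\<le>\<^sub>0) \<inter> V"
  have openW: "open W" unfolding W_def
    using holomorphic_on_imp_continuous_on[OF J0V] openV
    by (simp add: continuous_on_open_vimage closed_nonpos_Reals_complex open_Compl)
  have J0W: "J0 \<alpha>s holomorphic_on W" using J0V by (rule holomorphic_on_subset) (auto simp: W_def)
  have gh: "(\<lambda>z. Ln (J0 \<alpha>s z) / 2) holomorphic_on W"
    by (intro holomorphic_intros J0W) (auto simp: W_def)
  have sub: "sphere 0 1 \<subseteq> W"
  proof
    fix z :: complex assume "z \<in> sphere 0 1"
    then have z: "cmod z = 1" by simp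
    then have "z \<in> dom" using cball_subset_dom by auto
    moreover have "b z \<noteq> 0" using norm_blaschke_circle[OF z] by auto
    moreover have "J0 \<alpha>s z \<notin> \<real>\<^sub>\<le>\<^sub>0" using J0_eq_j0[OF z] j0_pos[OF z] by simp
    ultimately show "z \<in> W" by (simp add: W_def V_def)
  qed
  have eq: "of_real (half_log_j0 z) = Ln (J0 \<alpha>s z) / 2" if "cmod z = 1" for z
    using J0_eq_j0[OF that] j0_pos[OF that] by (simp add: half_log_j0_def Ln_of_real)
  show "\<exists>M. \<forall>n>0. cmod (fourier (\<lambda>z. of_real (half_log_j0 z)) (int n)) \<le> M / real n ^ 2"
    by (rule fourier_decay_holomorphic[OF _ gh openW sub eq]) auto
  have "continuous_on (sphere 0 1) (\<lambda>z. Ln (J0 \<alpha>s z) / 2)"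
    using holomorphic_on_imp_continuous_on[OF gh] sub continuous_on_subset by blast
  then have "bounded ((\<lambda>z. Ln (J0 \<alpha>s z) / 2) ` sphere 0 1)" by (intro compact_imp_bounded compact_continuous_image) auto
  then obtain B where B: "\<forall>z\<in>sphere 0 1. cmod (Ln (J0 \<alpha>s z) / 2) \<le> B" unfolding bounded_iff by auto
  have "\<bar>half_log_j0 z\<bar> \<le> B" if z: "cmod z = 1" for z
  proof -
    have "cmod (Ln (J0 \<alpha>s z) / 2) \<le> B" using B z by simp
    then show ?thesis unfolding eq[OF z, symmetric] by simp
  qed
  then show "\<exists>B. \<forall>z. cmod z = 1 \<longrightarrow> \<bar>half_log_j0 z\<bar> \<le> B" by blast
qed

abbreviation Jb :: "complex \<Rightarrow> complex" where "Jb \<equiv> J_half_bd \<alpha>s"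

text \<open>Everywhere in the plane \<open>Jb\<close> is a value of \<open>exp\<close>, so it has no
  zeros at all, and dividing by it gives identities of functions and not merely almost everywhere.
  The half in \<open>half_log_j0\<close> is what makes the squared modulus equal to
  \<open>j0\<close>.\<close>

lemma
  shows Jb_measurable [measurable]: "Jb \<in> borel_measurable borel"
    and Jb_nonzero: "Jb z \<noteq> 0"
    and Jb_AE: "AE z in circ_meas. (cmod (Jb z))^2 = j0 z"
    and Jb_HinfT: "Jb \<in> HinfT"
    and inverse_Jb_HinfT: "(\<lambda>z. inverse (Jb z)) \<in> HinfT"
proof -
  obtain B C where "outer_boundary half_log_j0 B C"
    using half_log_j0_decay half_log_j0_bounded unfolding outer_boundary_def by (metis half_log_j0_measurable)
  then interpret outer_boundary half_log_j0 B C .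
  have Jb: "Jb = (\<lambda>w. if cmod w \<le> 1 then exp (G w) else exp (- cnj (G (1 / cnj w))))"
    unfolding J_half_bd_def[abs_def] J_half_def half_log_j0_def[abs_def, symmetric] radial_limit ..
  show m [measurable]: "Jb \<in> borel_measurable borel" unfolding Jb by measurable
  show "Jb z \<noteq> 0" unfolding Jb by simp
  show "AE z in circ_meas. (cmod (Jb z))^2 = j0 z"
    using Re_G_AE AE_circ_norm
  proof eventually_elim
    fix z assume z: "Re (G z) = half_log_j0 z" "cmod z = 1"
    have "(cmod (Jb z))^2 = exp (2 * Re (G z))" unfolding Jb using z(2) by (simp add: exp_double)
    also have "\<dots> = j0 z" unfolding z(1) using J0_eq_j0[OF z(2)] j0_pos[OF z(2)] by (simp add: half_log_j0_def)
    finally show "(cmod (Jb z))^2 = j0 z" .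
  qed
  have c1: "continuous_on (cball 0 1) Jb" "Jb holomorphic_on ball 0 1"
  proof -
    have "continuous_on (cball 0 1) (\<lambda>w. exp (G w))" by (intro continuous_intros continuous_G)
    then show "continuous_on (cball 0 1) Jb" by (rule continuous_on_eq) (simp add: Jb)
    have "(\<lambda>w. exp (G w)) holomorphic_on ball 0 1" by (intro holomorphic_intros holomorphic_G)
    then show "Jb holomorphic_on ball 0 1" by (rule holomorphic_transform) (simp add: Jb)
  qed
  show "Jb \<in> HinfT" by (rule HinfT_holomorphic[OF m c1])
  have nz: "Jb z \<noteq> 0" for z unfolding Jb by simp
  show "(\<lambda>z. inverse (Jb z)) \<in> HinfT"
    by (rule HinfT_holomorphic) (use nz in \<open>auto intro!: continuous_intros holomorphic_intros c1 borel_measurable_inverse\<close>)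
qed

end

section \<open>Operators given by a weight\<close>

lemma one_HinfT: "(\<lambda>_. 1) \<in> HinfT"
  using poly_HinfT[of "[:1:]"] by simp

lemma H2T_add: "f \<in> H2T \<Longrightarrow> g \<in> H2T \<Longrightarrow> (\<lambda>z. c * f z + g z) \<in> H2T"
  by (simp add: H2T_def L2T_add L2T_cmult fourier_lincomb)

text \<open>The infimum in the essential supremum is attained: the bounds
  \<open>Linf_norm g + 1/(n+1)\<close> hold off countably many null sets at once. The bound
  \<open>D\<close> ensures that the infimum is taken over a nonempty set.\<close>

lemma AE_le_Linf_norm:
  fixes g :: "complex \<Rightarrow> real"
  assumes nonneg: "\<And>z. g z \<ge> 0" and D: "AE z in circ_meas. g z \<le> D"
  shows "AE z in circ_meas. g z \<le> Linf_norm g" and "Linf_norm g \<ge> 0"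
proof -
  let ?S = "{C. 0 \<le> C \<and> (AE z in circ_meas. norm (g z) \<le> C)}"
  have "AE z in circ_meas. norm (g z) \<le> max D 0" using D by eventually_elim (use nonneg in auto)
  then have ne: "?S \<noteq> {}" by (intro ex_in_conv[THEN iffD1] exI[of _ "max D 0"]) simp
  show "Linf_norm g \<ge> 0" unfolding Linf_norm_def by (rule cInf_greatest[OF ne]) auto
  have "AE z in circ_meas. g z \<le> Linf_norm g + 1 / real (Suc n)" for n
  proof -
    obtain C where "C \<in> ?S" "C < Linf_norm g + 1 / real (Suc n)"
      using cInf_lessD[OF ne, of "Linf_norm g + 1 / real (Suc n)"] unfolding Linf_norm_def by auto
    then have "AE z in circ_meas. norm (g z) \<le> C" "C < Linf_norm g + 1 / real (Suc n)" by auto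
    then show ?thesis using nonneg by (auto elim!: eventually_mono)
  qed
  then have "AE z in circ_meas. \<forall>n. g z \<le> Linf_norm g + 1 / real (Suc n)" by (simp add: AE_all_countable)
  then show "AE z in circ_meas. g z \<le> Linf_norm g"
  proof eventually_elim
    fix z assume *: "\<forall>n. g z \<le> Linf_norm g + 1 / real (Suc n)"
    show "g z \<le> Linf_norm g"
    proof (rule field_le_epsilon)
      fix e :: real assume "e > 0"
      then obtain n where "inverse (real (Suc n)) < e" using reals_Archimedean by blast
      then show "g z \<le> Linf_norm g + e" using *[rule_format, of n] by (simp add: inverse_eq_divide)
    qed
  qed
qed

lemma Linf_norm_le:
  fixes g :: "complex \<Rightarrow> real"
  assumes "\<And>z. g z \<ge> 0" "AE z in circ_meas. g z \<le> D" "D \<ge> 0"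
  shows "Linf_norm g \<le> D"
  unfolding Linf_norm_def by (rule cInf_lower) (use assms in \<open>auto intro: bdd_belowI[of _ 0]\<close>)

lemma integrable_weight:
  fixes g :: "complex \<Rightarrow> real"
  assumes g [measurable]: "g \<in> borel_measurable borel" and nonneg: "\<And>z. g z \<ge> 0"
    and D: "AE z in circ_meas. g z \<le> D" and f: "f \<in> L2T"
  shows "integrable circ_meas (\<lambda>z. (cmod (f z))^2 * g z)"
    and "(LINT z|circ_meas. (cmod (f z))^2 * g z) \<le> D * (L2norm f)^2"
proof -
  have fm [measurable]: "f \<in> borel_measurable borel" using f by (rule L2T_measurable)
  have i: "integrable circ_meas (\<lambda>z. D * (cmod (f z))^2)" using L2T_integrable[OF f] by simp
  have le: "AE z in circ_meas. (cmod (f z))^2 * g z \<le> D * (cmod (f z))^2"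
    using D by eventually_elim (metis mult.commute mult_left_mono zero_le_power2)
  show i2: "integrable circ_meas (\<lambda>z. (cmod (f z))^2 * g z)"
  proof (rule Bochner_Integration.integrable_bound[OF i])
    show "AE z in circ_meas. norm ((cmod (f z))^2 * g z) \<le> norm (D * (cmod (f z))^2)"
      using le by eventually_elim (use nonneg in \<open>auto intro: order_trans[OF _ abs_ge_self]\<close>)
  qed simp
  show "(LINT z|circ_meas. (cmod (f z))^2 * g z) \<le> D * (L2norm f)^2"
    using integral_mono_AE[OF i2 i le] by (simp add: L2norm_power2)
qed

text \<open>The operator enters only through the identity for
  \<open>\<parallel>S f\<parallel>^2\<close>, and the space only through its polynomials, so one
  argument covers L2 and H2. Normalised polynomials show that the integral of
  \<open>|p|^2 (c^2 - g)\<close> is nonnegative for \<open>c = opnorm V S\<close>, and positivity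
  gives \<open>g \<le> c^2\<close>. For isometries the same test is applied to \<open>g - 1\<close>
  and to \<open>1 - g\<close>.\<close>

lemma
  fixes g :: "complex \<Rightarrow> real"
  assumes g [measurable]: "g \<in> borel_measurable borel" and nonneg: "\<And>z. g z \<ge> 0"
    and D: "AE z in circ_meas. g z \<le> D"
    and V: "V \<subseteq> L2T" "\<And>p. (\<lambda>z. poly p z) \<in> V"
    and S: "\<And>f. f \<in> V \<Longrightarrow> (L2norm (S f))^2 = (LINT z|circ_meas. (cmod (f z))^2 * g z)"
  shows opnorm_weight: "opnorm V S = sqrt (Linf_norm g)"
    and isometry_weight: "isometry_on V S \<longleftrightarrow> (AE z in circ_meas. g z = 1)"
proof -
  let ?L = "Linf_norm g"
  have L: "AE z in circ_meas. g z \<le> ?L" "?L \<ge> 0" using AE_le_Linf_norm[OF nonneg D] by blast+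
  have gi: "integrable circ_meas g"
    by (rule circ.integrable_const_bound[of _ D]) (use nonneg D in auto)
  have pL: "(\<lambda>z. poly p z) \<in> L2T" for p using V by blast
  have upper: "(L2norm (S f))^2 \<le> ?L * (L2norm f)^2" if "f \<in> V" for f
    unfolding S[OF that] using integrable_weight(2)[OF g nonneg L(1), of f] that V by auto
  let ?A = "{L2norm (S f) | f. f \<in> V \<and> L2norm f \<le> 1}"
  have ub: "x \<le> sqrt ?L" if x: "x \<in> ?A" for x
  proof -
    obtain f where f: "x = L2norm (S f)" "f \<in> V" "L2norm f \<le> 1" using x by blast
    have "(L2norm (S f))^2 \<le> ?L * (L2norm f)^2" using upper f by simp
    also have "\<dots> \<le> ?L * 1" using f(3) L(2) L2norm_nonneg by (intro mult_left_mono) (auto simp: power_le_one)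
    finally show ?thesis unfolding f(1) by (simp add: real_le_rsqrt)
  qed
  \<comment> \<open>The zero polynomial makes the set nonempty, so that \<open>Sup\<close> is a
    genuine least upper bound, and shows that it is nonnegative.\<close>
  have zA: "L2norm (S (\<lambda>z. poly 0 z)) \<in> ?A" using V(2)[of 0] by (auto simp: L2norm_def)
  have bdd: "bdd_above ?A" using ub by (rule bdd_aboveI)
  have s0: "opnorm V S \<ge> 0"
    unfolding opnorm_def using cSup_upper[OF zA bdd] L2norm_nonneg order_trans by blast
  show "opnorm V S = sqrt ?L"
  proof (rule antisym)
    show "opnorm V S \<le> sqrt ?L" unfolding opnorm_def by (rule cSup_least) (use zA ub in auto)
    have "(LINT z|circ_meas. (cmod (poly p z))^2 * ((opnorm V S)^2 - g z)) \<ge> 0" for p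
    proof -
      have i: "integrable circ_meas (\<lambda>z. (cmod (poly p z))^2 * g z)"
        by (rule integrable_weight(1)[OF g nonneg D pL])
      have i2: "integrable circ_meas (\<lambda>z. (cmod (poly p z))^2 * (opnorm V S)^2)"
        using L2T_integrable[OF pL] by simp
      have "(LINT z|circ_meas. (cmod (poly p z))^2 * g z) \<le> (opnorm V S)^2 * (L2norm (poly p))^2"
      proof (cases "L2norm (poly p) = 0")
        case True
        then show ?thesis using integrable_weight(2)[OF g nonneg D pL, of p] by simp
      next
        case False
        then have pos: "L2norm (poly p) > 0" using L2norm_nonneg[of "poly p"] by simp
        define c where "c = 1 / L2norm (poly p)"
        let ?q = "smult (of_real c) p"
        have "L2norm (poly ?q) = L2norm (\<lambda>z. of_real c * poly p z)"
          by (rule arg_cong[of _ _ L2norm]) (rule ext, simp)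
        also have "\<dots> = 1" unfolding L2norm_cmult norm_of_real using pos by (simp add: c_def)
        finally have "L2norm (S (poly ?q)) \<in> ?A" using V(2)[of ?q]
          by (intro CollectI exI[of _ "poly ?q"]) (simp del: poly_smult)
        then have "L2norm (S (poly ?q)) \<le> opnorm V S" unfolding opnorm_def by (rule cSup_upper[OF _ bdd])
        then have "(L2norm (S (poly ?q)))^2 \<le> (opnorm V S)^2" using L2norm_nonneg by (rule power_mono)
        moreover have "(L2norm (S (poly ?q)))^2 = c^2 * (LINT z|circ_meas. (cmod (poly p z))^2 * g z)"
          unfolding S[OF V(2)] by (simp add: norm_mult power_mult_distrib mult.assoc)
        ultimately have "c^2 * (LINT z|circ_meas. (cmod (poly p z))^2 * g z) \<le> (opnorm V S)^2" by linarith
        then show ?thesis using pos by (simp add: c_def power_divide pos_divide_le_eq mult.commute)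
      qed
      then show ?thesis using i i2 by (simp add: right_diff_distrib L2norm_power2 mult.commute)
    qed
    then have "AE z in circ_meas. (opnorm V S)^2 - g z \<ge> 0"
      by (intro AE_nonneg_if_poly_integrals_nonneg) (use gi in auto)
    then have "?L \<le> (opnorm V S)^2" by (intro Linf_norm_le nonneg) auto
    then show "sqrt ?L \<le> opnorm V S" using s0 by (simp add: real_le_lsqrt)
  qed
  show "isometry_on V S \<longleftrightarrow> (AE z in circ_meas. g z = 1)"
  proof
    assume iso: "isometry_on V S"
    have eq: "(LINT z|circ_meas. (cmod (poly p z))^2 * g z) = (LINT z|circ_meas. (cmod (poly p z))^2)" for p
      using S[OF V(2), of p] iso V(2)[of p] L2norm_power2[of "poly p"] by (simp add: isometry_on_def)
    have i: "integrable circ_meas (\<lambda>z. (cmod (poly p z))^2 * g z)" for p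
      by (rule integrable_weight(1)[OF g nonneg D pL])
    have "AE z in circ_meas. g z - 1 \<ge> 0"
      by (rule AE_nonneg_if_poly_integrals_nonneg)
         (use gi i L2T_integrable[OF pL] eq in \<open>auto simp: right_diff_distrib\<close>)
    moreover have "AE z in circ_meas. 1 - g z \<ge> 0"
      by (rule AE_nonneg_if_poly_integrals_nonneg)
         (use gi i L2T_integrable[OF pL] eq in \<open>auto simp: right_diff_distrib\<close>)
    ultimately show "AE z in circ_meas. g z = 1" by eventually_elim simp
  next
    assume g1: "AE z in circ_meas. g z = 1"
    show "isometry_on V S" unfolding isometry_on_def
    proof
      fix f assume f: "f \<in> V"
      then have [measurable]: "f \<in> borel_measurable borel" using V L2T_measurable by blast
      have "(L2norm (S f))^2 = (LINT z|circ_meas. (cmod (f z))^2 * g z)" by (rule S[OF f])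
      also have "\<dots> = (LINT z|circ_meas. (cmod (f z))^2)"
        by (rule integral_cong_AE) (use g1 in \<open>auto elim: eventually_mono\<close>)
      also have "\<dots> = (L2norm f)^2" by (simp add: L2norm_power2)
      finally show "L2norm (S f) = L2norm f" using L2norm_nonneg by (simp add: power2_eq_iff_nonneg)
    qed
  qed
qed

subsection \<open>Bounded operators\<close>

lemma bounded_op_diff:
  assumes "bounded_op V T" "f \<in> V" "g \<in> V"
  shows "AE z in circ_meas. T (\<lambda>w. f w - g w) z = T f z - T g z"
proof -
  have "AE z in circ_meas. T (\<lambda>w. (-1) * g w + f w) z = (-1) * T g z + T f z"
    using assms unfolding bounded_op_def by blast
  then show ?thesis by simp
qed

lemma bounded_op_bound:
  assumes "bounded_op V T"
  obtains C where "C > 0" "\<And>f. f \<in> V \<Longrightarrow> L2norm (T f) \<le> C * L2norm f"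
proof -
  obtain C where C: "\<And>f. f \<in> V \<Longrightarrow> L2norm (T f) \<le> C * L2norm f"
    using assms unfolding bounded_op_def by blast
  have "L2norm (T f) \<le> (\<bar>C\<bar> + 1) * L2norm f" if "f \<in> V" for f
  proof -
    have "C * L2norm f \<le> (\<bar>C\<bar> + 1) * L2norm f" by (intro mult_right_mono L2norm_nonneg) simp
    then show ?thesis using C[OF that] by simp
  qed
  then show thesis using that[of "\<bar>C\<bar> + 1"] by simp
qed

text \<open>The error \<open>T f - S f\<close> is \<open>(T f - T d) + (S d - S f)\<close> with
  \<open>d\<close> from the dense set. Linearity holds only almost everywhere, so each bracket is
  compared with the image of \<open>f - d\<close> through its norm.\<close>

lemma op_eq_dense:
  assumes V: "V \<subseteq> L2T" "\<And>f g. f \<in> V \<Longrightarrow> g \<in> V \<Longrightarrow> (\<lambda>z. f z - g z) \<in> V"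
    and T: "bounded_op V T" and S: "bounded_op V S"
    and D: "D \<subseteq> V" "\<And>f e. f \<in> V \<Longrightarrow> e > 0 \<Longrightarrow> \<exists>d\<in>D. L2norm (\<lambda>z. f z - d z) < e"
    and eq: "\<And>d. d \<in> D \<Longrightarrow> AE z in circ_meas. T d z = S d z"
  shows "op_eq V T S"
  unfolding op_eq_def
proof
  fix f assume f: "f \<in> V"
  have in_V: "T h \<in> V" "S h \<in> V" if "h \<in> V" for h using T S that unfolding bounded_op_def by blast+
  then have in_L: "T h \<in> L2T" "S h \<in> L2T" if "h \<in> V" for h using V that by blast+
  obtain A where A: "A > 0" "\<And>f. f \<in> V \<Longrightarrow> L2norm (T f) \<le> A * L2norm f" using bounded_op_bound[OF T] by blast
  obtain B where B: "B > 0" "\<And>f. f \<in> V \<Longrightarrow> L2norm (S f) \<le> B * L2norm f" using bounded_op_bound[OF S] by blast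
  show "AE z in circ_meas. T f z = S f z"
  proof (rule L2T_eq_AE_if_close[OF in_L[OF f]])
    fix e :: real assume "e > 0"
    then have "e / (A + B) > 0" using A B by simp
    then obtain d where d: "d \<in> D" "L2norm (\<lambda>z. f z - d z) < e / (A + B)" using D(2)[OF f] by blast
    have dV: "d \<in> V" using d D by blast
    have fd: "(\<lambda>z. f z - d z) \<in> V" by (rule V(2)[OF f dV])
    have "L2norm (\<lambda>z. T f z - T d z) = L2norm (T (\<lambda>z. f z - d z))"
      by (rule L2norm_cong_AE)
         (use bounded_op_diff[OF T f dV] L2T_measurable[OF L2T_diff[OF in_L(1)[OF f] in_L(1)[OF dV]]]
            L2T_measurable[OF in_L(1)[OF fd]] in \<open>auto elim: eventually_mono\<close>)
    also have "\<dots> \<le> A * L2norm (\<lambda>z. f z - d z)" by (rule A(2)[OF fd])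
    finally have 1: "L2norm (\<lambda>z. T f z - T d z) \<le> A * L2norm (\<lambda>z. f z - d z)" .
    have "L2norm (\<lambda>z. T d z - S f z) = L2norm (S (\<lambda>z. f z - d z))"
    proof -
      have "L2norm (\<lambda>z. T d z - S f z) = L2norm (\<lambda>z. (-1) * S (\<lambda>z. f z - d z) z)"
      proof (rule L2norm_cong_AE)
        show "AE z in circ_meas. T d z - S f z = (-1) * S (\<lambda>z. f z - d z) z"
          using bounded_op_diff[OF S f dV] eq[OF d(1)] by eventually_elim simp
      qed (use L2T_measurable[OF L2T_diff[OF in_L(1)[OF dV] in_L(2)[OF f]]]
             L2T_measurable[OF L2T_cmult[OF in_L(2)[OF fd], of "-1"]] in auto)
      then show ?thesis unfolding L2norm_cmult by simp
    qed
    also have "\<dots> \<le> B * L2norm (\<lambda>z. f z - d z)" by (rule B(2)[OF fd])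
    finally have 2: "L2norm (\<lambda>z. T d z - S f z) \<le> B * L2norm (\<lambda>z. f z - d z)" .
    have "L2norm (\<lambda>z. T f z - S f z) \<le> (A + B) * L2norm (\<lambda>z. f z - d z)"
      using L2norm_diff_triangle[OF in_L(1)[OF f] in_L(1)[OF dV] in_L(2)[OF f]] 1 2 by (simp add: distrib_right)
    also have "\<dots> \<le> e" using d(2) A B by (simp add: field_simps)
    finally show "L2norm (\<lambda>z. T f z - S f z) \<le> e" .
  qed
qed

section \<open>Weighted composition operators\<close>

context finite_blaschke
begin

abbreviation weight :: "(complex \<Rightarrow> complex) \<Rightarrow> complex \<Rightarrow> real" where
  "weight m \<equiv> transfer \<alpha>s (\<lambda>z. (cmod (m z))^2)"

lemma weighted_comp_apply: "(mult m \<circ> Cb \<alpha>s) f = (\<lambda>z. m z * (Jb z * f (b z)))"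
  by (simp add: mult_def Cb_def Gamma_def o_def)

lemma weight_measurable [measurable]:
  assumes [measurable]: "m \<in> borel_measurable borel"
  shows "weight m \<in> borel_measurable borel"
  by measurable

lemma weight_nonneg: "weight m z \<ge> 0"
  by (rule transfer_nonneg) simp

lemma weighted_AE:
  "AE z in circ_meas. (cmod (m z * (Jb z * f (b z))))^2 = (cmod (f (b z)))^2 * (cmod (m z))^2 * j0 z"
  using Jb_AE by eventually_elim (simp add: norm_mult power_mult_distrib)

text \<open>Since \<open>|Jb|^2 = j0\<close> almost everywhere, this is the change of variables with
  \<open>u = |m|^2\<close> and \<open>v = |f|^2\<close>. The equivalence is meant for symbols that
  are not yet known to be bounded.\<close>

lemma
  assumes [measurable]: "m \<in> borel_measurable borel" "f \<in> borel_measurable borel"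
  shows L2norm_weighted: "(L2norm (\<lambda>z. m z * (Jb z * f (b z))))^2 = (LINT z|circ_meas. (cmod (f z))^2 * weight m z)"
    and L2T_weighted_iff: "(\<lambda>z. m z * (Jb z * f (b z))) \<in> L2T \<longleftrightarrow> integrable circ_meas (\<lambda>z. (cmod (f z))^2 * weight m z)"
proof -
  have "(L2norm (\<lambda>z. m z * (Jb z * f (b z))))^2 = (LINT z|circ_meas. (cmod (f (b z)))^2 * (cmod (m z))^2 * j0 z)"
    unfolding L2norm_power2 by (rule integral_cong_AE) (use weighted_AE in auto)
  also have "\<dots> = (LINT z|circ_meas. (cmod (f z))^2 * weight m z)"
    by (rule integral_transfer[of "\<lambda>z. (cmod (m z))^2" "\<lambda>z. (cmod (f z))^2"]) auto
  finally show "(L2norm (\<lambda>z. m z * (Jb z * f (b z))))^2 = (LINT z|circ_meas. (cmod (f z))^2 * weight m z)" .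
  have "(\<lambda>z. m z * (Jb z * f (b z))) \<in> L2T \<longleftrightarrow> integrable circ_meas (\<lambda>z. (cmod (m z * (Jb z * f (b z))))^2)"
    by (simp add: L2T_iff)
  also have "\<dots> \<longleftrightarrow> integrable circ_meas (\<lambda>z. (cmod (f (b z)))^2 * (cmod (m z))^2 * j0 z)"
    by (rule integrable_cong_AE) (use weighted_AE in auto)
  also have "\<dots> \<longleftrightarrow> integrable circ_meas (\<lambda>z. (cmod (f z))^2 * weight m z)"
    by (rule integrable_transfer_iff[of "\<lambda>z. (cmod (m z))^2" "\<lambda>z. (cmod (f z))^2"]) auto
  finally show "(\<lambda>z. m z * (Jb z * f (b z))) \<in> L2T \<longleftrightarrow> integrable circ_meas (\<lambda>z. (cmod (f z))^2 * weight m z)" .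
qed

text \<open>The bound on \<open>m\<close> holds only almost everywhere, while
  \<open>transfer\<close> evaluates \<open>m\<close> at the points of a fibre. The excess
  \<open>u\<close> of \<open>|m|^2\<close> over \<open>C^2\<close> is null, hence
  \<open>transfer \<alpha>s u\<close> has integral 0 and vanishes almost everywhere; so over almost
  every point the whole fibre obeys the bound.\<close>

lemma weight_bounded:
  assumes m: "m \<in> LinfT"
  obtains D where "D \<ge> 0" "AE z in circ_meas. weight m z \<le> D"
proof -
  have [measurable]: "m \<in> borel_measurable borel" using m by (rule LinfT_measurable)
  obtain C where C: "C > 0" "AE z in circ_meas. cmod (m z) \<le> C" using m by (rule LinfT_bound)
  define u where "u z = max ((cmod (m z))^2 - C^2) 0" for z
  have u [measurable]: "u \<in> borel_measurable borel" unfolding u_def[abs_def] by measurable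
  have u0: "u z \<ge> 0" for z by (simp add: u_def)
  have uAE: "AE z in circ_meas. u z = 0"
    using C(2)
  proof eventually_elim
    fix z assume "cmod (m z) \<le> C"
    then have "(cmod (m z))^2 \<le> C^2" by (intro power_mono) auto
    then show "u z = 0" by (simp add: u_def)
  qed
  have "(LINT z|circ_meas. 1 * transfer \<alpha>s u z) = (LINT z|circ_meas. 1 * u z * j0 z)"
    by (rule integral_transfer[symmetric]) (use u0 in auto)
  also have "\<dots> = (LINT z|circ_meas. 0)"
    by (rule integral_cong_AE) (use uAE in \<open>auto elim: eventually_mono\<close>)
  finally have zero: "(LINT z|circ_meas. transfer \<alpha>s u z) = 0" by simp
  have "integrable circ_meas (\<lambda>z. 1 * transfer \<alpha>s u z) \<longleftrightarrow> integrable circ_meas (\<lambda>z. 1 * u z * j0 z)"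
    by (rule integrable_transfer_iff[symmetric]) (use u0 in auto)
  also have "\<dots> \<longleftrightarrow> integrable circ_meas (\<lambda>z. 0 :: real)"
    by (rule integrable_cong_AE) (use uAE in \<open>auto elim: eventually_mono\<close>)
  finally have int: "integrable circ_meas (transfer \<alpha>s u)" by simp
  have "AE z in circ_meas. transfer \<alpha>s u z = 0"
    using integral_nonneg_eq_0_iff_AE[OF int] zero transfer_nonneg[of u, OF u0] by simp
  then have "AE z in circ_meas. weight m z \<le> C^2" using AE_circ_norm
  proof eventually_elim
    fix z assume z: "transfer \<alpha>s u z = 0" "cmod z = 1"
    obtain s where s: "z = cis s" using circle_cis[OF z(2)] by blast
    have "(\<Sum>j<N. (cmod (m (cis (unlift (s + 2 * pi * real j)))))^2)
        \<le> (\<Sum>j<N. u (cis (unlift (s + 2 * pi * real j))) + C^2)"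
      by (intro sum_mono) (simp add: u_def)
    also have "\<dots> = (\<Sum>j<N. u (cis (unlift (s + 2 * pi * real j)))) + real N * C^2"
      by (simp add: sum.distrib)
    also have "(\<Sum>j<N. u (cis (unlift (s + 2 * pi * real j)))) = 0"
      using z(1) N_pos unfolding s transfer_cis by simp
    finally show "weight m z \<le> C^2" unfolding s transfer_cis using N_pos by (simp add: field_simps)
  qed
  then show thesis using that[of "C^2"] by simp
qed

lemma LinfT_if_weight_bounded:
  assumes [measurable]: "m \<in> borel_measurable borel" and D: "AE z in circ_meas. weight m z \<le> D"
  shows "m \<in> LinfT"
proof -
  have "AE z in circ_meas. weight m (b z) \<le> D" by (rule AE_compose_blaschke[OF D])
  then have "AE z in circ_meas. cmod (m z) \<le> sqrt (real N * D)" using AE_circ_norm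
  proof eventually_elim
    fix z assume z: "weight m (b z) \<le> D" "cmod z = 1"
    have "(cmod (m z))^2 \<le> real N * weight m (b z)"
      by (rule transfer_ge_at_image[of "\<lambda>z. (cmod (m z))^2", OF _ z(2)]) simp
    also have "\<dots> \<le> real N * D" using z(1) by (intro mult_left_mono) auto
    finally show "cmod (m z) \<le> sqrt (real N * D)" by (rule real_le_rsqrt)
  qed
  then show ?thesis unfolding LinfT_def by auto
qed

lemma weighted_bounded:
  assumes m: "m \<in> LinfT"
  obtains C where "C \<ge> 0" "\<And>f. f \<in> L2T \<Longrightarrow> (\<lambda>z. m z * (Jb z * f (b z))) \<in> L2T"
    "\<And>f. f \<in> L2T \<Longrightarrow> L2norm (\<lambda>z. m z * (Jb z * f (b z))) \<le> C * L2norm f"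
proof -
  have [measurable]: "m \<in> borel_measurable borel" using m by (rule LinfT_measurable)
  obtain D where D: "D \<ge> 0" "AE z in circ_meas. weight m z \<le> D" using weight_bounded[OF m] by blast
  have w: "weight m \<in> borel_measurable borel" by measurable
  show thesis
  proof (rule that[of "sqrt D"])
    fix f assume f: "f \<in> L2T"
    then have [measurable]: "f \<in> borel_measurable borel" by (rule L2T_measurable)
    show "(\<lambda>z. m z * (Jb z * f (b z))) \<in> L2T"
      unfolding L2T_weighted_iff[OF \<open>m \<in> borel_measurable borel\<close> \<open>f \<in> borel_measurable borel\<close>]
      by (rule integrable_weight(1)[OF w weight_nonneg D(2) f])
    have "(L2norm (\<lambda>z. m z * (Jb z * f (b z))))^2 \<le> D * (L2norm f)^2"
      unfolding L2norm_weighted[OF \<open>m \<in> borel_measurable borel\<close> \<open>f \<in> borel_measurable borel\<close>]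
      by (rule integrable_weight(2)[OF w weight_nonneg D(2) f])
    also have "\<dots> = (sqrt D * L2norm f)^2" using D(1) by (simp add: power_mult_distrib)
    finally show "L2norm (\<lambda>z. m z * (Jb z * f (b z))) \<le> sqrt D * L2norm f"
      by (rule power2_le_imp_le) (use D(1) L2norm_nonneg in simp)
  qed (use D in simp)
qed

section \<open>Composition with \<open>b\<close> on L2, H2 and H-infinity\<close>

text \<open>Composition with \<open>b\<close> is the weighted operator whose symbol is
  \<open>1 / Jb\<close>, and that symbol is bounded.\<close>

lemma composition_bounded:
  obtains C where "C \<ge> 0" "\<And>f. f \<in> L2T \<Longrightarrow> f \<circ> b \<in> L2T" "\<And>f. f \<in> L2T \<Longrightarrow> L2norm (f \<circ> b) \<le> C * L2norm f"
proof -
  have e: "(\<lambda>z. inverse (Jb z) * (Jb z * f (b z))) = f \<circ> b" for f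
    using Jb_nonzero by (auto simp: mult.assoc[symmetric])
  show thesis
    by (rule weighted_bounded[of "\<lambda>z. inverse (Jb z)"])
       (use inverse_Jb_HinfT that in \<open>auto simp: e HinfT_def\<close>)
qed

lemma composition_L2T: "f \<in> L2T \<Longrightarrow> f \<circ> b \<in> L2T"
  using composition_bounded by blast

lemma composition_LinfT:
  assumes "\<phi> \<in> LinfT"
  shows "\<phi> \<circ> b \<in> LinfT"
proof -
  obtain C where "AE z in circ_meas. cmod (\<phi> z) \<le> C" using assms by (auto simp: LinfT_def)
  from AE_compose_blaschke[OF this] show ?thesis
    using LinfT_measurable[OF assms] by (auto simp: LinfT_def o_def intro: measurable_compose[OF blaschke_measurable])
qed

lemma composition_poly: "(\<lambda>z. poly p (b z)) \<in> HinfT"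
proof (rule HinfT_holomorphic)
  have h: "(\<lambda>z. poly p (b z)) holomorphic_on dom"
    using holomorphic_on_compose[OF holomorphic_b poly_holomorphic[of p]] by (simp add: o_def)
  then show "continuous_on (cball 0 1) (\<lambda>z. poly p (b z))"
    using holomorphic_on_imp_continuous_on cball_subset_dom continuous_on_subset by blast
  show "(\<lambda>z. poly p (b z)) holomorphic_on ball 0 1"
    using h cball_subset_dom ball_subset_cball holomorphic_on_subset by (metis order_trans)
qed measurable

text \<open>A polynomial in \<open>b\<close> is holomorphic across the circle and so belongs to H2.
  Boundedness of composition and density of polynomials extend this to all of H2.\<close>

lemma composition_H2T:
  assumes f: "f \<in> H2T"
  shows "f \<circ> b \<in> H2T"
proof (rule H2T_closed)
  obtain C where C: "C \<ge> 0" "\<And>f. f \<in> L2T \<Longrightarrow> L2norm (f \<circ> b) \<le> C * L2norm f"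
    by (rule composition_bounded) blast
  show "f \<circ> b \<in> L2T" by (rule composition_L2T[OF H2T_L2T[OF f]])
  fix e :: real assume "e > 0"
  then have "e / (C + 1) > 0" using C(1) by simp
  then obtain p where p: "L2norm (\<lambda>z. f z - poly p z) < e / (C + 1)" using poly_dense[OF f] by blast
  have "L2norm (\<lambda>z. (f \<circ> b) z - poly p (b z)) \<le> C * L2norm (\<lambda>z. f z - poly p z)"
    using C(2)[OF L2T_diff[OF H2T_L2T[OF f] H2T_L2T[OF poly_H2T[of p]]]] by (simp add: o_def)
  also have "\<dots> \<le> C * (e / (C + 1))" using p C(1) by (intro mult_left_mono) auto
  also have "\<dots> < e" using \<open>e > 0\<close> C(1) by (simp add: field_simps)
  finally show "\<exists>h\<in>H2T. L2norm (\<lambda>z. (f \<circ> b) z - h z) < e"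
    using bexI[OF _ HinfT_H2T[OF composition_poly[of p]], of "\<lambda>h. L2norm (\<lambda>z. (f \<circ> b) z - h z) < e"] by simp
qed

lemma composition_HinfT: "\<phi> \<in> HinfT \<Longrightarrow> \<phi> \<circ> b \<in> HinfT"
  using composition_LinfT[of \<phi>] composition_H2T[OF HinfT_H2T, of \<phi>] by (simp add: HinfT_def H2T_def)

lemma Cb_H2T: "f \<in> H2T \<Longrightarrow> Cb \<alpha>s f \<in> H2T"
  using HinfT_mult_H2T[OF Jb_HinfT composition_H2T, of f] by (simp add: Cb_def mult_def Gamma_def)

lemma weighted_AE_cong:
  assumes "AE z in circ_meas. f z = g z"
  shows "AE z in circ_meas. (mult m \<circ> Cb \<alpha>s) f z = (mult m \<circ> Cb \<alpha>s) g z"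
  unfolding weighted_comp_apply using AE_compose_blaschke[OF assms] by eventually_elim simp

lemma bounded_op_weighted:
  assumes m: "m \<in> LinfT"
  shows "bounded_op L2T (mult m \<circ> Cb \<alpha>s)"
proof -
  obtain C where "C \<ge> 0" and C0: "\<And>f. f \<in> L2T \<Longrightarrow> (\<lambda>z. m z * (Jb z * f (b z))) \<in> L2T"
    "\<And>f. f \<in> L2T \<Longrightarrow> L2norm (\<lambda>z. m z * (Jb z * f (b z))) \<le> C * L2norm f"
    by (rule weighted_bounded[OF m]) blast
  have C: "(mult m \<circ> Cb \<alpha>s) f \<in> L2T" "L2norm ((mult m \<circ> Cb \<alpha>s) f) \<le> C * L2norm f" if "f \<in> L2T" for f
    unfolding weighted_comp_apply by (rule C0[OF that])+
  show ?thesis unfolding bounded_op_def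
  proof (intro conjI ballI allI impI exI[of _ C])
    fix f g c
    show "AE z in circ_meas. (mult m \<circ> Cb \<alpha>s) (\<lambda>w. c * f w + g w) z = c * (mult m \<circ> Cb \<alpha>s) f z + (mult m \<circ> Cb \<alpha>s) g z"
      unfolding weighted_comp_apply by (simp add: algebra_simps)
  qed (use C weighted_AE_cong in auto)
qed

lemma
  assumes m: "m \<in> HinfT" and f: "f \<in> H2T"
  shows toeplitz_Cb_H2T: "(toeplitz m \<circ> Cb \<alpha>s) f \<in> H2T"
    and toeplitz_Cb_AE: "AE z in circ_meas. (toeplitz m \<circ> Cb \<alpha>s) f z = (mult m \<circ> Cb \<alpha>s) f z"
  using toeplitz_H2T[OF m Cb_H2T[OF f]] toeplitz_AE[OF m Cb_H2T[OF f]] by (simp_all add: mult_def)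

lemma L2norm_toeplitz_Cb:
  assumes m: "m \<in> HinfT" and f: "f \<in> H2T"
  shows "L2norm ((toeplitz m \<circ> Cb \<alpha>s) f) = L2norm ((mult m \<circ> Cb \<alpha>s) f)"
proof (rule L2norm_cong_AE)
  have ml: "m \<in> LinfT" using m by (simp add: HinfT_def)
  then have "(mult m \<circ> Cb \<alpha>s) f \<in> L2T"
    using bounded_op_weighted[OF ml] H2T_L2T[OF f] unfolding bounded_op_def by blast
  then show "(mult m \<circ> Cb \<alpha>s) f \<in> borel_measurable borel" by (rule L2T_measurable)
qed (use toeplitz_Cb_H2T[OF assms] toeplitz_Cb_AE[OF assms] in \<open>auto intro: L2T_measurable H2T_L2T\<close>)

lemma bounded_op_toeplitz_Cb:
  assumes m: "m \<in> HinfT"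
  shows "bounded_op H2T (toeplitz m \<circ> Cb \<alpha>s)"
proof -
  have ml: "m \<in> LinfT" using m by (simp add: HinfT_def)
  obtain C where C: "\<And>f. f \<in> L2T \<Longrightarrow> L2norm ((mult m \<circ> Cb \<alpha>s) f) \<le> C * L2norm f"
    using bounded_op_weighted[OF ml] unfolding bounded_op_def by blast
  show ?thesis unfolding bounded_op_def
  proof (intro conjI ballI allI impI exI[of _ C])
    fix f assume f: "f \<in> H2T"
    show "(toeplitz m \<circ> Cb \<alpha>s) f \<in> H2T" by (rule toeplitz_Cb_H2T[OF m f])
    show "L2norm ((toeplitz m \<circ> Cb \<alpha>s) f) \<le> C * L2norm f"
      unfolding L2norm_toeplitz_Cb[OF m f] by (rule C[OF H2T_L2T[OF f]])
    fix g assume g: "g \<in> H2T"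
    show "AE z in circ_meas. (toeplitz m \<circ> Cb \<alpha>s) f z = (toeplitz m \<circ> Cb \<alpha>s) g z" if "AE z in circ_meas. f z = g z"
      using toeplitz_Cb_AE[OF m f] toeplitz_Cb_AE[OF m g] weighted_AE_cong[OF that, of m] by eventually_elim simp
    fix c
    show "AE z in circ_meas. (toeplitz m \<circ> Cb \<alpha>s) (\<lambda>w. c * f w + g w) z = c * (toeplitz m \<circ> Cb \<alpha>s) f z + (toeplitz m \<circ> Cb \<alpha>s) g z"
      using toeplitz_Cb_AE[OF m H2T_add[OF f g, of c]] toeplitz_Cb_AE[OF m f] toeplitz_Cb_AE[OF m g]
      by eventually_elim (simp only: weighted_comp_apply, simp add: algebra_simps)
  qed
qed

text \<open>The symbol of an intertwiner \<open>T\<close> is \<open>m = T 1 / J^(1/2)\<close>. It is bounded because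
  \<open>\<integral>|p|\<^sup>2 \<L>(|m|\<^sup>2) = \<parallel>T p\<parallel>\<^sup>2 \<le> C\<^sup>2 \<integral>|p|\<^sup>2\<close> for all polynomials and
  \<open>|m|\<^sup>2 \<le> N \<L>(|m|\<^sup>2) \<circ> b\<close>.\<close>

lemma symbol_LinfT:
  assumes h: "h \<in> L2T"
    and bound: "\<And>p. L2norm (\<lambda>z. poly p (b z) * h z) \<le> C * L2norm (poly p)"
  shows "(\<lambda>z. inverse (Jb z) * h z) \<in> LinfT"
proof -
  have hm [measurable]: "h \<in> borel_measurable borel" using h by (rule L2T_measurable)
  define m where "m z = inverse (Jb z) * h z" for z
  have m [measurable]: "m \<in> borel_measurable borel" unfolding m_def[abs_def] by measurable
  have eq: "(\<lambda>z. m z * (Jb z * f (b z))) = (\<lambda>z. f (b z) * h z)" for f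
    using Jb_nonzero by (auto simp: m_def field_simps)
  have wi: "integrable circ_meas (weight m)"
    using L2T_weighted_iff[OF m, of "\<lambda>_. 1"] eq[of "\<lambda>_. 1"] h by simp
  have "(LINT z|circ_meas. (cmod (poly p z))^2 * (C^2 - weight m z)) \<ge> 0" for p
  proof -
    have pL: "(\<lambda>z. poly p z) \<in> L2T" by (rule H2T_L2T[OF poly_H2T])
    have "(\<lambda>z. poly p (b z) * h z) \<in> L2T"
      using LinfT_mult_L2T[OF _ h, of "\<lambda>z. poly p (b z)"] composition_poly[of p] by (simp add: HinfT_def)
    then have i: "integrable circ_meas (\<lambda>z. (cmod (poly p z))^2 * weight m z)"
      unfolding eq[of "poly p", symmetric] by (subst (asm) L2T_weighted_iff) auto
    have "(LINT z|circ_meas. (cmod (poly p z))^2 * weight m z) = (L2norm (\<lambda>z. m z * (Jb z * poly p (b z))))^2"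
      by (rule L2norm_weighted[symmetric]) auto
    also have "\<dots> \<le> (C * L2norm (poly p))^2" unfolding eq[of "poly p"] by (rule power_mono[OF bound L2norm_nonneg])
    also have "\<dots> = C^2 * (LINT z|circ_meas. (cmod (poly p z))^2)" by (simp add: power_mult_distrib L2norm_power2)
    finally show ?thesis using i L2T_integrable[OF pL] by (simp add: right_diff_distrib mult.commute)
  qed
  then have "AE z in circ_meas. C^2 - weight m z \<ge> 0"
    by (intro AE_nonneg_if_poly_integrals_nonneg) (use wi in auto)
  then have "AE z in circ_meas. weight m z \<le> C^2" by eventually_elim simp
  then show ?thesis using LinfT_if_weight_bounded[OF m] by (simp add: m_def[abs_def])
qed

section \<open>Characterisation of the intertwiners\<close>

lemma intertwiner_L2T_iff:
  assumes T: "bounded_op L2T T"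
  shows "(\<forall>\<phi>\<in>LinfT. op_eq L2T (T \<circ> mult \<phi>) (mult (\<phi> \<circ> b) \<circ> T)) \<longleftrightarrow> (\<exists>m\<in>LinfT. op_eq L2T T (mult m \<circ> Cb \<alpha>s))"
proof
  assume comm: "\<forall>\<phi>\<in>LinfT. op_eq L2T (T \<circ> mult \<phi>) (mult (\<phi> \<circ> b) \<circ> T)"
  define h where "h = T (\<lambda>_. 1)"
  have one: "(\<lambda>_. 1) \<in> L2T" using one_HinfT by (simp add: HinfT_def LinfT_subset_L2T)
  have Tin: "T f \<in> L2T" if "f \<in> L2T" for f using T that unfolding bounded_op_def by blast
  have h: "h \<in> L2T" unfolding h_def by (rule Tin[OF one])
  have T\<phi>: "AE z in circ_meas. T \<phi> z = \<phi> (b z) * h z" if "\<phi> \<in> LinfT" for \<phi>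
    using comm[rule_format, OF that] one unfolding op_eq_def by (auto simp: mult_def h_def)
  obtain C where C: "\<And>f. f \<in> L2T \<Longrightarrow> L2norm (T f) \<le> C * L2norm f" using T unfolding bounded_op_def by blast
  have "L2norm (\<lambda>z. poly p (b z) * h z) \<le> C * L2norm (poly p)" for p
  proof -
    have p: "poly p \<in> LinfT" using poly_HinfT[of p] by (simp add: HinfT_def)
    have "L2norm (\<lambda>z. poly p (b z) * h z) = L2norm (T (poly p))"
      by (rule L2norm_cong_AE)
         (use T\<phi>[OF p] L2T_measurable[OF h] L2T_measurable[OF Tin[OF LinfT_subset_L2T[OF p]]] in \<open>auto elim: eventually_mono\<close>)
    then show ?thesis using C[OF LinfT_subset_L2T[OF p]] by simp
  qed
  then have m: "(\<lambda>z. inverse (Jb z) * h z) \<in> LinfT" by (rule symbol_LinfT[OF h])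
  let ?m = "\<lambda>z. inverse (Jb z) * h z"
  have "op_eq L2T T (mult ?m \<circ> Cb \<alpha>s)"
  \<comment> \<open>The dense set has to consist of bounded functions, because
    \<open>T\<phi>\<close> comes from the intertwining relation for the multiplier
    \<open>\<phi>\<close> applied to 1.\<close>
  proof (rule op_eq_dense[where D = "{\<lambda>z. poly p z / z ^ n | p n. True}", OF _ L2T_diff T bounded_op_weighted[OF m]])
    show "{\<lambda>z. poly p z / z ^ n | p n. True} \<subseteq> L2T" using trig_L2T by blast
    show "\<exists>d\<in>{\<lambda>z. poly p z / z ^ n | p n. True}. L2norm (\<lambda>z. f z - d z) < e" if "f \<in> L2T" "e > 0" for f e
    proof -
      obtain p n where "L2norm (\<lambda>z. f z - poly p z / z ^ n) < e" using trig_dense[OF \<open>f \<in> L2T\<close> \<open>e > 0\<close>] by blast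
      then show ?thesis by (intro bexI[of _ "\<lambda>z. poly p z / z ^ n"]) auto
    qed
    fix d :: "complex \<Rightarrow> complex" assume "d \<in> {\<lambda>z. poly p z / z ^ n | p n. True}"
    then have "d \<in> LinfT" using trig_LinfT by blast
    from T\<phi>[OF this] show "AE z in circ_meas. T d z = (mult ?m \<circ> Cb \<alpha>s) d z"
      unfolding weighted_comp_apply by eventually_elim (use Jb_nonzero in \<open>simp add: field_simps\<close>)
  qed simp
  then show "\<exists>m\<in>LinfT. op_eq L2T T (mult m \<circ> Cb \<alpha>s)" using m by blast
next
  assume "\<exists>m\<in>LinfT. op_eq L2T T (mult m \<circ> Cb \<alpha>s)"
  then obtain m where m: "m \<in> LinfT" "op_eq L2T T (mult m \<circ> Cb \<alpha>s)" by blast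
  have T: "AE z in circ_meas. T f z = m z * (Jb z * f (b z))" if "f \<in> L2T" for f
    using m(2) that unfolding op_eq_def weighted_comp_apply by blast
  show "\<forall>\<phi>\<in>LinfT. op_eq L2T (T \<circ> mult \<phi>) (mult (\<phi> \<circ> b) \<circ> T)"
    unfolding op_eq_def
  proof (intro ballI)
    fix \<phi> f assume \<phi>: "\<phi> \<in> LinfT" and f: "f \<in> L2T"
    have "AE z in circ_meas. T (mult \<phi> f) z = m z * (Jb z * mult \<phi> f (b z))"
      by (rule T) (use LinfT_mult_L2T[OF \<phi> f] in \<open>simp add: mult_def\<close>)
    then show "AE z in circ_meas. (T \<circ> mult \<phi>) f z = (mult (\<phi> \<circ> b) \<circ> T) f z"
      using T[OF f] by eventually_elim (simp add: mult_def)
  qed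
qed

text \<open>For analytic symbols every Toeplitz product equals the pointwise product up to null
  sets, and \<open>T\<close> respects null sets by \<open>Tcong\<close>; this recovers
  \<open>T \<phi> = (\<phi> \<circ> b) * T 1\<close> for bounded analytic
  \<open>\<phi>\<close>.\<close>

lemma intertwiner_H2T_iff:
  assumes T: "bounded_op H2T T"
  shows "(\<forall>\<phi>\<in>HinfT. op_eq H2T (T \<circ> toeplitz \<phi>) (toeplitz (\<phi> \<circ> b) \<circ> T)) \<longleftrightarrow> (\<exists>m\<in>HinfT. op_eq H2T T (toeplitz m \<circ> Cb \<alpha>s))"
proof
  assume comm: "\<forall>\<phi>\<in>HinfT. op_eq H2T (T \<circ> toeplitz \<phi>) (toeplitz (\<phi> \<circ> b) \<circ> T)"
  define h where "h = T (\<lambda>_. 1)"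
  have one: "(\<lambda>_. 1) \<in> H2T" by (rule HinfT_H2T[OF one_HinfT])
  have Tin: "T f \<in> H2T" if "f \<in> H2T" for f using T that unfolding bounded_op_def by blast
  have Tcong: "AE z in circ_meas. T f z = T g z" if "f \<in> H2T" "g \<in> H2T" "AE z in circ_meas. f z = g z" for f g
    using T that unfolding bounded_op_def by blast
  have h: "h \<in> H2T" unfolding h_def by (rule Tin[OF one])
  have T\<phi>: "AE z in circ_meas. T \<phi> z = \<phi> (b z) * h z" if \<phi>: "\<phi> \<in> HinfT" for \<phi>
  proof -
    have "AE z in circ_meas. toeplitz \<phi> (\<lambda>_. 1) z = \<phi> z" using toeplitz_AE[OF \<phi> one] by simp
    then have "AE z in circ_meas. T (toeplitz \<phi> (\<lambda>_. 1)) z = T \<phi> z"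
      by (rule Tcong[OF toeplitz_H2T[OF \<phi> one] HinfT_H2T[OF \<phi>]])
    moreover have "AE z in circ_meas. T (toeplitz \<phi> (\<lambda>_. 1)) z = toeplitz (\<phi> \<circ> b) h z"
      using comm[rule_format, OF \<phi>] one unfolding op_eq_def by (auto simp: h_def)
    moreover have "AE z in circ_meas. toeplitz (\<phi> \<circ> b) h z = (\<phi> \<circ> b) z * h z"
      by (rule toeplitz_AE[OF composition_HinfT[OF \<phi>] h])
    ultimately show ?thesis by eventually_elim simp
  qed
  obtain C where C: "\<And>f. f \<in> H2T \<Longrightarrow> L2norm (T f) \<le> C * L2norm f" using T unfolding bounded_op_def by blast
  have "L2norm (\<lambda>z. poly p (b z) * h z) \<le> C * L2norm (poly p)" for p
  proof -
    have p: "poly p \<in> HinfT" using poly_HinfT[of p] by simp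
    have "L2norm (\<lambda>z. poly p (b z) * h z) = L2norm (T (poly p))"
      by (rule L2norm_cong_AE)
         (use T\<phi>[OF p] L2T_measurable[OF H2T_L2T[OF h]] L2T_measurable[OF H2T_L2T[OF Tin[OF HinfT_H2T[OF p]]]] in \<open>auto elim: eventually_mono\<close>)
    then show ?thesis using C[OF HinfT_H2T[OF p]] by simp
  qed
  then have "(\<lambda>z. inverse (Jb z) * h z) \<in> LinfT" by (rule symbol_LinfT[OF H2T_L2T[OF h]])
  \<comment> \<open>Here the outer choice of the square root enters: its inverse is a bounded
    analytic multiplier, so the symbol has no negative frequencies.\<close>
  moreover have "(\<lambda>z. inverse (Jb z) * h z) \<in> H2T" by (rule HinfT_mult_H2T[OF inverse_Jb_HinfT h])
  ultimately have m: "(\<lambda>z. inverse (Jb z) * h z) \<in> HinfT" by (simp add: HinfT_def H2T_def)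
  let ?m = "\<lambda>z. inverse (Jb z) * h z"
  have "op_eq H2T T (toeplitz ?m \<circ> Cb \<alpha>s)"
  proof (rule op_eq_dense[where D = "range poly", OF _ H2T_diff T bounded_op_toeplitz_Cb[OF m]])
    show "range poly \<subseteq> H2T" using poly_H2T by auto
    show "\<exists>d\<in>range poly. L2norm (\<lambda>z. f z - d z) < e" if "f \<in> H2T" "e > 0" for f e
      using poly_dense[OF that] by blast
    fix d :: "complex \<Rightarrow> complex" assume "d \<in> range poly"
    then have d: "d \<in> HinfT" using poly_HinfT by auto
    show "AE z in circ_meas. T d z = (toeplitz ?m \<circ> Cb \<alpha>s) d z"
      using T\<phi>[OF d] toeplitz_Cb_AE[OF m HinfT_H2T[OF d]] unfolding weighted_comp_apply
      by eventually_elim (use Jb_nonzero in \<open>simp add: field_simps\<close>)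
  qed (use H2T_L2T in auto)
  then show "\<exists>m\<in>HinfT. op_eq H2T T (toeplitz m \<circ> Cb \<alpha>s)" using m by blast
next
  assume "\<exists>m\<in>HinfT. op_eq H2T T (toeplitz m \<circ> Cb \<alpha>s)"
  then obtain m where m: "m \<in> HinfT" "op_eq H2T T (toeplitz m \<circ> Cb \<alpha>s)" by blast
  have Tin: "T f \<in> H2T" if "f \<in> H2T" for f using T that unfolding bounded_op_def by blast
  have Tm: "AE z in circ_meas. T f z = m z * (Jb z * f (b z))" if f: "f \<in> H2T" for f
  proof -
    have "AE z in circ_meas. T f z = (toeplitz m \<circ> Cb \<alpha>s) f z" using m(2) f unfolding op_eq_def by blast
    then show ?thesis using toeplitz_Cb_AE[OF m(1) f] unfolding weighted_comp_apply by eventually_elim simp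
  qed
  show "\<forall>\<phi>\<in>HinfT. op_eq H2T (T \<circ> toeplitz \<phi>) (toeplitz (\<phi> \<circ> b) \<circ> T)"
    unfolding op_eq_def
  proof (intro ballI)
    fix \<phi> f assume \<phi>: "\<phi> \<in> HinfT" and f: "f \<in> H2T"
    show "AE z in circ_meas. (T \<circ> toeplitz \<phi>) f z = (toeplitz (\<phi> \<circ> b) \<circ> T) f z"
      \<comment> \<open>\<open>T\<close> evaluates \<open>toeplitz \<phi> f\<close> at
        \<open>b z\<close>, so the almost everywhere description of that function has to be pulled
        back along \<open>b\<close>.\<close>
      using Tm[OF toeplitz_H2T[OF \<phi> f]] AE_compose_blaschke[OF toeplitz_AE[OF \<phi> f]] Tm[OF f]
        toeplitz_AE[OF composition_HinfT[OF \<phi>] Tin[OF f]]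
      by eventually_elim simp
  qed
qed

section \<open>Operator norms and isometries\<close>

lemma norm_and_isometry_L2T:
  assumes m: "m \<in> LinfT"
  shows "opnorm L2T (mult m \<circ> Cb \<alpha>s) = sqrt (Linf_norm (weight m))"
    and "isometry_on L2T (mult m \<circ> Cb \<alpha>s) \<longleftrightarrow> (AE z in circ_meas. weight m z = 1)"
proof -
  have [measurable]: "m \<in> borel_measurable borel" using m by (rule LinfT_measurable)
  obtain D where D: "AE z in circ_meas. weight m z \<le> D" using weight_bounded[OF m] by blast
  have S: "(L2norm ((mult m \<circ> Cb \<alpha>s) f))^2 = (LINT z|circ_meas. (cmod (f z))^2 * weight m z)" if "f \<in> L2T" for f
    unfolding weighted_comp_apply using L2T_measurable[OF that] by (intro L2norm_weighted) auto
  show "opnorm L2T (mult m \<circ> Cb \<alpha>s) = sqrt (Linf_norm (weight m))"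
    by (rule opnorm_weight[OF _ weight_nonneg D _ _ S]) (auto simp: H2T_L2T poly_H2T)
  show "isometry_on L2T (mult m \<circ> Cb \<alpha>s) \<longleftrightarrow> (AE z in circ_meas. weight m z = 1)"
    by (rule isometry_weight[OF _ weight_nonneg D _ _ S]) (auto simp: H2T_L2T poly_H2T)
qed

lemma norm_and_isometry_H2T:
  assumes m: "m \<in> HinfT"
  shows "opnorm H2T (toeplitz m \<circ> Cb \<alpha>s) = sqrt (Linf_norm (weight m))"
    and "isometry_on H2T (toeplitz m \<circ> Cb \<alpha>s) \<longleftrightarrow> (AE z in circ_meas. weight m z = 1)"
proof -
  have ml: "m \<in> LinfT" using m by (simp add: HinfT_def)
  then have [measurable]: "m \<in> borel_measurable borel" by (rule LinfT_measurable)
  obtain D where D: "AE z in circ_meas. weight m z \<le> D" using weight_bounded[OF ml] by blast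
  have S: "(L2norm ((toeplitz m \<circ> Cb \<alpha>s) f))^2 = (LINT z|circ_meas. (cmod (f z))^2 * weight m z)" if "f \<in> H2T" for f
    unfolding L2norm_toeplitz_Cb[OF m that] weighted_comp_apply
    using L2T_measurable[OF H2T_L2T[OF that]] by (intro L2norm_weighted) auto
  show "opnorm H2T (toeplitz m \<circ> Cb \<alpha>s) = sqrt (Linf_norm (weight m))"
    by (rule opnorm_weight[OF _ weight_nonneg D _ _ S]) (auto simp: H2T_L2T poly_H2T)
  show "isometry_on H2T (toeplitz m \<circ> Cb \<alpha>s) \<longleftrightarrow> (AE z in circ_meas. weight m z = 1)"
    by (rule isometry_weight[OF _ weight_nonneg D _ _ S]) (auto simp: H2T_L2T poly_H2T)
qed

end

theorem theorem4p7:
  fixes \<alpha>s :: "complex list"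
  assumes "\<alpha>s \<noteq> []" and "\<forall>a\<in>set \<alpha>s. cmod a < 1"
  shows
   "(\<forall>T. bounded_op L2T T \<longrightarrow>
       ((\<forall>\<phi>\<in>LinfT. op_eq L2T (T \<circ> mult \<phi>) (mult (\<phi> \<circ> blaschke \<alpha>s) \<circ> T))
        \<longleftrightarrow> (\<exists>m\<in>LinfT. op_eq L2T T (mult m \<circ> Cb \<alpha>s)))) \<and>
    (\<forall>T. bounded_op H2T T \<longrightarrow>
       ((\<forall>\<phi>\<in>HinfT. op_eq H2T (T \<circ> toeplitz \<phi>) (toeplitz (\<phi> \<circ> blaschke \<alpha>s) \<circ> T))
        \<longleftrightarrow> (\<exists>m\<in>HinfT. op_eq H2T T (toeplitz m \<circ> Cb \<alpha>s)))) \<and>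
    (\<forall>m\<in>LinfT.
       opnorm L2T (mult m \<circ> Cb \<alpha>s) = sqrt (Linf_norm (transfer \<alpha>s (\<lambda>z. (cmod (m z))^2))) \<and>
       (isometry_on L2T (mult m \<circ> Cb \<alpha>s) \<longleftrightarrow>
          (AE z in circ_meas. transfer \<alpha>s (\<lambda>z. (cmod (m z))^2) z = 1))) \<and>
    (\<forall>m\<in>HinfT.
       opnorm H2T (toeplitz m \<circ> Cb \<alpha>s) = sqrt (Linf_norm (transfer \<alpha>s (\<lambda>z. (cmod (m z))^2))) \<and>
       (isometry_on H2T (toeplitz m \<circ> Cb \<alpha>s) \<longleftrightarrow>
          (AE z in circ_meas. transfer \<alpha>s (\<lambda>z. (cmod (m z))^2) z = 1)))"
proof -
  interpret finite_blaschke \<alpha>s using assms by unfold_locales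
  show ?thesis
    by (intro conjI allI impI ballI intertwiner_L2T_iff intertwiner_H2T_iff
      norm_and_isometry_L2T norm_and_isometry_H2T)
qed

end
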